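(* Let $n\ge 1$, let $\mathcal H = F^2(\mathbb C^n)$ be the Fock space, and let $A \in \mathcal C_1(\mathcal H)$ be odd, i.e. $UAU = -A$. If $A$ is a Fredholm operator, then its Fredholm index $\operatorname{ind}(A)$ is an odd integer.
   Context: Let $\mu$ be the Gaussian measure $d\mu(z) = (2\pi)^{-n} e^{-|z|^2/2}\,dz$ on $\mathbb C^n$, and let $F^2(\mathbb C^n)$ be the closed subspace of $L^2(\mathbb C^n,\mu)$ consisting of entire functions. For $z\in\mathbb C^n$ let $k_z(w) = e^{\frac{w\cdot\overline z}{2}-\frac{|z|^2}{4}}$ be the normalized reproducing kernel, and define the unitary Weyl operators $W_z$ on $F^2(\mathbb C^n)$ by $W_z f(w) = k_z(w) f(w-z)$. The parity operator is $Uf(z) = f(-z)$. $\mathcal L(\mathcal H)$ denotes the bounded linear operators on $\mathcal H$, and $$\mathcal C_1(\mathcal H) = \{A\in\mathcal L(\mathcal H): \|W_zAW_z^\ast - A\|_{op}\to 0 \text{ as } z\to 0\}.$$ The Fredholm index is $\operatorname{ind}(A) = \dim\ker A - \dim\operatorname{coker} A$. *)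

theory Defs
  imports "HOL-Analysis.Analysis" "HOL-Library.Set_Algebras"
begin

section \<open>Gaussian measure and entire functions\<close>

abbreviation gauss_dens :: "complex^'n::finite \<Rightarrow> real" where
  "gauss_dens z \<equiv> exp (- (norm z)\<^sup>2 / 2) / (2 * pi) ^ CARD('n)"

definition gauss :: "(complex^'n::finite) measure" where
  "gauss = density lborel (\<lambda>z. ennreal (gauss_dens z))"

definition entire :: "(complex^'n::finite \<Rightarrow> complex) \<Rightarrow> bool" where
  "entire f \<longleftrightarrow> (\<forall>z. \<exists>D. (f has_derivative D) (at z) \<and> (\<forall>c v. D (c *s v) = c * D v))"

definition cdot :: "complex^'n::finite \<Rightarrow> complex^'n \<Rightarrow> complex" where
  "cdot w z = (\<Sum>j\<in>UNIV. w $ j * cnj (z $ j))"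

lemma cdot_minus [simp]: "cdot (- w) z = - cdot w z" "cdot w (- z) = - cdot w z"
  by (simp_all add: cdot_def sum_negf)

lemma cdot_diff_left: "cdot (w - v) z = cdot w z - cdot v z"
  by (simp add: cdot_def sum_subtractf algebra_simps)

lemma cnj_cdot: "cnj (cdot w z) = cdot z w"
  by (simp add: cdot_def mult.commute)

lemma Re_cdot: "Re (cdot w z) = w \<bullet> z"
  by (simp add: cdot_def inner_vec_def inner_complex_def)

lemma cdot_self: "cdot z z = of_real ((norm z)\<^sup>2)"
proof (rule complex_eqI)
  show "Re (cdot z z) = Re (of_real ((norm z)\<^sup>2))"
    by (simp add: Re_cdot power2_norm_eq_inner)
  show "Im (cdot z z) = Im (of_real ((norm z)\<^sup>2))"
    by (simp add: cdot_def)
qed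

lemma entire_continuous: "entire f \<Longrightarrow> continuous_on UNIV f"
  unfolding entire_def by (metis continuous_at_imp_continuous_on has_derivative_continuous)

lemma entire_measurable: "entire f \<Longrightarrow> f \<in> borel_measurable borel"
  using entire_continuous borel_measurable_continuous_onI by blast

lemma entire_const: "entire (\<lambda>z. c)"
  unfolding entire_def by (intro allI exI[of _ "\<lambda>_. 0"]) auto

lemma entire_add: assumes "entire f" "entire g" shows "entire (\<lambda>z. f z + g z)"
  unfolding entire_def
proof
  fix z
  obtain D E where "(f has_derivative D) (at z)" "\<forall>c v. D (c *s v) = c * D v"
    "(g has_derivative E) (at z)" "\<forall>c v. E (c *s v) = c * E v"
    using assms unfolding entire_def by meson
  then show "\<exists>D. ((\<lambda>z. f z + g z) has_derivative D) (at z) \<and> (\<forall>c v. D (c *s v) = c * D v)"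
    by (intro exI[of _ "\<lambda>v. D v + E v"]) (auto intro: has_derivative_add simp: algebra_simps)
qed

lemma entire_mult: assumes "entire f" "entire g" shows "entire (\<lambda>z. f z * g z)"
  unfolding entire_def
proof
  fix z
  obtain D E where "(f has_derivative D) (at z)" "\<forall>c v. D (c *s v) = c * D v"
    "(g has_derivative E) (at z)" "\<forall>c v. E (c *s v) = c * E v"
    using assms unfolding entire_def by meson
  then show "\<exists>D. ((\<lambda>z. f z * g z) has_derivative D) (at z) \<and> (\<forall>c v. D (c *s v) = c * D v)"
    by (intro exI[of _ "\<lambda>v. f z * E v + D v * g z"] conjI has_derivative_mult)
       (auto simp: algebra_simps)
qed

lemma entire_cmult: "entire f \<Longrightarrow> entire (\<lambda>z. c * f z)"
  by (intro entire_mult entire_const)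

lemma entire_compose_diff: assumes "entire f" shows "entire (\<lambda>w. f (w - z))"
  unfolding entire_def
proof
  fix w
  obtain D where D: "(f has_derivative D) (at (w - z))" "\<forall>c v. D (c *s v) = c * D v"
    using assms unfolding entire_def by meson
  have "((\<lambda>w. w - z) has_derivative (\<lambda>v. v)) (at w)"
    by (auto intro!: derivative_eq_intros)
  from has_derivative_compose[OF this D(1)] D(2)
  show "\<exists>D. ((\<lambda>w. f (w - z)) has_derivative D) (at w) \<and> (\<forall>c v. D (c *s v) = c * D v)"
    by auto
qed

lemma entire_compose_minus: assumes "entire f" shows "entire (\<lambda>w. f (- w))"
  unfolding entire_def
proof
  fix w
  obtain D where D: "(f has_derivative D) (at (- w))" "\<forall>c v. D (c *s v) = c * D v"
    using assms unfolding entire_def by meson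
  have "((\<lambda>w. - w) has_derivative (\<lambda>v. - v)) (at w)"
    by (auto intro!: derivative_eq_intros)
  from has_derivative_compose[OF this D(1)]
  have "((\<lambda>w. f (- w)) has_derivative (\<lambda>v. D (- v))) (at w)" .
  moreover have "D (- (c *s v)) = c * D (- v)" for c v
    using D(2) by (metis vector_smult_rneg)
  ultimately show "\<exists>D. ((\<lambda>w. f (- w)) has_derivative D) (at w) \<and> (\<forall>c v. D (c *s v) = c * D v)"
    by auto
qed

lemma entire_exp: assumes "entire f" shows "entire (\<lambda>w. exp (f w))"
  unfolding entire_def
proof
  fix w
  obtain D where D: "(f has_derivative D) (at w)" "\<forall>c v. D (c *s v) = c * D v"
    using assms unfolding entire_def by meson
  have "(exp has_derivative (*) (exp (f w))) (at (f w))"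
    using DERIV_exp has_field_derivative_def by blast
  from has_derivative_compose[OF D(1) this] D(2)
  show "\<exists>D. ((\<lambda>w. exp (f w)) has_derivative D) (at w) \<and> (\<forall>c v. D (c *s v) = c * D v)"
    by auto
qed

lemma entire_cdot: "entire (\<lambda>w. cdot w z)"
  unfolding entire_def
proof
  fix w
  have "((\<lambda>w. cdot w z) has_derivative (\<lambda>v. cdot v z)) (at w)"
    unfolding cdot_def
    by (intro has_derivative_sum has_derivative_mult_left
        bounded_linear.has_derivative[OF bounded_linear_vec_nth] has_derivative_ident)
  moreover have "cdot (c *s v) z = c * cdot v z" for c v
    by (simp add: cdot_def sum_distrib_left mult.assoc)
  ultimately show "\<exists>D. ((\<lambda>w. cdot w z) has_derivative D) (at w) \<and> (\<forall>c v. D (c *s v) = c * D v)"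
    by auto
qed

section \<open>The Fock space\<close>

definition sq_integrable :: "(complex^'n::finite \<Rightarrow> complex) \<Rightarrow> bool" where
  "sq_integrable f \<longleftrightarrow> integrable gauss (\<lambda>z. (cmod (f z))\<^sup>2)"

lemma sets_gauss [simp, measurable_cong]: "sets gauss = sets borel"
  by (simp add: gauss_def)

lemma space_gauss [simp]: "space gauss = UNIV"
  by (simp add: gauss_def)

lemma gauss_dens_pos: "gauss_dens z > 0"
  by simp

lemma integrable_gauss_iff:
  fixes f :: "complex^'n::finite \<Rightarrow> 'b::{banach, second_countable_topology}"
  assumes "f \<in> borel_measurable borel"
  shows "integrable gauss f \<longleftrightarrow> integrable lborel (\<lambda>z. gauss_dens z *\<^sub>R f z)"
  unfolding gauss_def using assms by (subst integrable_density) auto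

lemma integral_gauss:
  fixes f :: "complex^'n::finite \<Rightarrow> 'b::{banach, second_countable_topology}"
  assumes "f \<in> borel_measurable borel"
  shows "integral\<^sup>L gauss f = integral\<^sup>L lborel (\<lambda>z. gauss_dens z *\<^sub>R f z)"
  unfolding gauss_def using assms by (subst integral_density) auto

lemma integrable_lborel_shift:
  fixes f :: "complex^'n::finite \<Rightarrow> 'b::{banach, second_countable_topology}"
  assumes "integrable lborel f"
  shows "integrable lborel (\<lambda>w. f (w - z))"
proof -
  have "integrable (distr lborel borel ((+) (- z))) f"
    using assms by (simp add: lborel_distr_plus)
  then have "integrable lborel (\<lambda>w. f ((+) (- z) w))"
    by (rule integrable_distr[rotated]) simp
  then show ?thesis by simp
qed

lemma integral_lborel_shift:
  fixes f :: "complex^'n::finite \<Rightarrow> 'b::{banach, second_countable_topology}"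
  assumes [measurable]: "f \<in> borel_measurable borel"
  shows "integral\<^sup>L lborel (\<lambda>w. f (w - z)) = integral\<^sup>L lborel f"
proof -
  have "integral\<^sup>L lborel f = integral\<^sup>L (distr lborel borel ((+) (- z))) f"
    by (simp add: lborel_distr_plus)
  also have "\<dots> = integral\<^sup>L lborel (\<lambda>w. f ((+) (- z) w))"
    by (rule integral_distr) simp_all
  finally show ?thesis by simp
qed

lemma sq_integrable_mult_cnj:
  assumes "entire f" "entire g" "sq_integrable f" "sq_integrable g"
  shows "integrable gauss (\<lambda>z. f z * cnj (g z))"
proof (rule Bochner_Integration.integrable_bound)
  show "integrable gauss (\<lambda>z. (cmod (f z))\<^sup>2 + (cmod (g z))\<^sup>2)"
    using assms by (simp add: sq_integrable_def)
  have [measurable]: "f \<in> borel_measurable borel" "g \<in> borel_measurable borel"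
    using assms entire_measurable by auto
  have cnj: "cnj \<in> borel_measurable borel"
    by (intro borel_measurable_continuous_onI continuous_intros)
  show "(\<lambda>z. f z * cnj (g z)) \<in> borel_measurable gauss"
    using measurable_compose[OF assms(2)[THEN entire_measurable] cnj] by measurable
  show "AE z in gauss. norm (f z * cnj (g z)) \<le> norm ((cmod (f z))\<^sup>2 + (cmod (g z))\<^sup>2)"
  proof (intro AE_I2)
    fix z
    have "2 * (cmod (f z) * cmod (g z)) \<le> (cmod (f z))\<^sup>2 + (cmod (g z))\<^sup>2"
      using sum_squares_bound[of "cmod (f z)" "cmod (g z)"] by (simp add: mult.assoc)
    moreover have "0 \<le> cmod (f z) * cmod (g z)" by simp
    ultimately have "cmod (f z) * cmod (g z) \<le> (cmod (f z))\<^sup>2 + (cmod (g z))\<^sup>2"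
      by linarith
    then show "norm (f z * cnj (g z)) \<le> norm ((cmod (f z))\<^sup>2 + (cmod (g z))\<^sup>2)"
      by (simp add: norm_mult)
  qed
qed

lemma sq_integrable_add:
  assumes "entire f" "entire g" "sq_integrable f" "sq_integrable g"
  shows "sq_integrable (\<lambda>z. f z + g z)"
  unfolding sq_integrable_def
proof (rule Bochner_Integration.integrable_bound)
  show "integrable gauss (\<lambda>z. 2 * (cmod (f z))\<^sup>2 + 2 * (cmod (g z))\<^sup>2)"
    using assms by (simp add: sq_integrable_def)
  have [measurable]: "f \<in> borel_measurable borel" "g \<in> borel_measurable borel"
    using assms entire_measurable by auto
  show "(\<lambda>z. (cmod (f z + g z))\<^sup>2) \<in> borel_measurable gauss"
    by measurable
  show "AE z in gauss. norm ((cmod (f z + g z))\<^sup>2) \<le> norm (2 * (cmod (f z))\<^sup>2 + 2 * (cmod (g z))\<^sup>2)"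
  proof (intro AE_I2)
    fix z
    have "(cmod (f z + g z))\<^sup>2 \<le> (cmod (f z) + cmod (g z))\<^sup>2"
      by (intro power_mono norm_triangle_ineq) simp
    also have "\<dots> \<le> 2 * (cmod (f z))\<^sup>2 + 2 * (cmod (g z))\<^sup>2"
      using sum_squares_bound[of "cmod (f z)" "cmod (g z)"] by (simp add: power2_sum)
    finally show "norm ((cmod (f z + g z))\<^sup>2) \<le> norm (2 * (cmod (f z))\<^sup>2 + 2 * (cmod (g z))\<^sup>2)"
      by simp
  qed
qed

lemma sq_integrable_cmult: "sq_integrable f \<Longrightarrow> sq_integrable (\<lambda>z. c * f z)"
  by (simp add: sq_integrable_def norm_mult power_mult_distrib)

text \<open>A class in \<open>L\<^sup>2\<close> contains at most one entire function, so elements of the Fock space are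
  represented by functions rather than by classes modulo null sets.\<close>

typedef (overloaded) 'n fock = "{f :: complex^'n::finite \<Rightarrow> complex. entire f \<and> sq_integrable f}"
  by (intro exI[of _ "\<lambda>_. 0"]) (simp add: entire_const sq_integrable_def)

setup_lifting type_definition_fock

lemma entire_Rep: "entire (Rep_fock f)" and sq_integrable_Rep: "sq_integrable (Rep_fock f)"
  using Rep_fock[of f] by auto

definition fock_cinner :: "'n::finite fock \<Rightarrow> 'n fock \<Rightarrow> complex" where
  "fock_cinner f g = (\<integral>z. Rep_fock f z * cnj (Rep_fock g z) \<partial>gauss)"

lift_definition fock_scaleC :: "complex \<Rightarrow> 'n::finite fock \<Rightarrow> 'n fock"  (infixr \<open>*\<^sub>C\<close> 75)
  is "\<lambda>c f z. c * f z"
  by (auto intro: entire_cmult sq_integrable_cmult)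

lemma fock_integrable: "integrable gauss (\<lambda>z. Rep_fock f z * cnj (Rep_fock g z))"
  by (intro sq_integrable_mult_cnj entire_Rep sq_integrable_Rep)

lemma entire_null:
  assumes "entire f" "sq_integrable f" "(\<integral>z. (cmod (f z))\<^sup>2 \<partial>gauss) = 0"
  shows "f = (\<lambda>_. 0)"
proof -
  have [measurable]: "f \<in> borel_measurable borel"
    using assms entire_measurable by auto
  have "AE z in gauss. (cmod (f z))\<^sup>2 = 0"
    using assms integral_nonneg_eq_0_iff_AE[of gauss "\<lambda>z. (cmod (f z))\<^sup>2"]
    by (auto simp: sq_integrable_def)
  then have "AE z in density lborel (\<lambda>z. ennreal (gauss_dens z)). f z = 0"
    unfolding gauss_def by simp
  then have "AE z in lborel. f z = 0"
    by (subst (asm) AE_density) auto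
  moreover have "closed {z. f z = 0}"
    using entire_continuous[OF assms(1)] by (intro closed_Collect_eq) auto
  ultimately have "f z = 0" for z
    using mem_closed_if_AE_lebesgue[of "{z. f z = 0}" z] AE_completion by auto
  then show ?thesis by auto
qed

text \<open>The real inner product is the real part of the Hermitian one; both induce the same norm.\<close>

instantiation fock :: (finite) real_inner
begin

lift_definition zero_fock :: "'a fock" is "\<lambda>_. 0"
  by (simp add: entire_const sq_integrable_def)

lift_definition plus_fock :: "'a fock \<Rightarrow> 'a fock \<Rightarrow> 'a fock" is "\<lambda>f g z. f z + g z"
  by (auto intro: entire_add sq_integrable_add)

definition uminus_fock :: "'a fock \<Rightarrow> 'a fock" where "uminus_fock f = (-1 :: complex) *\<^sub>C f"

definition minus_fock :: "'a fock \<Rightarrow> 'a fock \<Rightarrow> 'a fock" where "minus_fock f g = f + (- g)"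

definition scaleR_fock :: "real \<Rightarrow> 'a fock \<Rightarrow> 'a fock" where "scaleR_fock r f = of_real r *\<^sub>C f"

definition inner_fock :: "'a fock \<Rightarrow> 'a fock \<Rightarrow> real" where "inner_fock f g = Re (fock_cinner f g)"

definition norm_fock :: "'a fock \<Rightarrow> real" where "norm_fock f = sqrt (f \<bullet> f)"

definition sgn_fock :: "'a fock \<Rightarrow> 'a fock" where "sgn_fock f = inverse (norm f) *\<^sub>R f"

definition dist_fock :: "'a fock \<Rightarrow> 'a fock \<Rightarrow> real" where "dist_fock f g = norm (f - g)"

definition uniformity_fock :: "('a fock \<times> 'a fock) filter" where
  "uniformity_fock = (INF e\<in>{0<..}. principal {(x, y). dist x y < e})"

definition open_fock :: "'a fock set \<Rightarrow> bool" where
  "open_fock U \<longleftrightarrow> (\<forall>x\<in>U. \<forall>\<^sub>F (x', y) in uniformity. x' = x \<longrightarrow> y \<in> U)"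

instance
proof
  fix f g h :: "'a fock" and r s :: real and U :: "'a fock set"
  show "f + g + h = f + (g + h)" by transfer (simp add: add.assoc)
  show "f + g = g + f" by transfer (simp add: add.commute)
  show "0 + f = f" by transfer simp
  show "- f + f = 0" unfolding uminus_fock_def by transfer simp
  show "f - g = f + - g" by (simp add: minus_fock_def)
  show "r *\<^sub>R (f + g) = r *\<^sub>R f + r *\<^sub>R g"
    unfolding scaleR_fock_def by transfer (simp add: algebra_simps)
  show "(r + s) *\<^sub>R f = r *\<^sub>R f + s *\<^sub>R f"
    unfolding scaleR_fock_def by transfer (simp add: algebra_simps)
  show "r *\<^sub>R s *\<^sub>R f = (r * s) *\<^sub>R f"
    unfolding scaleR_fock_def by transfer (simp add: algebra_simps)
  show "1 *\<^sub>R f = f" unfolding scaleR_fock_def by transfer simp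
  show "sgn f = inverse (norm f) *\<^sub>R f" by (simp add: sgn_fock_def)
  show "dist f g = norm (f - g)" by (simp add: dist_fock_def)
  show "(uniformity :: ('a fock \<times> 'a fock) filter) = (INF e\<in>{0<..}. principal {(x, y). dist x y < e})"
    by (simp add: uniformity_fock_def)
  show "open U \<longleftrightarrow> (\<forall>x\<in>U. \<forall>\<^sub>F (x', y) in uniformity. x' = x \<longrightarrow> y \<in> U)"
    by (simp add: open_fock_def)
  show "f \<bullet> g = g \<bullet> f"
  proof -
    have "cnj (fock_cinner f g) = fock_cinner g f"
      unfolding fock_cinner_def by (subst Bochner_Integration.integral_cnj[symmetric]) (simp add: mult.commute)
    then show ?thesis unfolding inner_fock_def by (metis complex_cnj_cancel_iff cnj.simps(1))
  qed
  show "(f + g) \<bullet> h = f \<bullet> h + g \<bullet> h"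
    unfolding inner_fock_def fock_cinner_def
    by (simp add: plus_fock.rep_eq distrib_right fock_integrable)
  show "(r *\<^sub>R f) \<bullet> g = r * (f \<bullet> g)"
    unfolding inner_fock_def fock_cinner_def
    by (simp add: scaleR_fock_def fock_scaleC.rep_eq mult.assoc)
  have sq: "f \<bullet> f = (\<integral>z. (cmod (Rep_fock f z))\<^sup>2 \<partial>gauss)"
    unfolding inner_fock_def fock_cinner_def
    by (subst integral_Re[symmetric, OF fock_integrable])
       (simp add: complex_mult_cnj cmod_power2)
  show "0 \<le> f \<bullet> f" unfolding sq by (rule Bochner_Integration.integral_nonneg) simp
  show "f \<bullet> f = 0 \<longleftrightarrow> f = 0"
  proof
    assume "f \<bullet> f = 0"
    then have "Rep_fock f = (\<lambda>_. 0)"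
      using entire_null[OF entire_Rep sq_integrable_Rep] sq by metis
    then show "f = 0" using Rep_fock_inject[of f 0] by (simp add: zero_fock.rep_eq)
  next
    assume "f = 0" then show "f \<bullet> f = 0" unfolding sq by (simp add: zero_fock.rep_eq)
  qed
  show "norm f = sqrt (f \<bullet> f)" by (simp add: norm_fock_def)
qed

end

interpretation fock: vector_space "fock_scaleC :: complex \<Rightarrow> 'n::finite fock \<Rightarrow> 'n fock"
  by unfold_locales (transfer; simp add: algebra_simps)+

section \<open>Weyl operators and parity\<close>

definition nrk :: "complex^'n::finite \<Rightarrow> complex^'n \<Rightarrow> complex" where
  "nrk z w = exp (cdot w z / 2 - of_real ((norm z)\<^sup>2) / 4)"

lemma entire_nrk: "entire (nrk z)"
proof -
  have "entire (\<lambda>w. exp ((1/2) * cdot w z + (- of_real ((norm z)\<^sup>2) / 4)))"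
    by (intro entire_exp entire_add entire_cmult entire_cdot entire_const)
  then show ?thesis unfolding nrk_def[abs_def] by simp
qed

lemma gauss_dens_shift: "gauss_dens w * (cmod (nrk z w))\<^sup>2 = gauss_dens (w - z)"
proof -
  have "(cmod (nrk z w))\<^sup>2 = exp (w \<bullet> z - (norm z)\<^sup>2 / 2)"
    by (simp add: nrk_def Re_cdot flip: exp_double)
  moreover have "- (norm w)\<^sup>2 / 2 + (w \<bullet> z - (norm z)\<^sup>2 / 2) = - (norm (w - z))\<^sup>2 / 2"
    by (simp add: power2_norm_eq_inner inner_diff inner_commute field_simps)
  ultimately show ?thesis
    by (simp flip: exp_add)
qed

lift_definition weyl :: "complex^'n::finite \<Rightarrow> 'n fock \<Rightarrow> 'n fock"
  is "\<lambda>z f w. nrk z w * f (w - z)"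
proof (elim CollectE conjE, intro CollectI conjI)
  fix z :: "complex^'n" and f :: "complex^'n \<Rightarrow> complex" assume f: "entire f" "sq_integrable f"
  show ent: "entire (\<lambda>w. nrk z w * f (w - z))"
    by (intro entire_mult entire_nrk entire_compose_diff f)
  have [measurable]: "f \<in> borel_measurable borel" 
    "(\<lambda>w. nrk z w * f (w - z)) \<in> borel_measurable borel"
    using f ent entire_measurable by auto
  have "integrable lborel (\<lambda>w. gauss_dens w *\<^sub>R (cmod (f w))\<^sup>2)"
    using f by (simp add: sq_integrable_def integrable_gauss_iff)
  then have "integrable lborel (\<lambda>w. gauss_dens (w - z) *\<^sub>R (cmod (f (w - z)))\<^sup>2)"
    by (rule integrable_lborel_shift)
  moreover have "gauss_dens (w - z) *\<^sub>R (cmod (f (w - z)))\<^sup>2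
      = gauss_dens w *\<^sub>R (cmod (nrk z w * f (w - z)))\<^sup>2" for w
    unfolding gauss_dens_shift[symmetric, of w z] norm_mult real_scaleR_def
    by (simp add: power_mult_distrib)
  ultimately have "integrable lborel (\<lambda>w. gauss_dens w *\<^sub>R (cmod (nrk z w * f (w - z)))\<^sup>2)"
    by simp
  then show "sq_integrable (\<lambda>w. nrk z w * f (w - z))"
    unfolding sq_integrable_def by (subst integrable_gauss_iff) simp_all
qed

lift_definition parity :: "'n::finite fock \<Rightarrow> 'n fock" is "\<lambda>f z. f (- z)"
proof (elim CollectE conjE, intro CollectI conjI)
  fix f :: "complex^'n \<Rightarrow> complex" assume f: "entire f" "sq_integrable f"
  show ent: "entire (\<lambda>w. f (- w))"
    by (intro entire_compose_minus f)
  have [measurable]: "f \<in> borel_measurable borel" 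
    using f entire_measurable by auto
  have "(lborel :: (complex^'n) measure) = distr lborel borel uminus"
    using lborel_affine[of "-1" "0 :: complex^'n"] by (simp add: density_1)
  moreover have "integrable lborel (\<lambda>w. gauss_dens w *\<^sub>R (cmod (f w))\<^sup>2)"
    using f by (simp add: sq_integrable_def integrable_gauss_iff)
  ultimately have "integrable (distr lborel borel uminus) (\<lambda>w. gauss_dens w *\<^sub>R (cmod (f w))\<^sup>2)"
    by metis
  then have "integrable lborel (\<lambda>w. gauss_dens (- w) *\<^sub>R (cmod (f (- w)))\<^sup>2)"
    by (rule integrable_distr[rotated]) simp
  then show "sq_integrable (\<lambda>w. f (- w))"
    unfolding sq_integrable_def by (subst integrable_gauss_iff) simp_all
qed

section \<open>Bounded operators, adjoints and the algebra \<open>\<C>\<^sub>1\<close>\<close>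

definition fock_ops :: "('n::finite fock \<Rightarrow> 'n fock) set" where
  "fock_ops = {A. bounded_linear A \<and> (\<forall>c f. A (c *\<^sub>C f) = c *\<^sub>C A f)}"

text \<open>The adjoint with respect to the Hermitian inner product.\<close>

definition fock_adj :: "('n::finite fock \<Rightarrow> 'n fock) \<Rightarrow> 'n fock \<Rightarrow> 'n fock" where
  "fock_adj A = (SOME B. \<forall>f g. fock_cinner (A f) g = fock_cinner f (B g))"

lemma fock_adj_unique:
  assumes "\<And>f g. fock_cinner (A f) g = fock_cinner f (B g)"
  shows "fock_adj A = B"
proof -
  have "\<forall>f g. fock_cinner (A f) g = fock_cinner f (fock_adj A g)"
    unfolding fock_adj_def by (rule someI[of _ B]) (use assms in auto)
  then have "\<forall>f. f \<bullet> fock_adj A g = f \<bullet> B g" for g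
    using assms by (simp add: inner_fock_def)
  then show ?thesis unfolding vector_eq_ldot by (rule ext)
qed

lemma fock_adj_weyl: "fock_adj (weyl z) = weyl (- z)"
proof (rule fock_adj_unique)
  fix f g :: "'a fock"
  let ?f = "Rep_fock f" and ?g = "Rep_fock g"
  have ent: "entire ?f" "entire ?g" "entire (Rep_fock (weyl z f))" "entire (Rep_fock (weyl (-z) g))"
    by (rule entire_Rep)+
  have cnj: "cnj \<in> borel_measurable borel"
    by (intro borel_measurable_continuous_onI continuous_intros)
  note [measurable] = ent[THEN entire_measurable] 
    ent[THEN entire_measurable, THEN measurable_compose, OF cnj]
  let ?h = "\<lambda>w. gauss_dens w *\<^sub>R (?f w * cnj (Rep_fock (weyl (- z) g) w))"
  have key: "gauss_dens w *\<^sub>R (Rep_fock (weyl z f) w * cnj (?g w)) = ?h (w - z)" for w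
  proof -
    have "of_real (gauss_dens w) * nrk z w = of_real (gauss_dens (w - z)) * cnj (nrk (- z) (w - z))"
    proof -
      have "of_real (- (norm w)\<^sup>2 / 2) + (cdot w z / 2 - of_real ((norm z)\<^sup>2) / 4)
        = of_real (- (norm (w - z))\<^sup>2 / 2) + cnj (cdot (w - z) (- z) / 2 - of_real ((norm (- z))\<^sup>2) / 4)"
      proof -
        have "cdot v (w - z) = cdot v w - cdot v z" for v :: "complex^'a"
          by (simp add: cdot_def sum_subtractf algebra_simps)
        then have "of_real ((norm (w - z))\<^sup>2) = cdot w w - cdot z w - cdot w z + cdot z z"
          unfolding cdot_self[symmetric] by (simp add: cdot_diff_left)
        moreover have "cnj (cdot (w - z) (- z) / 2 - of_real ((norm (- z))\<^sup>2) / 4)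
            = (cdot z z - cdot z w) / 2 - cdot z z / 4"
          using cnj_cdot[of w z] cnj_cdot[of z z]
          by (simp add: cdot_diff_left cdot_self[symmetric] del: of_real_power)
        moreover have "of_real (- x / 2) = - (of_real x :: complex) / 2" for x
          by simp
        moreover have "- a / 2 + (b / 2 - d / 4) = - (a - c - b + d) / 2 + ((d - c) / 2 - d / 4)"
          for a b c d :: complex by (simp add: field_simps)
        ultimately show ?thesis
          by (metis cdot_self)
      qed
      then have "exp (of_real (- (norm w)\<^sup>2 / 2)) * nrk z w
         = exp (of_real (- (norm (w - z))\<^sup>2 / 2)) * cnj (nrk (- z) (w - z))"
        unfolding nrk_def exp_cnj exp_add[symmetric] by (rule arg_cong)
      then have *: "of_real (exp (- (norm w)\<^sup>2 / 2)) * nrk z w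
         = of_real (exp (- (norm (w - z))\<^sup>2 / 2)) * cnj (nrk (- z) (w - z))"
        unfolding exp_of_real .
      have "a * n = b * m \<Longrightarrow> a / c * n = b / c * m" for a b c m n :: complex
        by simp
      from this[OF *] show ?thesis
        unfolding of_real_divide .
    qed
    note * = this
    have "a * n = b * m \<Longrightarrow> a * (n * x * y) = b * (x * (m * y))" for a b m n x y :: complex
      by (metis mult.assoc mult.left_commute)
    from this[OF *, of "?f (w - z)" "cnj (?g w)"] show ?thesis
      unfolding weyl.rep_eq scaleR_conv_of_real complex_cnj_mult diff_minus_eq_add diff_add_cancel .
  qed
  have "fock_cinner (weyl z f) g = integral\<^sup>L lborel (\<lambda>w. ?h (w - z))"
    unfolding fock_cinner_def by (subst integral_gauss) (measurable, simp only: key)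
  also have "\<dots> = integral\<^sup>L lborel ?h"
    by (rule integral_lborel_shift) measurable
  also have "\<dots> = fock_cinner f (weyl (- z) g)"
    unfolding fock_cinner_def by (subst integral_gauss) simp_all
  finally show "fock_cinner (weyl z f) g = fock_cinner f (weyl (- z) g)" .
qed

definition fock_C1 :: "('n::finite fock \<Rightarrow> 'n fock) set" where
  "fock_C1 = {A \<in> fock_ops.
     ((\<lambda>z. onorm (\<lambda>f. weyl z (A (fock_adj (weyl z) f)) - A f)) \<longlongrightarrow> 0) (at 0)}"

section \<open>Fredholm operators and index\<close>

definition fock_ker :: "('n::finite fock \<Rightarrow> 'n fock) \<Rightarrow> 'n fock set" where
  "fock_ker A = {f. A f = 0}"

text \<open>For a subspace \<open>R\<close>, the cosets \<open>b + R\<close>, \<open>b \<in> B\<close>, form a (finite) basis of the quotient space: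
  every coset is a linear combination of them with unique coefficients.\<close>

definition quotient_basis :: "'n::finite fock set \<Rightarrow> 'n fock set \<Rightarrow> bool" where
  "quotient_basis R B \<longleftrightarrow> finite B \<and>
     (\<forall>f. \<exists>!c. (\<forall>b. b \<notin> B \<longrightarrow> c b = 0) \<and> f +o R = (\<Sum>b\<in>B. c b *\<^sub>C b) +o R)"

definition quotient_dim :: "'n::finite fock set \<Rightarrow> nat" where
  "quotient_dim R = card (SOME B. quotient_basis R B)"

text \<open>The range of a bounded operator of finite algebraic codimension is automatically closed.\<close>

definition fredholm :: "('n::finite fock \<Rightarrow> 'n fock) \<Rightarrow> bool" where
  "fredholm A \<longleftrightarrow> A \<in> fock_ops \<and> (\<exists>B. finite B \<and> fock.span B = fock_ker A) \<and>
     (\<exists>B. quotient_basis (range A) B)"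

definition fredholm_index :: "('n::finite fock \<Rightarrow> 'n fock) \<Rightarrow> int" where
  "fredholm_index A = int (fock.dim (fock_ker A)) - int (quotient_dim (range A))"

end

theory Submission
  imports Defs "HOL-Probability.Distributions" "HOL-Complex_Analysis.Cauchy_Integral_Formula"
    "HOL-Complex_Analysis.Conformal_Mappings"
begin

text \<open>
  Let \<open>U\<close> be the parity operator and \<open>k z\<close> the coherent states. If the kernels \<open>\<langle>A k w, k z\<rangle>\<close>
  and \<open>\<langle>B k w, k z\<rangle>\<close> decay exponentially in \<open>z - w\<close>, then
  \<open>\<phi> C = \<integral> \<langle>C k (-z), k z\<rangle> dz\<close> converges absolutely on products, since
  \<open>norm (z - w) + norm (z + w) \<ge> norm z + norm w\<close>; Fubini shows that \<open>\<phi> (A B) = - \<phi> (B A)\<close>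
  if \<open>B\<close> is odd. On finite rank operators \<open>\<phi> C = (2 pi)^n Tr (C U)\<close>, whereas \<open>\<phi> 1 = pi^n\<close>.

  Averaging the translates of \<open>A\<close> against a narrow Gaussian changes \<open>A\<close> little in norm, and the
  translates of the average \<open>X\<close> extend to small complex times. A translation by an imaginary time
  moves the two arguments of the kernel in opposite directions, which yields the decay for all
  words in \<open>X\<close> and its adjoint.

  For large \<open>k\<close> the operator \<open>(1 - c X* X)^k\<close> is close to the projection onto the kernel of
  \<open>A\<close>, and the Newton iteration \<open>Y \<mapsto> 3 Y^2 - 2 Y^3\<close> moves it to a projection \<open>P\<close> of the same
  rank. All iterates have the form \<open>1 - B X\<close> with \<open>B\<close> odd, and \<open>1 - X B\<close> converges to a projection
  \<open>P'\<close> of the rank of the cokernel. Hence \<open>\<phi> P + \<phi> P' = 2 \<phi> 1\<close>, that is,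
  \<open>2^n (Tr (P U) + Tr (P' U)) = 2\<close>. So the integer \<open>Tr (P U) + Tr (P' U)\<close>, which has the parity of
  the index, is odd.
\<close>

section \<open>Gaussian integrals and the mean value property\<close>

text \<open>Formally \<open>Tr ((1 - B X) U) + Tr ((1 - X B) U) = 2 Tr U\<close>, because
  \<open>U\<close> anticommutes with \<open>X\<close> and \<open>B\<close>. But \<open>U\<close> is
  unitary and has no trace. The integral over \<open>z\<close> pairs only opposite coherent states,
  where a kernel with off-diagonal decay is small; after division by (2 pi)^n it gives
  \<open>U\<close> the value 2^(-n). Decay is thus the price of the argument. Membership in
  \<open>C1\<close> only says that translates depend continuously on the translation; decay needs an
  orbit that extends analytically, hence the passage to the average \<open>X\<close>. The kernel of
  \<open>X\<close> may be smaller than that of \<open>A\<close>, so the powers of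
  \<open>1 - c S X\<close>, with \<open>S\<close> the adjoint of \<open>X\<close>, need not tend to
  a projection of the right rank. The projection is therefore reached by polynomials, since words in
  \<open>X\<close> and \<open>S\<close> again have continued orbits. At complex times the
  continuations of \<open>X\<close> and \<open>S\<close> are not adjoint to each other, so the
  iteration is estimated in a general normed algebra, near an idempotent. The bounds do not depend
  on the number of iterations; this gives one decay constant for all iterates, and the regularized
  trace passes to the limit.\<close>

lemma nn_integral_lborel_shift:
  fixes f :: "'a::euclidean_space \<Rightarrow> ennreal"
  assumes [measurable]: "f \<in> borel_measurable borel"
  shows "(\<integral>\<^sup>+x. f (x + c) \<partial>lborel) = (\<integral>\<^sup>+x. f x \<partial>lborel)"
proof -
  have "(\<integral>\<^sup>+x. f x \<partial>lborel) = (\<integral>\<^sup>+x. f x \<partial>distr lborel borel ((+) c))"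
    by (simp add: lborel_distr_plus)
  also have "\<dots> = (\<integral>\<^sup>+x. f (c + x) \<partial>lborel)"
    by (rule nn_integral_distr) auto
  finally show ?thesis by (simp add: add.commute)
qed

text \<open>A translation-invariant measure is determined by its value on the unit ball: compute
  \<open>\<integral>\<integral> indicator A x * indicator B (x - T y)\<close> in both orders.\<close>

lemma lborel_isometry:
  fixes T :: "'a::euclidean_space \<Rightarrow> 'a"
  assumes lin: "linear T" and iso: "\<And>x. norm (T x) = norm x" and inv: "\<And>x. T (S x) = x"
  shows "distr lborel borel T = lborel"
proof (rule measure_eqI)
  interpret linear T by (rule lin)
  have [measurable]: "T \<in> borel_measurable borel"
    using lin by (intro borel_measurable_continuous_onI linear_continuous_on linear_conv_bounded_linear[THEN iffD1])
  fix A assume "A \<in> sets (distr lborel borel T)"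
  then have A[measurable]: "A \<in> sets borel" by simp
  define B where "B = cball (0::'a) 1"
  have [measurable]: "B \<in> sets borel" by (simp add: B_def)
  define b where "b = emeasure lborel B"
  have b: "b \<noteq> 0" "b \<noteq> \<infinity>"
  proof -
    \<comment> \<open>The cube with half-side \<open>1 / DIM('a)\<close> lies in the unit ball
      because the Euclidean norm is at most the sum of the absolute coordinates; its volume is
      positive.\<close>
    have "emeasure lborel (box (- (\<Sum>b\<in>Basis. (1/DIM('a)) *\<^sub>R b)) (\<Sum>b\<in>Basis. (1/DIM('a)) *\<^sub>R b) :: 'a set) \<le> b"
      unfolding b_def
    proof (rule emeasure_mono)
      show "box (- (\<Sum>b\<in>Basis. (1/DIM('a)) *\<^sub>R b)) (\<Sum>b\<in>Basis. (1/DIM('a)) *\<^sub>R b) \<subseteq> B"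
      proof
        fix x :: 'a assume "x \<in> box (- (\<Sum>b\<in>Basis. (1/DIM('a)) *\<^sub>R b)) (\<Sum>b\<in>Basis. (1/DIM('a)) *\<^sub>R b)"
        then have "\<bar>x \<bullet> i\<bar> \<le> 1/DIM('a)" if "i \<in> Basis" for i
          using that by (force simp: mem_box inner_sum_left_Basis)
        then have "(\<Sum>i\<in>Basis. \<bar>x \<bullet> i\<bar>) \<le> (\<Sum>i\<in>(Basis::'a set). 1/DIM('a))" by (intro sum_mono) auto
        also have "\<dots> = 1" by simp
        finally show "x \<in> B" using norm_le_l1[of x] by (simp add: B_def)
      qed
    qed simp
    moreover have "emeasure lborel (box (- (\<Sum>b\<in>Basis. (1/DIM('a)) *\<^sub>R b)) (\<Sum>b\<in>Basis. (1/DIM('a)) *\<^sub>R b) :: 'a set) > 0"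
      by (subst emeasure_lborel_box) (auto simp: inner_sum_left_Basis inner_add_left intro!: prod_pos)
    ultimately have "0 < b" by (rule order.strict_trans2[rotated])
    then show "b \<noteq> 0" by simp
    show "b \<noteq> \<infinity>" unfolding b_def B_def using emeasure_bounded_finite[of "cball (0::'a) 1"] by auto
  qed
  \<comment> \<open>\<open>T (S x) = x\<close> turns \<open>x - T y\<close> into
    \<open>T (S x - y)\<close>, so by isometry the ball condition on \<open>x\<close> becomes a
    translate of the ball in \<open>y\<close>.\<close>
  have TB: "indicator B (x - T y) = (indicator B (y + - S x) :: ennreal)" for x y
  proof -
    have "norm (x - T y) = norm (T (S x - y))" by (simp add: diff inv)
    also have "\<dots> = norm (S x - y)" by (rule iso)
    finally show ?thesis by (simp add: B_def indicator_def norm_minus_commute)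
  qed
  have m: "(\<lambda>(x, y). indicator A x * indicator B (x - T y) :: ennreal)
      \<in> borel_measurable (lborel \<Otimes>\<^sub>M lborel)" by measurable
  have "(\<integral>\<^sup>+y. \<integral>\<^sup>+x. indicator A x * indicator B (x - T y) \<partial>lborel \<partial>lborel)
      = (\<integral>\<^sup>+x. \<integral>\<^sup>+y. indicator A x * indicator B (x - T y) \<partial>lborel \<partial>lborel)"
    using lborel_pair.Fubini'[OF m] .
  also have "\<dots> = (\<integral>\<^sup>+x. indicator A x * b \<partial>lborel)"
    unfolding TB by (subst nn_integral_cmult, measurable)
      (subst nn_integral_lborel_shift[of "indicator B"], auto simp: b_def)
  also have "\<dots> = emeasure lborel A * b" by (subst nn_integral_multc) auto
  finally have 1: "(\<integral>\<^sup>+y. \<integral>\<^sup>+x. indicator A x * indicator B (x - T y) \<partial>lborel \<partial>lborel) = emeasure lborel A * b" .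
  have "(\<integral>\<^sup>+x. indicator A x * indicator B (x - T y) \<partial>lborel)
     = (\<integral>\<^sup>+x. indicator A (x + T y) * indicator B x \<partial>lborel)" for y
    using nn_integral_lborel_shift[of "\<lambda>x. indicator A x * indicator B (x - T y)" "T y"] by simp
  then have "emeasure lborel A * b = (\<integral>\<^sup>+y. \<integral>\<^sup>+x. indicator A (x + T y) * indicator B x \<partial>lborel \<partial>lborel)"
    using 1 by simp
  also have "\<dots> = (\<integral>\<^sup>+x. \<integral>\<^sup>+y. indicator A (x + T y) * indicator B x \<partial>lborel \<partial>lborel)"
    by (rule lborel_pair.Fubini') measurable
  also have "\<dots> = (\<integral>\<^sup>+x. (\<integral>\<^sup>+y. indicator A (T (y + S x)) \<partial>lborel) * indicator B x \<partial>lborel)"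
    by (subst nn_integral_multc) (auto simp: add inv add.commute)
  also have "\<dots> = (\<integral>\<^sup>+x. emeasure (distr lborel borel T) A * indicator B x \<partial>lborel)"
  proof -
    have "(\<integral>\<^sup>+y. indicator A (T (y + S x)) \<partial>lborel) = emeasure (distr lborel borel T) A" for x
    proof -
      have "(\<integral>\<^sup>+y. indicator A (T (y + S x)) \<partial>lborel) = (\<integral>\<^sup>+y. indicator A (T y) \<partial>lborel)"
        by (rule nn_integral_lborel_shift[of "\<lambda>y. indicator A (T y)"]) measurable
      also have "\<dots> = (\<integral>\<^sup>+y. indicator A y \<partial>distr lborel borel T)"
        by (rule nn_integral_distr[symmetric]) auto
      finally show ?thesis by simp
    qed
    then show ?thesis by simp
  qed
  also have "\<dots> = emeasure (distr lborel borel T) A * b"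
    by (simp add: nn_integral_cmult b_def)
  finally show "emeasure (distr lborel borel T) A = emeasure lborel A"
    using b by (simp add: ennreal_mult_cancel_left mult.commute[of _ b])
qed simp

lemma gaussian_real:
  assumes c: "c > (0::real)"
  shows "(\<integral>\<^sup>+x. ennreal (exp (- c * x\<^sup>2)) \<partial>lborel) = ennreal (sqrt (pi / c))"
proof -
  \<comment> \<open>The standard deviation for which the normal density is a multiple of the given
    Gaussian.\<close>
  define s where "s = sqrt (1 / (2 * c))"
  have s: "s > 0" "s\<^sup>2 = 1 / (2 * c)" using c by (auto simp: s_def)
  have "has_bochner_integral lborel (normal_density 0 s) 1"
    using integrable_normal_moment[OF s(1), of 0 0] integral_normal_density[OF s(1), of 0]
    by (simp add: has_bochner_integral_iff s)
  then have "has_bochner_integral lborel (\<lambda>x. sqrt (pi / c) * normal_density 0 s x) (sqrt (pi / c))"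
    using has_bochner_integral_mult_right[of "sqrt (pi / c)" lborel "normal_density 0 s" 1] by simp
  moreover have "sqrt (pi / c) * normal_density 0 s x = exp (- c * x\<^sup>2)" for x
    using c s by (simp add: normal_density_def)
  ultimately have "has_bochner_integral lborel (\<lambda>x. exp (- c * x\<^sup>2)) (sqrt (pi / c))" by simp
  then show ?thesis
    by (subst nn_integral_eq_integral) (auto simp: has_bochner_integral_iff)
qed

lemma gaussian_nn:
  assumes "c > (0::real)"
  shows "(\<integral>\<^sup>+(z::complex^'n::finite). ennreal (exp (- c * (norm z)\<^sup>2)) \<partial>lborel) = ennreal ((pi / c) ^ CARD('n))"
proof -
  have dim: "DIM(complex^'n) = 2 * CARD('n)" by simp
  have "exp (- c * (norm z)\<^sup>2) = (\<Prod>b\<in>Basis. exp (- c * (z \<bullet> b)\<^sup>2))" for z :: "complex^'n"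
  proof -
    have "(norm z)\<^sup>2 = (\<Sum>b\<in>Basis. (z \<bullet> b)\<^sup>2)"
      by (subst power2_norm_eq_inner, subst euclidean_inner) (simp add: power2_eq_square)
    then show ?thesis by (simp add: exp_sum[symmetric] sum_distrib_left)
  qed
  then have "(\<integral>\<^sup>+(z::complex^'n). ennreal (exp (- c * (norm z)\<^sup>2)) \<partial>lborel)
     = (\<integral>\<^sup>+(z::complex^'n). (\<Prod>b\<in>Basis. ennreal (exp (- c * (z \<bullet> b)\<^sup>2))) \<partial>lborel)"
    by (simp only: prod_ennreal exp_ge_zero)
  also have "\<dots> = (\<Prod>b\<in>(Basis::(complex^'n) set). \<integral>\<^sup>+x. ennreal (exp (- c * x\<^sup>2)) \<partial>lborel)"
    by (rule nn_integral_lborel_prod) auto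
  also have "\<dots> = ennreal (sqrt (pi / c) ^ (2 * CARD('n)))"
    unfolding gaussian_real[OF assms] prod_constant dim using assms by (subst ennreal_power) auto
  also have "sqrt (pi / c) ^ (2 * CARD('n)) = (pi / c) ^ CARD('n)"
    using assms by (simp add: power_mult)
  finally show ?thesis .
qed

lemma gaussian_integrable: "c > (0::real) \<Longrightarrow> integrable lborel (\<lambda>z::complex^'n::finite. exp (- c * (norm z)\<^sup>2))"
  by (rule integrableI_nonneg) (auto simp: gaussian_nn[simplified])

lemma gaussian_integral: "c > (0::real) \<Longrightarrow> (\<integral>(z::complex^'n::finite). exp (- c * (norm z)\<^sup>2) \<partial>lborel) = (pi / c) ^ CARD('n)"
  by (subst integral_eq_nn_integral) (auto simp: gaussian_nn[simplified])

text \<open>Half of the Gaussian absorbs the linear term, since b r <= b^2 / (2 c) + (c / 2) r^2.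
  Gaussians with a complex centre are dominated by functions of this kind.\<close>

lemma gaussian_integrable_linear:
  assumes "c > 0"
  shows "integrable lborel (\<lambda>z::complex^'n::finite. exp (- c * (norm z)\<^sup>2 + b * norm z))"
proof (rule Bochner_Integration.integrable_bound)
  show "integrable lborel (\<lambda>z::complex^'n. exp (b\<^sup>2 / (2 * c)) * exp (- (c/2) * (norm z)\<^sup>2))"
    using gaussian_integrable[of "c/2"] assms by auto
  have "- c * r\<^sup>2 + b * r \<le> b\<^sup>2 / (2 * c) + - (c/2) * r\<^sup>2" for r
  proof -
    have "0 \<le> (c * r - b)\<^sup>2 / (2 * c)" using assms by simp
    also have "\<dots> = c/2 * r\<^sup>2 - b * r + b\<^sup>2 / (2 * c)" using assms by (simp add: power2_eq_square field_simps)
    finally show ?thesis by simp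
  qed
  then show "AE z::complex^'n in lborel. norm (exp (- c * (norm z)\<^sup>2 + b * norm z))
      \<le> norm (exp (b\<^sup>2 / (2 * c)) * exp (- (c/2) * (norm z)\<^sup>2))"
    by (intro AE_I2) (simp flip: exp_add)
qed simp

text \<open>A product of one-dimensional two-sided exponentials dominates the radial one: the
  absolute coordinates add up to at most \<open>D * norm z\<close>, hence the rate
  \<open>d / D\<close>.\<close>

lemma exp_norm_integrable:
  assumes "d > 0"
  shows "integrable lborel (\<lambda>z::complex^'n::finite. exp (- d * norm z))"
proof (rule integrableI_nonneg)
  define D where "D = real (DIM(complex^'n))"
  have D: "D > 0" by (simp add: D_def)
  define a where "a = d / D"
  have a: "a > 0" using assms D by (simp add: a_def)
  have fin: "(\<integral>\<^sup>+x. ennreal (exp (- a * \<bar>x\<bar>)) \<partial>lborel) < \<infinity>"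
  proof -
    have one: "(\<integral>\<^sup>+x. ennreal (exponential_density a x) \<partial>lborel) = 1"
      using prob_space.emeasure_space_1[OF prob_space_exponential_density[OF a]]
      by (simp add: emeasure_density)
    have "distr lborel borel uminus = (lborel :: real measure)" by (rule lborel_distr_uminus)
    then have two: "(\<integral>\<^sup>+x. ennreal (exponential_density a (- x)) \<partial>lborel) = 1"
      using nn_integral_distr[of uminus lborel borel "\<lambda>x. ennreal (exponential_density a x)"] one by simp
    have "(\<integral>\<^sup>+x. ennreal (exp (- a * \<bar>x\<bar>)) \<partial>lborel)
      \<le> (\<integral>\<^sup>+x. ennreal (1/a) * (ennreal (exponential_density a x) + ennreal (exponential_density a (- x))) \<partial>lborel)"
      using a by (intro nn_integral_mono)
        (auto simp: exponential_density_def abs_if mult.commute simp flip: ennreal_mult ennreal_plus)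
    also have "\<dots> = ennreal (1/a) * (1 + 1)"
      by (subst nn_integral_cmult, simp, subst nn_integral_add) (auto simp: one two)
    also have "\<dots> < \<infinity>" by (simp add: ennreal_mult_less_top)
    finally show ?thesis .
  qed
  have "exp (- d * norm z) \<le> (\<Prod>b\<in>Basis. exp (- a * \<bar>z \<bullet> b\<bar>))" for z :: "complex^'n"
  proof -
    have "(\<Sum>b\<in>Basis. \<bar>z \<bullet> b\<bar>) \<le> (\<Sum>b\<in>(Basis::(complex^'n) set). norm z)" by (intro sum_mono Basis_le_norm)
    also have "\<dots> = D * norm z" by (simp add: D_def)
    finally have "a * (\<Sum>b\<in>Basis. \<bar>z \<bullet> b\<bar>) \<le> a * (D * norm z)" using a by (intro mult_left_mono) auto
    then have "a * (\<Sum>b\<in>Basis. \<bar>z \<bullet> b\<bar>) \<le> d * norm z" using D by (simp add: a_def)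
    then show ?thesis by (simp add: exp_sum[symmetric] sum_distrib_left sum_negf)
  qed
  then have "(\<integral>\<^sup>+(z::complex^'n). ennreal (exp (- d * norm z)) \<partial>lborel)
      \<le> (\<integral>\<^sup>+(z::complex^'n). (\<Prod>b\<in>Basis. ennreal (exp (- a * \<bar>z \<bullet> b\<bar>))) \<partial>lborel)"
    by (intro nn_integral_mono) (auto simp: prod_ennreal intro!: ennreal_leI)
  also have "\<dots> = (\<Prod>b\<in>(Basis::(complex^'n) set). \<integral>\<^sup>+x. ennreal (exp (- a * \<bar>x\<bar>)) \<partial>lborel)"
    by (rule nn_integral_lborel_prod) auto
  also have "\<dots> < \<infinity>" unfolding prod_constant using fin by (simp add: power_less_top_ennreal)
  finally show "(\<integral>\<^sup>+(z::complex^'n). ennreal (exp (- d * norm z)) \<partial>lborel) < \<infinity>" .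
qed auto

lemma gauss_total: "integrable gauss (\<lambda>z::complex^'n::finite. 1::real)" "(\<integral>(z::complex^'n::finite). (1::complex) \<partial>gauss) = 1"
proof -
  have *: "gauss_dens z = exp (- (1/2) * (norm z)\<^sup>2) / (2 * pi) ^ CARD('n)" for z :: "complex^'n"
    by simp
  show "integrable gauss (\<lambda>z::complex^'n::finite. 1::real)"
    unfolding integrable_gauss_iff[OF borel_measurable_const] *
    using gaussian_integrable[of "1/2", where 'n='n] by simp
  have "(\<integral>z. gauss_dens z \<partial>(lborel :: (complex^'n) measure)) = 1"
    unfolding * using gaussian_integral[of "1/2", where 'n='n] by simp
  moreover have "(\<integral>(z::complex^'n::finite). (1::complex) \<partial>gauss) = (\<integral>z. complex_of_real (gauss_dens z) \<partial>(lborel :: (complex^'n) measure))"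
    by (subst integral_gauss) (auto simp: scaleR_conv_of_real)
  ultimately show "(\<integral>(z::complex^'n::finite). (1::complex) \<partial>gauss) = 1" by (simp only: integral_complex_of_real of_real_1)
qed

lift_definition vac :: "'n::finite fock" is "\<lambda>_. 1"
  using gauss_total(1) by (auto simp: sq_integrable_def entire_const)

section \<open>Complex lines, rotations and the mean value property\<close>

lemma norm_vec_smult: "norm (c *s z) = cmod c * norm (z :: complex^'n::finite)"
  by (simp add: norm_vec_def norm_mult L2_set_right_distrib)

lemma has_derivative_line:
  "((\<lambda>t. z + t *s v) has_derivative (\<lambda>c. c *s (v :: complex^'n::finite))) (at t)"
proof -
  have "((\<lambda>t. z + t *s v) has_derivative (\<lambda>c. 0 + c *s v)) (at t)"
    by (intro has_derivative_add has_derivative_const bounded_linear_imp_has_derivative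
        bounded_linear_intro[where K="norm v"])
      (auto simp: vec_eq_iff norm_vec_smult algebra_simps)
  then show ?thesis by simp
qed

text \<open>Restriction to complex lines reduces several variables to one: Cauchy's formula,
  Cauchy's inequality and the identity theorem are applied to such slices.\<close>

lemma entire_line_holomorphic:
  assumes "entire f"
  shows "(\<lambda>t. f (z + t *s v)) holomorphic_on UNIV"
  unfolding holomorphic_on_def
proof
  fix t
  obtain D where D: "(f has_derivative D) (at (z + t *s v))" "\<And>c v. D (c *s v) = c * D v"
    using assms unfolding entire_def by metis
  from has_derivative_compose[OF has_derivative_line D(1)] D(2)
  have "((\<lambda>t. f (z + t *s v)) has_derivative (\<lambda>c. c * D v)) (at t)" by simp
  then have "((\<lambda>t. f (z + t *s v)) has_field_derivative D v) (at t)"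
    by (simp add: has_field_derivative_def mult_commute_abs)
  then show "(\<lambda>t. f (z + t *s v)) field_differentiable at t within UNIV"
    unfolding field_differentiable_def by auto
qed

lemma entire_circle_mean:
  fixes f :: "complex^'n::finite \<Rightarrow> complex"
  assumes "entire f"
  shows "((\<lambda>t. f (exp (2 * of_real pi * \<i> * of_real t) *s z)) has_integral f 0) {0..1}"
proof -
  let ?h = "\<lambda>t. f (t *s z)"
  have "?h holomorphic_on cball 0 1"
    using holomorphic_on_subset[OF entire_line_holomorphic[OF assms, of 0 z]] by simp
  have [simp]: "(0::complex) *s z = 0" by (simp add: vec_eq_iff)
  from Cauchy_integral_circlepath_simple[OF \<open>?h holomorphic_on cball 0 1\<close>, of 0]
  have "((\<lambda>u. ?h u / u) has_contour_integral (2 * of_real pi * \<i> * f 0)) (circlepath 0 1)" by simp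
  then have "((\<lambda>x. ?h (circlepath 0 1 x) / circlepath 0 1 x * vector_derivative (circlepath 0 1) (at x within {0..1}))
      has_integral (2 * of_real pi * \<i> * f 0)) {0..1}"
    unfolding has_contour_integral_def by simp
  then have "((\<lambda>t. 2 * of_real pi * \<i> * f (exp (2 * of_real pi * \<i> * of_real t) *s z))
     has_integral (2 * of_real pi * \<i> * f 0)) {0..1}"
  proof (rule has_integral_eq[rotated])
    fix x :: real assume x: "x \<in> {0..1}"
    have "vector_derivative (circlepath 0 1) (at x within {0..1}) = 2 * of_real pi * \<i> * exp (2 * of_real pi * \<i> * of_real x)"
      using vector_derivative_circlepath01[of x 0 1] x by simp
    then show "?h (circlepath 0 1 x) / circlepath 0 1 x * vector_derivative (circlepath 0 1) (at x within {0..1})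
        = 2 * of_real pi * \<i> * f (exp (2 * of_real pi * \<i> * of_real x) *s z)"
      by (simp only:) (simp add: circlepath)
  qed
  from has_integral_mult_right[OF this, of "1 / (2 * of_real pi * \<i>)"] show ?thesis by simp
qed

lemma linear_vec_smult: "linear ((*s) (c::complex) :: complex^'n::finite \<Rightarrow> _)"
  by (rule linearI) (auto simp: vec_eq_iff algebra_simps)

text \<open>Unimodular scalars act as isometries. Besides the circle average, the case
  \<open>c = -1\<close> justifies the substitution of \<open>- z\<close> for
  \<open>z\<close>.\<close>

lemma integral_lborel_rotate:
  fixes f :: "complex^'n::finite \<Rightarrow> 'b::{banach, second_countable_topology}"
  assumes [measurable]: "f \<in> borel_measurable borel" and c: "cmod c = 1"
  shows "integrable lborel (\<lambda>z. f (c *s z)) \<longleftrightarrow> integrable lborel f"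
    and "(\<integral>z. f (c *s z) \<partial>lborel) = (\<integral>z. f z \<partial>lborel)"
proof -
  have [measurable]: "(*s) c \<in> borel_measurable (borel :: (complex^'n) measure)"
    by (intro borel_measurable_continuous_onI linear_continuous_on linear_conv_bounded_linear[THEN iffD1] linear_vec_smult)
  have "c \<noteq> 0" using c by auto
  then have d: "distr lborel borel ((*s) c :: complex^'n \<Rightarrow> _) = lborel"
    by (intro lborel_isometry[where S="(*s) (inverse c)"] linear_vec_smult) (auto simp: norm_vec_smult c)
  show "integrable lborel (\<lambda>z. f (c *s z)) \<longleftrightarrow> integrable lborel f"
    by (subst (2) d[symmetric], subst integrable_distr_eq) auto
  show "(\<integral>z. f (c *s z) \<partial>lborel) = (\<integral>z. f z \<partial>lborel)"
    by (subst (2) d[symmetric], subst integral_distr) auto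
qed

lemma fock_integrable1: "integrable gauss (Rep_fock f)"
  using fock_integrable[of f vac] by (simp add: vac.rep_eq)

lemma continuous_vec_smult: "continuous_on S (\<lambda>x. fst x *s (snd x :: complex^'n::finite))"
  by (rule continuous_on_eq[where f="\<lambda>x. \<chi> i. fst x * snd x $ i"])
     (auto simp: vec_eq_iff intro!: continuous_intros)

text \<open>The circle action preserves the Gaussian measure, while the circle average of an entire
  function is its value at the origin; Fubini exchanges the two integrals. This is the reproducing
  property at the origin.\<close>

lemma fock_mean: "(\<integral>z. Rep_fock f z \<partial>gauss) = Rep_fock f 0" for f :: "'n::finite fock"
proof -
  let ?f = "Rep_fock f"
  let ?e = "\<lambda>t::real. exp (2 * of_real pi * \<i> * of_real t)"
  have cf: "continuous_on S ?f" for S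
    using entire_continuous[OF entire_Rep] continuous_on_subset by blast
  have [measurable]: "?f \<in> borel_measurable borel" by (rule entire_measurable[OF entire_Rep])
  let ?g = "\<lambda>t z. gauss_dens z *\<^sub>R ?f (?e t *s z)"
  have e: "cmod (?e t) = 1" for t by (simp add: norm_exp_eq_Re)
  have c2: "continuous_on UNIV (\<lambda>(t, z). ?f (?e t *s z))"
    unfolding case_prod_beta
    by (rule continuous_on_compose2[OF cf[of UNIV]], rule continuous_on_compose2[OF continuous_vec_smult[of UNIV], of _ "\<lambda>p. (?e (fst p), snd p)", simplified])
       (auto intro!: continuous_intros)
  have m2: "(\<lambda>(t, z). ?f (?e t *s z)) \<in> borel_measurable (borel \<Otimes>\<^sub>M borel)"
    unfolding borel_prod by (rule borel_measurable_continuous_onI[OF c2])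
  have meas: "(\<lambda>(t, z). indicator {0..1} t *\<^sub>R ?g t z) \<in> borel_measurable (lborel \<Otimes>\<^sub>M (lborel :: (complex^'n) measure))"
    using m2 unfolding case_prod_beta by measurable
  have gi: "integrable lborel (\<lambda>z. gauss_dens z *\<^sub>R ?f z)"
    using fock_integrable1[of f] by (subst (asm) integrable_gauss_iff) auto
  have shift: "integrable lborel (?g t)" "(\<integral>z. ?g t z \<partial>lborel) = (\<integral>z. gauss_dens z *\<^sub>R ?f z \<partial>lborel)"
    "(\<integral>z. norm (?g t z) \<partial>lborel) = (\<integral>z. norm (gauss_dens z *\<^sub>R ?f z) \<partial>lborel)" for t
    using integral_lborel_rotate[of "\<lambda>z. gauss_dens z *\<^sub>R ?f z" "?e t"] gi e[of t]
     integral_lborel_rotate[of "\<lambda>z. norm (gauss_dens z *\<^sub>R ?f z)" "?e t"]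
    by (simp_all add: norm_vec_smult)
  have int: "integrable (lborel \<Otimes>\<^sub>M (lborel :: (complex^'n) measure)) (\<lambda>(t, z). indicator {0..1} t *\<^sub>R ?g t z)"
  proof (rule lborel_pair.Fubini_integrable[OF meas])
    have "integrable lborel (\<lambda>t::real. indicator {0..1} t *\<^sub>R (\<integral>z. norm (gauss_dens z *\<^sub>R ?f z) \<partial>lborel))"
      by (intro integrable_scaleR_left) auto
    moreover have "(\<integral>z. norm (case (t, z) of (t, z) \<Rightarrow> indicator {0..1} t *\<^sub>R ?g t z) \<partial>lborel)
        = indicator {0..1} t *\<^sub>R (\<integral>z. norm (gauss_dens z *\<^sub>R ?f z) \<partial>lborel)" for t :: real
    proof -
      have "(\<integral>z. norm (case (t, z) of (t, z) \<Rightarrow> indicator {0..1} t *\<^sub>R ?g t z) \<partial>lborel)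
        = (\<integral>z. indicator {0..1} t *\<^sub>R norm (?g t z) \<partial>lborel)"
        by (intro Bochner_Integration.integral_cong) (auto simp: indicator_def)
      then show ?thesis by (simp only: integral_scaleR_right shift)
    qed
    ultimately show "integrable lborel (\<lambda>t. \<integral>z. norm (case (t, z) of (t, z) \<Rightarrow> indicator {0..1} t *\<^sub>R ?g t z) \<partial>lborel)"
      by simp
    show "AE t in lborel. integrable lborel (\<lambda>z. case (t, z) of (t, z) \<Rightarrow> indicator {0..1} t *\<^sub>R ?g t z)"
      by (intro AE_I2, simp only: prod.case) (rule integrable_scaleR_right, rule shift(1))
  qed
  have inner: "(\<integral>t. indicator {0..1} t *\<^sub>R ?g t z \<partial>lborel) = gauss_dens z *\<^sub>R ?f 0" for z
  proof -
    have c: "continuous_on {0..1} (\<lambda>t. ?f (?e t *s z))"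
      using continuous_on_compose2[OF c2, of "{0..1}" "\<lambda>t. (t, z)"]
        continuous_on_Pair[OF continuous_on_id continuous_on_const, of "{0..1}" z] by auto
    have "set_integrable lborel {0..1} (\<lambda>t. ?f (?e t *s z))"
      by (rule borel_integrable_atLeastAtMost') (rule c)
    from set_borel_integral_eq_integral(2)[OF this]
    have "(LINT t:{0..1}|lborel. ?f (?e t *s z)) = integral {0..1} (\<lambda>t. ?f (?e t *s z))" .
    also have "\<dots> = ?f 0" by (rule integral_unique, rule entire_circle_mean[OF entire_Rep])
    finally have "(\<integral>t. indicator {0..1} t *\<^sub>R ?f (?e t *s z) \<partial>lborel) = ?f 0"
      by (simp add: set_lebesgue_integral_def)
    moreover have "(\<integral>t. indicator {0..1} t *\<^sub>R ?g t z \<partial>lborel) = (\<integral>t. gauss_dens z *\<^sub>R (indicator {0..1} t *\<^sub>R ?f (?e t *s z)) \<partial>lborel)"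
      by (intro Bochner_Integration.integral_cong) (auto simp: indicator_def)
    ultimately show ?thesis by (simp only: integral_scaleR_right)
  qed
  have "(\<integral>z. ?f z \<partial>gauss) = (\<integral>z. gauss_dens z *\<^sub>R ?f z \<partial>lborel)" by (rule integral_gauss) simp
  also have "\<dots> = (\<integral>t. indicator {0..1} t *\<^sub>R (\<integral>z. gauss_dens z *\<^sub>R ?f z \<partial>lborel) \<partial>(lborel::real measure))"
    by (subst integral_scaleR_left) auto
  also have "\<dots> = (\<integral>t. \<integral>z. indicator {0..1} t *\<^sub>R ?g t z \<partial>lborel \<partial>lborel)"
    by (simp only: integral_scaleR_right shift)
  also have "\<dots> = (\<integral>z. \<integral>t. indicator {0..1} t *\<^sub>R ?g t z \<partial>lborel \<partial>lborel)"
    using lborel_pair.Fubini_integral[OF int] by simp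
  also have "\<dots> = (\<integral>(z::complex^'n). gauss_dens z *\<^sub>R ?f 0 \<partial>lborel)" by (simp only: inner)
  also have "\<dots> = (\<integral>(z::complex^'n). ?f 0 \<partial>gauss)" by (rule integral_gauss[symmetric]) simp
  also have "\<dots> = ?f 0"
    using gauss_total(2)[where 'n='n] by (simp add: scaleR_conv_of_real)
  finally show ?thesis .
qed

section \<open>The Fock space as a Hilbert space\<close>

lemma cdot_add: "cdot (w + v) z = cdot w z + cdot v z" "cdot w (y + z) = cdot w y + cdot w z"
  by (simp_all add: cdot_def sum.distrib algebra_simps)

lemma cdot_smult: "cdot (c *s w) z = c * cdot w z" "cdot w (c *s z) = cnj c * cdot w z"
  by (simp_all add: cdot_def sum_distrib_left algebra_simps)

lemma cdot_zero [simp]: "cdot 0 z = 0" "cdot z 0 = 0"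
  by (simp_all add: cdot_def)

lemma norm_add_cdot: "(norm (z + w))\<^sup>2 = (norm z)\<^sup>2 + (norm w)\<^sup>2 + 2 * Re (cdot z w)"
  by (simp add: Re_cdot power2_norm_eq_inner inner_add inner_commute)

lemma complex_phase: obtains c where "cmod c = 1" "c * w = of_real (cmod w)"
proof (cases "w = 0")
  case True
  then show ?thesis using that[of 1] by simp
next
  case False
  have "cnj w * w = of_real (cmod w) * of_real (cmod w)"
    using complex_norm_square[of w] by (simp only: power2_eq_square of_real_mult mult.commute)
  then show ?thesis using False by (intro that[of "cnj w / of_real (cmod w)"]) (auto simp: norm_divide)
qed

lemma Rep_fock_minus [simp]: "Rep_fock (- f) z = - Rep_fock f z"
  unfolding uminus_fock_def fock_scaleC.rep_eq by simp

lemma Rep_fock_diff [simp]: "Rep_fock (f - g) z = Rep_fock f z - Rep_fock g z"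
  unfolding minus_fock_def plus_fock.rep_eq by simp

lemma Rep_fock_scaleR [simp]: "Rep_fock (r *\<^sub>R f) z = of_real r * Rep_fock f z"
  by (simp add: scaleR_fock_def fock_scaleC.rep_eq)

lemmas Rep_fock_simps [simp] = zero_fock.rep_eq plus_fock.rep_eq fock_scaleC.rep_eq vac.rep_eq

lemma fock_eqI: "(\<And>z. Rep_fock f z = Rep_fock g z) \<Longrightarrow> f = g"
  by (metis Rep_fock_inject ext)

lemma Rep_fock_sum [simp]: "Rep_fock (\<Sum>i\<in>I. f i) z = (\<Sum>i\<in>I. Rep_fock (f i) z)"
  by (induction I rule: infinite_finite_induct) auto

lemma scaleR_scaleC: "r *\<^sub>R f = of_real r *\<^sub>C f" for f :: "'n::finite fock"
  by (rule scaleR_fock_def)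

lemma cinner_add_left: "fock_cinner (f + g) h = fock_cinner f h + fock_cinner g h"
  by (simp add: fock_cinner_def distrib_right fock_integrable)

lemma cinner_scale_left: "fock_cinner (c *\<^sub>C f) h = c * fock_cinner f h"
  by (simp add: fock_cinner_def mult.assoc)

lemma cinner_cnj: "cnj (fock_cinner f g) = fock_cinner g f"
  unfolding fock_cinner_def by (subst Bochner_Integration.integral_cnj[symmetric]) (simp add: mult.commute)

lemma cinner_add_right: "fock_cinner h (f + g) = fock_cinner h f + fock_cinner h g"
  by (metis cinner_add_left cinner_cnj complex_cnj_add)

lemma cinner_scale_right: "fock_cinner h (c *\<^sub>C f) = cnj c * fock_cinner h f"
  by (metis cinner_scale_left cinner_cnj complex_cnj_mult)

lemma cinner_minus_left: "fock_cinner (- f) g = - fock_cinner f g"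
  unfolding uminus_fock_def cinner_scale_left by simp

lemma cinner_minus_right: "fock_cinner g (- f) = - fock_cinner g f"
  unfolding uminus_fock_def cinner_scale_right by simp

lemma cinner_diff_left: "fock_cinner (f - g) h = fock_cinner f h - fock_cinner g h"
  using cinner_add_left[of f "- g" h] by (simp add: cinner_minus_left)

lemma cinner_diff_right: "fock_cinner h (f - g) = fock_cinner h f - fock_cinner h g"
  using cinner_add_right[of h f "- g"] by (simp add: cinner_minus_right)

lemma cinner_zero [simp]: "fock_cinner 0 g = 0" "fock_cinner g 0 = 0"
  by (simp_all add: fock_cinner_def)

lemma cinner_sum_left: "fock_cinner (\<Sum>i\<in>I. f i) g = (\<Sum>i\<in>I. fock_cinner (f i) g)"
  by (induction I rule: infinite_finite_induct) (auto simp: cinner_add_left)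

lemma cinner_sum_right: "fock_cinner g (\<Sum>i\<in>I. f i) = (\<Sum>i\<in>I. fock_cinner g (f i))"
  by (induction I rule: infinite_finite_induct) (auto simp: cinner_add_right)

lemma cinner_self: "fock_cinner f f = of_real ((norm f)\<^sup>2)"
proof (rule complex_eqI)
  show "Re (fock_cinner f f) = Re (of_real ((norm f)\<^sup>2))"
    by (simp add: power2_norm_eq_inner inner_fock_def)
  have "cnj (fock_cinner f f) = fock_cinner f f" by (rule cinner_cnj)
  then show "Im (fock_cinner f f) = Im (of_real ((norm f)\<^sup>2))"
    by (simp add: complex_eq_iff)
qed

lemma norm_scaleC: "norm (c *\<^sub>C f) = cmod c * norm f" for f :: "'n::finite fock"
proof -
  have "fock_cinner (c *\<^sub>C f) (c *\<^sub>C f) = (c * cnj c) * fock_cinner f f"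
    by (simp add: cinner_scale_left cinner_scale_right)
  then have "complex_of_real ((norm (c *\<^sub>C f))\<^sup>2) = of_real ((cmod c * norm f)\<^sup>2)"
    by (simp only: cinner_self complex_norm_square[symmetric] power_mult_distrib of_real_mult)
  then have "(norm (c *\<^sub>C f))\<^sup>2 = (cmod c * norm f)\<^sup>2" by (simp only: of_real_eq_iff)
  then show ?thesis by (simp add: power2_eq_iff_nonneg)
qed

text \<open>A phase makes the Hermitian product real and nonnegative, and then it equals the real
  inner product.\<close>

lemma cinner_cauchy_schwarz: "cmod (fock_cinner f g) \<le> norm f * norm g"
proof -
  obtain c where c: "cmod c = 1" "c * fock_cinner f g = of_real (cmod (fock_cinner f g))" by (rule complex_phase)
  have "cmod (fock_cinner f g) = Re (fock_cinner (c *\<^sub>C f) g)" by (simp add: cinner_scale_left c)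
  also have "\<dots> = (c *\<^sub>C f) \<bullet> g" by (simp add: inner_fock_def)
  also have "\<dots> \<le> norm (c *\<^sub>C f) * norm g" by (rule norm_cauchy_schwarz)
  finally show ?thesis by (simp add: norm_scaleC c)
qed

lemma cinner_eqI: "(\<And>h. fock_cinner f h = fock_cinner g h) \<Longrightarrow> f = g"
proof -
  assume "\<And>h. fock_cinner f h = fock_cinner g h"
  then have "fock_cinner (f - g) (f - g) = 0" by (simp add: cinner_diff_left)
  then show "f = g" by (simp add: cinner_self)
qed

section \<open>Weyl operators, parity and coherent states\<close>

lemma weyl_add: "weyl z (f + g) = weyl z f + weyl z g"
  by (rule fock_eqI) (simp add: weyl.rep_eq algebra_simps)

lemma weyl_scale: "weyl z (c *\<^sub>C f) = c *\<^sub>C weyl z f"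
  by (rule fock_eqI) (simp add: weyl.rep_eq algebra_simps)

text \<open>Translations compose up to a phase, the Heisenberg cocycle. The phase disappears under
  conjugation, which is what \<open>alpha_alpha\<close> uses.\<close>

lemma weyl_weyl: "weyl z (weyl w f) = exp (- \<i> * of_real (Im (cdot z w)) / 2) *\<^sub>C weyl (z + w) f"
proof (rule fock_eqI)
  fix x
  have n: "complex_of_real ((norm (z + w))\<^sup>2) = of_real ((norm z)\<^sup>2) + of_real ((norm w)\<^sup>2) + 2 * of_real (Re (cdot z w))"
    unfolding norm_add_cdot by simp
  have "nrk z x * nrk w (x - z) = exp (- \<i> * of_real (Im (cdot z w)) / 2) * nrk (z + w) x"
    unfolding nrk_def exp_add[symmetric] n
    by (rule arg_cong[where f=exp]) (simp add: cdot_diff_left cdot_add complex_eq_iff field_simps)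
  then show "Rep_fock (weyl z (weyl w f)) x = Rep_fock (exp (- \<i> * of_real (Im (cdot z w)) / 2) *\<^sub>C weyl (z + w) f) x"
    by (simp add: weyl.rep_eq diff_diff_eq flip: mult.assoc)
qed

lemma weyl_0 [simp]: "weyl 0 f = f"
  by (rule fock_eqI) (simp add: weyl.rep_eq nrk_def)

lemma weyl_inverse [simp]: "weyl z (weyl (- z) f) = f" "weyl (- z) (weyl z f) = f"
  by (simp_all add: weyl_weyl cdot_self)

lemma cinner_weyl_weyl: "fock_cinner (weyl z f) (weyl z g) = fock_cinner f g"
proof -
  have [measurable]: "Rep_fock f \<in> borel_measurable borel" for f :: "'a fock"
    by (rule entire_measurable[OF entire_Rep])
  have cnj: "cnj \<in> borel_measurable borel"
    by (intro borel_measurable_continuous_onI continuous_intros)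
  have [measurable]: "(\<lambda>z. cnj (Rep_fock f z)) \<in> borel_measurable borel" for f :: "'a fock"
    by (rule measurable_compose[OF _ cnj]) measurable
  let ?h = "\<lambda>w. gauss_dens w *\<^sub>R (Rep_fock f w * cnj (Rep_fock g w))"
  have "gauss_dens w *\<^sub>R (Rep_fock (weyl z f) w * cnj (Rep_fock (weyl z g) w)) = ?h (w - z)" for w
    unfolding gauss_dens_shift[symmetric, of w z]
    by (simp add: weyl.rep_eq scaleR_conv_of_real complex_norm_square del: of_real_power)
  note eq = this
  have m: "(\<lambda>w. Rep_fock (weyl z f) w * cnj (Rep_fock (weyl z g) w)) \<in> borel_measurable borel"
    by measurable
  have "fock_cinner (weyl z f) (weyl z g) = (\<integral>w. ?h (w - z) \<partial>lborel)"
    unfolding fock_cinner_def integral_gauss[OF m] eq ..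
  also have "\<dots> = (\<integral>w. ?h w \<partial>lborel)" by (rule integral_lborel_shift) measurable
  also have "\<dots> = fock_cinner f g"
    unfolding fock_cinner_def by (subst integral_gauss) simp_all
  finally show ?thesis .
qed

lemma cinner_weyl: "fock_cinner (weyl z f) g = fock_cinner f (weyl (- z) g)"
  using cinner_weyl_weyl[of z f "weyl (- z) g"] by simp

lemma norm_weyl [simp]: "norm (weyl z f) = norm f"
proof -
  have "complex_of_real ((norm (weyl z f))\<^sup>2) = of_real ((norm f)\<^sup>2)"
    unfolding cinner_self[symmetric] by (simp add: cinner_weyl)
  then have "(norm (weyl z f))\<^sup>2 = (norm f)\<^sup>2" by (simp only: of_real_eq_iff)
  then show ?thesis by (simp add: power2_eq_iff_nonneg)
qed

lemma parity_parity [simp]: "parity (parity f) = f"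
  by (rule fock_eqI) (simp add: parity.rep_eq)

lemma parity_add: "parity (f + g) = parity f + parity g"
  by (rule fock_eqI) (simp add: parity.rep_eq)

lemma parity_scale: "parity (c *\<^sub>C f) = c *\<^sub>C parity f"
  by (rule fock_eqI) (simp add: parity.rep_eq)

lemma parity_vac [simp]: "parity vac = vac"
  by (rule fock_eqI) (simp add: parity.rep_eq)

lemma parity_weyl: "parity (weyl z f) = weyl (- z) (parity f)"
proof (rule fock_eqI)
  fix x
  have "nrk z (- x) = nrk (- z) x" by (simp add: nrk_def)
  then show "Rep_fock (parity (weyl z f)) x = Rep_fock (weyl (- z) (parity f)) x"
    by (simp add: weyl.rep_eq parity.rep_eq add.commute)
qed

lemma cinner_parity: "fock_cinner (parity f) g = fock_cinner f (parity g)"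
proof -
  have [measurable]: "Rep_fock f \<in> borel_measurable borel" for f :: "'a fock"
    by (rule entire_measurable[OF entire_Rep])
  have [measurable]: "cnj \<in> borel_measurable borel"
    by (intro borel_measurable_continuous_onI continuous_intros)
  have m1: "(- 1) *s z = - z" for z :: "complex^'a" by (simp add: vec_eq_iff)
  let ?h = "\<lambda>z. gauss_dens z *\<^sub>R (Rep_fock f z * cnj (Rep_fock (parity g) z))"
  have "fock_cinner (parity f) g = (\<integral>z. ?h (- z) \<partial>lborel)"
    unfolding fock_cinner_def by (subst integral_gauss) (auto simp: parity.rep_eq)
  also have "\<dots> = (\<integral>z. ?h z \<partial>lborel)"
    using integral_lborel_rotate(2)[of ?h "-1"] unfolding m1 by simp
  also have "\<dots> = fock_cinner f (parity g)"
    unfolding fock_cinner_def by (subst integral_gauss) auto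
  finally show ?thesis .
qed

definition coh :: "complex^'n::finite \<Rightarrow> 'n fock" where
  "coh w = weyl w vac"

lemma Rep_coh: "Rep_fock (coh w) z = nrk w z"
  by (simp add: coh_def weyl.rep_eq)

lemma norm_vac [simp]: "norm (vac :: 'n::finite fock) = 1"
proof -
  have "fock_cinner vac (vac :: 'n fock) = 1" using gauss_total(2)[where 'n='n] by (simp add: fock_cinner_def)
  then show ?thesis unfolding cinner_self by (metis norm_ge_zero of_real_eq_1_iff power2_eq_1_iff le_minus_one_simps(3))
qed

lemma norm_coh [simp]: "norm (coh w) = 1"
  by (simp add: coh_def)

text \<open>Unitarity moves \<open>w\<close> to the origin, where \<open>fock_mean\<close> applies.
  The exponential is the normalization of the reproducing kernel.\<close>

lemma cinner_coh: "fock_cinner f (coh w) = exp (- of_real ((norm w)\<^sup>2) / 4) * Rep_fock f w"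
proof -
  have "fock_cinner f (coh w) = fock_cinner (weyl (- w) f) vac"
    by (simp add: coh_def cinner_weyl)
  also have "\<dots> = Rep_fock (weyl (- w) f) 0"
    using fock_mean[of "weyl (- w) f"] by (simp add: fock_cinner_def)
  finally show ?thesis by (simp add: weyl.rep_eq nrk_def)
qed

lemma Rep_eq_cinner: "Rep_fock f w = exp (of_real ((norm w)\<^sup>2) / 4) * fock_cinner f (coh w)"
  by (simp add: cinner_coh flip: mult.assoc exp_add)

lemma Rep_fock_bound: "cmod (Rep_fock f w) \<le> exp ((norm w)\<^sup>2 / 4) * norm f"
proof -
  have "cmod (fock_cinner f (coh w)) \<le> norm f" using cinner_cauchy_schwarz[of f "coh w"] by simp
  then show ?thesis unfolding Rep_eq_cinner by (simp add: norm_mult norm_exp_eq_Re)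
qed

text \<open>The resolution of the identity by coherent states: the normalizations of the two factors
  multiply to the Gaussian density up to the constant \<open>(2 * pi) ^ CARD('n)\<close>.\<close>

lemma cinner_resolution:
  fixes f g :: "'n::finite fock"
  shows "integrable lborel (\<lambda>z. fock_cinner f (coh z) * fock_cinner (coh z) g)"
    and "(\<integral>z. fock_cinner f (coh z) * fock_cinner (coh z) g \<partial>lborel) = (2 * pi) ^ CARD('n) * fock_cinner f g"
proof -
  have [measurable]: "Rep_fock f \<in> borel_measurable borel" for f :: "'n fock"
    by (rule entire_measurable[OF entire_Rep])
  have [measurable]: "cnj \<in> borel_measurable borel"
    by (intro borel_measurable_continuous_onI continuous_intros)
  have *: "fock_cinner f (coh z) * fock_cinner (coh z) g
     = (2 * pi) ^ CARD('n) *\<^sub>R (gauss_dens z *\<^sub>R (Rep_fock f z * cnj (Rep_fock g z)))" for z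
  proof -
    have "exp (- of_real ((norm z)\<^sup>2) / 4) * cnj (exp (- of_real ((norm z)\<^sup>2) / 4)) = exp (of_real (- (norm z)\<^sup>2 / 2) :: complex)"
      by (simp add: exp_cnj del: of_real_power flip: exp_add)
    also have "\<dots> = complex_of_real (exp (- (norm z)\<^sup>2 / 2))" by (rule exp_of_real)
    finally have "complex_of_real (exp (- (norm z)\<^sup>2 / 2)) = exp (- of_real ((norm z)\<^sup>2) / 4) * cnj (exp (- of_real ((norm z)\<^sup>2) / 4))" ..
    then show ?thesis
      unfolding cinner_cnj[of g "coh z", symmetric] cinner_coh by (simp add: scaleR_conv_of_real)
  qed
  have i: "integrable lborel (\<lambda>z. gauss_dens z *\<^sub>R (Rep_fock f z * cnj (Rep_fock g z)))"
    using fock_integrable[of f g] by (subst (asm) integrable_gauss_iff) auto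
  then show "integrable lborel (\<lambda>z. fock_cinner f (coh z) * fock_cinner (coh z) g)"
    unfolding * by (intro integrable_scaleR_right) 
  show "(\<integral>z. fock_cinner f (coh z) * fock_cinner (coh z) g \<partial>lborel) = (2 * pi) ^ CARD('n) * fock_cinner f g"
    unfolding * integral_scaleR_right fock_cinner_def[of f g]
    by (subst integral_gauss) (auto simp: scaleR_conv_of_real)
qed

lemma parity_coh: "parity (coh w) = coh (- w)"
  by (simp add: coh_def parity_weyl)

text \<open>Opposite coherent states are almost orthogonal; this is why the regularized trace of the
  identity is finite.\<close>

lemma cinner_coh_coh: "fock_cinner (coh (- z)) (coh z) = of_real (exp (- (norm z)\<^sup>2))"
  by (simp add: cinner_coh Rep_coh nrk_def cdot_self exp_of_real[symmetric] flip: exp_add)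

section \<open>Completeness, orthogonal projection and Riesz representation\<close>

lemma entire_deriv_bound:
  assumes f: "entire f" and b: "\<And>w. norm w \<le> norm z + norm v \<Longrightarrow> cmod (f w) \<le> B"
    and D: "(f has_derivative D) (at z)" "\<And>c v. D (c *s v) = c * D v"
  shows "cmod (D v) \<le> B"
proof -
  let ?h = "\<lambda>t. f (z + t *s v)"
  have hol: "?h holomorphic_on UNIV" by (rule entire_line_holomorphic[OF f])
  have "z + 0 *s v = z" by (simp add: vec_eq_iff)
  then have "(?h has_derivative (\<lambda>c. D (c *s v))) (at 0)"
    using has_derivative_compose[OF has_derivative_line, of f D z 0 v] D(1) by simp
  then have "(?h has_field_derivative D v) (at 0)"
    by (simp add: has_field_derivative_def D(2) mult_commute_abs)
  then have "deriv ?h 0 = D v" by (rule DERIV_imp_deriv)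
  \<comment> \<open>Cauchy's inequality on the unit disc of the line through \<open>z\<close> in
    direction \<open>v\<close>; points of its boundary have norm at most
    \<open>norm z + norm v\<close>.\<close>
  moreover have "cmod ((deriv ^^ 1) ?h 0) \<le> fact 1 * B / 1 ^ 1"
  proof (rule Cauchy_inequality)
    show "?h holomorphic_on ball 0 1" using hol holomorphic_on_subset by blast
    show "continuous_on (cball 0 1) ?h"
      using holomorphic_on_imp_continuous_on[OF hol] continuous_on_subset by blast
    fix x :: complex assume "cmod (0 - x) = 1"
    then have "norm (z + x *s v) \<le> norm z + norm v"
      using norm_triangle_ineq[of z "x *s v"] by (simp add: norm_vec_smult)
    then show "cmod (?h x) \<le> B" by (rule b)
  qed simp
  ultimately show ?thesis by simp
qed

text \<open>A Cauchy sequence in the Fock space converges locally uniformly, together with its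
  derivatives, by the pointwise bound on functions in the Fock space.\<close>

lemma fock_Cauchy_pointwise:
  fixes X :: "nat \<Rightarrow> 'n::finite fock"
  assumes "Cauchy X"
  obtains g where "entire g" "\<And>z. (\<lambda>n. Rep_fock (X n) z) \<longlonglongrightarrow> g z"
proof -
  define F' where "F' n z = (SOME D. (Rep_fock (X n) has_derivative D) (at z) \<and> (\<forall>c v. D (c *s v) = c * D v))" for n z
  have F': "(Rep_fock (X n) has_derivative F' n z) (at z)" "F' n z (c *s v) = c * F' n z v" for n z c v
  proof -
    have "\<exists>D. (Rep_fock (X n) has_derivative D) (at z) \<and> (\<forall>c v. D (c *s v) = c * D v)"
      using entire_Rep[of "X n"] unfolding entire_def by blast
    from someI_ex[OF this] show "(Rep_fock (X n) has_derivative F' n z) (at z)" "F' n z (c *s v) = c * F' n z v"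
      unfolding F'_def by auto
  qed
  \<comment> \<open>For a unit direction the derivative is controlled by the values on the ball of
    radius \<open>norm z + 1\<close>, where the growth bound contributes the exponential; complex
    homogeneity supplies the factor \<open>norm v\<close>.\<close>
  have dF: "cmod (F' n z v - F' m z v) \<le> exp ((norm z + 1)\<^sup>2 / 4) * norm (X n - X m) * norm v" for n m z v
  proof (cases "v = 0")
    case True
    then have "0 *s v = v" by (simp add: vec_eq_iff)
    then have "F' n z v = 0" "F' m z v = 0" using F'(2)[of n z 0 v] F'(2)[of m z 0 v] by auto
    then show ?thesis by simp
  next
    case False
    define u where "u = of_real (1 / norm v) *s v"
    have nv: "norm v \<noteq> 0" using False by simp
    then have u: "norm u = 1" "v = of_real (norm v) *s u"
      unfolding u_def by (simp_all add: norm_vec_smult norm_divide vec_eq_iff del: norm_eq_zero)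
    have "cmod (F' n z u - F' m z u) \<le> exp ((norm z + 1)\<^sup>2 / 4) * norm (X n - X m)"
    proof (rule entire_deriv_bound[where D="\<lambda>v. F' n z v - F' m z v" and z=z])
      show "entire (Rep_fock (X n - X m))" by (rule entire_Rep)
      have "Rep_fock (X n - X m) = (\<lambda>z. Rep_fock (X n) z - Rep_fock (X m) z)" by auto
      then show "(Rep_fock (X n - X m) has_derivative (\<lambda>v. F' n z v - F' m z v)) (at z)"
        by (simp only:) (intro has_derivative_diff F')
      show "F' n z (c *s v) - F' m z (c *s v) = c * (F' n z v - F' m z v)" for c v
        by (simp add: F'(2) algebra_simps)
      fix w :: "complex^'n" assume "norm w \<le> norm z + norm u"
      then have "(norm w)\<^sup>2 \<le> (norm z + 1)\<^sup>2" using u by (intro power_mono) auto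
      then have "exp ((norm w)\<^sup>2 / 4) * norm (X n - X m) \<le> exp ((norm z + 1)\<^sup>2 / 4) * norm (X n - X m)"
        by (intro mult_right_mono) auto
      then show "cmod (Rep_fock (X n - X m) w) \<le> exp ((norm z + 1)\<^sup>2 / 4) * norm (X n - X m)"
        using Rep_fock_bound[of "X n - X m" w] by linarith
    qed
    then have "norm v * cmod (F' n z u - F' m z u) \<le> norm v * (exp ((norm z + 1)\<^sup>2 / 4) * norm (X n - X m))"
      by (intro mult_left_mono) auto
    moreover have "F' n z v - F' m z v = of_real (norm v) * (F' n z u - F' m z u)"
      using F'(2)[of n z "of_real (norm v)" u] F'(2)[of m z "of_real (norm v)" u] u(2)
      by (metis right_diff_distrib)
    ultimately show ?thesis by (simp add: norm_mult mult_ac)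
  qed
  have CX: "\<exists>N. \<forall>n\<ge>N. \<forall>m\<ge>N. norm (X n - X m) < e" if "e > 0" for e
    using assms that unfolding Cauchy_def dist_norm by blast
  have "\<exists>l. (\<lambda>n. F' n z v) \<longlonglongrightarrow> l" for z v
  proof (rule Cauchy_convergent_iff[THEN iffD1, unfolded convergent_def], rule CauchyI)
    fix e :: real assume e: "e > 0"
    let ?K = "exp ((norm z + 1)\<^sup>2 / 4) * (norm v + 1)"
    have K: "?K > 0" by (simp add: add_nonneg_pos)
    obtain N where N: "\<forall>n\<ge>N. \<forall>m\<ge>N. norm (X n - X m) < e / ?K" using CX[of "e / ?K"] K e by auto
    show "\<exists>M. \<forall>m\<ge>M. \<forall>n\<ge>M. cmod (F' m z v - F' n z v) < e"
    proof (intro exI[of _ N] allI impI)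
      fix m n assume "N \<le> m" "N \<le> n"
      then have "norm (X m - X n) * ?K < e" using N K by (auto simp: pos_less_divide_eq)
      moreover have "cmod (F' m z v - F' n z v) \<le> norm (X m - X n) * ?K"
        using dF[of m z v n] by (rule order_trans) (simp add: algebra_simps)
      ultimately show "cmod (F' m z v - F' n z v) < e" by simp
    qed
  qed
  then obtain G where G: "\<And>z v. (\<lambda>n. F' n z v) \<longlonglongrightarrow> G z v" by metis
  have Gc: "G z (c *s v) = c * G z v" for z c v
    using LIMSEQ_unique[OF G[of z "c *s v"]] tendsto_mult_left[OF G[of z v], of c] by (simp add: F'(2))
  have ptC: "\<exists>l. (\<lambda>n. Rep_fock (X n) z) \<longlonglongrightarrow> l" for z
  proof (rule Cauchy_convergent_iff[THEN iffD1, unfolded convergent_def], rule CauchyI)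
    fix e :: real assume e: "e > 0"
    obtain N where N: "\<forall>n\<ge>N. \<forall>m\<ge>N. norm (X n - X m) < e / exp ((norm z)\<^sup>2 / 4)"
      using CX[of "e / exp ((norm z)\<^sup>2 / 4)"] e by auto
    show "\<exists>M. \<forall>m\<ge>M. \<forall>n\<ge>M. cmod (Rep_fock (X m) z - Rep_fock (X n) z) < e"
    proof (intro exI[of _ N] allI impI)
      fix m n assume "N \<le> m" "N \<le> n"
      then have "exp ((norm z)\<^sup>2 / 4) * norm (X m - X n) < e" using N by (auto simp: field_simps)
      then show "cmod (Rep_fock (X m) z - Rep_fock (X n) z) < e"
        using Rep_fock_bound[of "X m - X n" z] by simp
    qed
  qed
  \<comment> \<open>The derivatives converge uniformly only on bounded sets, so differentiation of
    the limit is carried out on each ball; the local limits agree with the pointwise limit and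
    glue.\<close>
  have local: "\<exists>g. \<forall>x\<in>ball 0 R. (\<lambda>n. Rep_fock (X n) x) \<longlonglongrightarrow> g x \<and> (g has_derivative G x) (at x within ball 0 R)"
    if R: "R > 0" for R
  proof -
    obtain l where l: "(\<lambda>n. Rep_fock (X n) 0) \<longlonglongrightarrow> l" using ptC by blast
    show ?thesis
    proof (rule has_derivative_sequence[where f="\<lambda>n. Rep_fock (X n)" and f'=F' and ?x0.0=0])
      show "convex (ball (0::complex^'n) R)" by (rule convex_ball)
      show "(\<lambda>n. Rep_fock (X n) 0) \<longlonglongrightarrow> l" by (rule l)
      show "(Rep_fock (X n) has_derivative F' n x) (at x within ball 0 R)" for n x
        by (rule has_derivative_at_withinI[OF F'(1)])
      show "0 \<in> ball 0 R" using R by simp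
      fix e :: real assume e: "e > 0"
      let ?K = "exp ((R + 1)\<^sup>2 / 4)"
      obtain N where N: "\<forall>n\<ge>N. \<forall>m\<ge>N. norm (X n - X m) < e / ?K" using CX[of "e / ?K"] e by auto
      show "\<forall>\<^sub>F n in sequentially. \<forall>x\<in>ball 0 R. \<forall>h. cmod (F' n x h - G x h) \<le> e * norm h"
        unfolding eventually_sequentially
      proof (intro exI[of _ N] allI impI ballI)
        fix n x h assume n: "N \<le> n" and x: "x \<in> ball (0::complex^'n) R"
        show "cmod (F' n x h - G x h) \<le> e * norm h"
        proof (rule tendsto_upperbound)
          show "(\<lambda>m. cmod (F' n x h - F' m x h)) \<longlonglongrightarrow> cmod (F' n x h - G x h)"
            by (intro tendsto_intros G)
          show "\<forall>\<^sub>F m in sequentially. cmod (F' n x h - F' m x h) \<le> e * norm h"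
            unfolding eventually_sequentially
          proof (intro exI[of _ N] allI impI)
            fix m assume "N \<le> m"
            then have a: "norm (X n - X m) < e / ?K" using N n by auto
            have "(norm x + 1)\<^sup>2 \<le> (R + 1)\<^sup>2" using x by (intro power_mono) auto
            then have "exp ((norm x + 1)\<^sup>2 / 4) * norm (X n - X m) \<le> ?K * (e / ?K)"
              using a by (intro mult_mono) auto
            then have "exp ((norm x + 1)\<^sup>2 / 4) * norm (X n - X m) * norm h \<le> e * norm h"
              by (intro mult_right_mono) auto
            then show "cmod (F' n x h - F' m x h) \<le> e * norm h" using dF[of n x h m] by linarith
          qed
        qed simp
      qed
    qed
  qed
  define g where "g z = lim (\<lambda>n. Rep_fock (X n) z)" for z
  have g: "(\<lambda>n. Rep_fock (X n) z) \<longlonglongrightarrow> g z" for z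
    unfolding g_def using ptC[of z] convergent_LIMSEQ_iff convergent_def by blast
  have "entire g"
    unfolding entire_def
  proof
    fix z :: "complex^'n"
    obtain g' where g': "\<forall>x\<in>ball 0 (norm z + 1). (\<lambda>n. Rep_fock (X n) x) \<longlonglongrightarrow> g' x \<and> (g' has_derivative G x) (at x within ball 0 (norm z + 1))"
      using local[of "norm z + 1"] by (auto simp: add_nonneg_pos)
    have zb: "z \<in> ball 0 (norm z + 1)" by simp
    have eq: "g' x = g x" if "x \<in> ball 0 (norm z + 1)" for x
      using g' that LIMSEQ_unique[OF _ g[of x]] by blast
    have "(g' has_derivative G z) (at z)"
      using g' zb at_within_open[OF zb open_ball] by metis
    then have "(g has_derivative G z) (at z)"
      by (rule has_derivative_transform_within_open[OF _ open_ball zb eq])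
    then show "\<exists>D. (g has_derivative D) (at z) \<and> (\<forall>c v. D (c *s v) = c * D v)"
      using Gc by blast
  qed
  then show ?thesis using that g by blast
qed

lemma fock_norm_sq: "(norm f)\<^sup>2 = (\<integral>z. (cmod (Rep_fock f z))\<^sup>2 \<partial>gauss)"
proof -
  have "fock_cinner f f = of_real (\<integral>z. (cmod (Rep_fock f z))\<^sup>2 \<partial>gauss)"
    unfolding fock_cinner_def by (subst integral_complex_of_real[symmetric]) (simp add: complex_norm_square del: of_real_power)
  then show ?thesis unfolding cinner_self by (simp only: of_real_eq_iff)
qed

lemma fock_nn_norm: "(\<integral>\<^sup>+z. ennreal ((cmod (Rep_fock f z))\<^sup>2) \<partial>gauss) = ennreal ((norm f)\<^sup>2)"
  unfolding fock_norm_sq using sq_integrable_Rep[of f]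
  by (subst nn_integral_eq_integral) (auto simp: sq_integrable_def)

instance fock :: (finite) banach
proof
  fix X :: "nat \<Rightarrow> 'a fock"
  assume C: "Cauchy X"
  obtain g where g: "entire g" "\<And>z. (\<lambda>n. Rep_fock (X n) z) \<longlonglongrightarrow> g z"
    using fock_Cauchy_pointwise[OF C] by blast
  have [measurable]: "g \<in> borel_measurable borel" "Rep_fock f \<in> borel_measurable borel" for f :: "'a fock"
    using g entire_measurable entire_Rep by auto
  \<comment> \<open>Fatou's lemma compares the pointwise limit with the norms. The estimate is used
    twice: for square integrability of \<open>g\<close> and for convergence in norm.\<close>
  have est: "(\<integral>\<^sup>+z. ennreal ((cmod (g z - Rep_fock (X n) z))\<^sup>2) \<partial>gauss) \<le> ennreal (e\<^sup>2)"
    if N: "\<forall>m\<ge>N. norm (X m - X n) \<le> e" and e: "e \<ge> 0" for n N e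
  proof -
    have lim: "(\<lambda>m. ennreal ((cmod (Rep_fock (X m) z - Rep_fock (X n) z))\<^sup>2)) \<longlonglongrightarrow> ennreal ((cmod (g z - Rep_fock (X n) z))\<^sup>2)" for z
      by (intro tendsto_intros g)
    have "(\<integral>\<^sup>+z. ennreal ((cmod (g z - Rep_fock (X n) z))\<^sup>2) \<partial>gauss)
       = (\<integral>\<^sup>+z. liminf (\<lambda>m. ennreal ((cmod (Rep_fock (X m) z - Rep_fock (X n) z))\<^sup>2)) \<partial>gauss)"
      using lim_imp_Liminf[OF _ lim] by simp
    also have "\<dots> \<le> liminf (\<lambda>m. \<integral>\<^sup>+z. ennreal ((cmod (Rep_fock (X m) z - Rep_fock (X n) z))\<^sup>2) \<partial>gauss)"
      by (rule nn_integral_liminf) measurable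
    also have "\<dots> = liminf (\<lambda>m. ennreal ((norm (X m - X n))\<^sup>2))"
      using fock_nn_norm[of "X _ - X n"] by simp
    also have "\<dots> \<le> liminf (\<lambda>m. ennreal (e\<^sup>2))"
      by (intro Liminf_mono) (auto simp: eventually_sequentially intro!: exI[of _ N] ennreal_leI power_mono N[rule_format])
    also have "\<dots> = ennreal (e\<^sup>2)" by (intro lim_imp_Liminf) auto
    finally show ?thesis .
  qed
  have sq: "sq_integrable g"
  proof -
    obtain N where N: "\<forall>m\<ge>N. norm (X m - X N) < 1"
      using C unfolding Cauchy_def dist_norm by (metis order_refl zero_less_one)
    have "(\<integral>\<^sup>+z. ennreal ((cmod (g z - Rep_fock (X N) z))\<^sup>2) \<partial>gauss) \<le> ennreal (1\<^sup>2)"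
      by (rule est[of N]) (use N less_imp_le in auto)
    then have "(\<integral>\<^sup>+z. ennreal ((cmod (g z - Rep_fock (X N) z))\<^sup>2) \<partial>gauss) < \<infinity>"
      by (rule order.strict_trans1) simp
    then have "sq_integrable (\<lambda>z. g z + (- 1) * Rep_fock (X N) z)"
      unfolding sq_integrable_def by (intro integrableI_nonneg) auto
    moreover have "entire (\<lambda>z. g z + (- 1) * Rep_fock (X N) z)"
      by (intro entire_add entire_cmult g entire_Rep)
    ultimately have "sq_integrable (\<lambda>z. (g z + (- 1) * Rep_fock (X N) z) + Rep_fock (X N) z)"
      using sq_integrable_add[OF _ entire_Rep _ sq_integrable_Rep] by blast
    then show ?thesis by simp
  qed
  define G where "G = Abs_fock g"
  have G: "Rep_fock G = g" unfolding G_def by (rule Abs_fock_inverse) (simp add: g sq)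
  have "X \<longlonglongrightarrow> G"
  proof (rule LIMSEQ_I)
    fix e :: real assume e: "e > 0"
    obtain N where N: "\<forall>n\<ge>N. \<forall>m\<ge>N. norm (X m - X n) < e / 2"
      using C e unfolding Cauchy_def dist_norm by (meson half_gt_zero)
    show "\<exists>N. \<forall>n\<ge>N. norm (X n - G) < e"
    proof (intro exI[of _ N] allI impI)
      fix n assume n: "N \<le> n"
      have "(\<integral>\<^sup>+z. ennreal ((cmod (g z - Rep_fock (X n) z))\<^sup>2) \<partial>gauss) \<le> ennreal ((e/2)\<^sup>2)"
        by (rule est[of N]) (use N n e less_imp_le in auto)
      then have "ennreal ((norm (G - X n))\<^sup>2) \<le> ennreal ((e/2)\<^sup>2)"
        unfolding fock_nn_norm[symmetric] by (simp add: G)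
      then have "norm (G - X n) \<le> e / 2" using e by (simp add: ennreal_le_iff power2_le_iff_abs_le)
      then show "norm (X n - G) < e" using e by (simp add: norm_minus_commute)
    qed
  qed
  then show "convergent X" by (auto simp: convergent_def)
qed

lemma norm_diff_cinner: "(norm (f - g))\<^sup>2 = (norm f)\<^sup>2 - 2 * Re (fock_cinner f g) + (norm g)\<^sup>2"
  for f :: "'n::finite fock"
  by (simp add: power2_norm_eq_inner inner_diff inner_commute inner_fock_def[of f g])

lemma fock_projection:
  fixes S :: "'n::finite fock set"
  assumes S: "fock.subspace S" and cl: "closed S"
  obtains p where "p \<in> S" "\<And>s. s \<in> S \<Longrightarrow> fock_cinner (f - p) s = 0"
proof -
  have S0: "0 \<in> S" and Sadd: "\<And>x y. x \<in> S \<Longrightarrow> y \<in> S \<Longrightarrow> x + y \<in> S" and Ssc: "\<And>c x. x \<in> S \<Longrightarrow> c *\<^sub>C x \<in> S"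
    using S by (auto simp: fock.subspace_def)
  define d where "d = Inf ((\<lambda>s. (norm (f - s))\<^sup>2) ` S)"
  have bdd: "bdd_below ((\<lambda>s. (norm (f - s))\<^sup>2) ` S)" by (rule bdd_belowI[of _ 0]) auto
  have dle: "d \<le> (norm (f - s))\<^sup>2" if "s \<in> S" for s
    unfolding d_def using that by (intro cInf_lower bdd) auto
  have "\<exists>s\<in>S. (norm (f - s))\<^sup>2 < d + 1 / Suc n" for n
    using cInf_lessD[of "(\<lambda>s. (norm (f - s))\<^sup>2) ` S" "d + 1 / Suc n"] S0 unfolding d_def by auto
  then obtain s where s: "\<And>n. s n \<in> S" "\<And>n. (norm (f - s n))\<^sup>2 < d + 1 / Suc n" by metis
  \<comment> \<open>The parallelogram law at the midpoint, which lies in \<open>S\<close>: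
    minimizing sequences are Cauchy.\<close>
  have par: "(norm (s n - s m))\<^sup>2 \<le> 2 * (1 / Suc n) + 2 * (1 / Suc m)" for n m
  proof -
    have "(1/2) *\<^sub>R (s n + s m) \<in> S" by (simp add: scaleR_scaleC Ssc Sadd s)
    then have "d \<le> (norm (f - (1/2) *\<^sub>R (s n + s m)))\<^sup>2" by (rule dle)
    moreover have "(norm (s n - s m))\<^sup>2 + 4 * (norm (f - (1/2) *\<^sub>R (s n + s m)))\<^sup>2
       = 2 * (norm (f - s n))\<^sup>2 + 2 * (norm (f - s m))\<^sup>2"
      by (simp add: power2_norm_eq_inner inner_diff inner_add inner_commute algebra_simps)
    ultimately show ?thesis using s(2)[of n] s(2)[of m] by linarith
  qed
  have "Cauchy s"
  proof (rule CauchyI)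
    fix e :: real assume e: "e > 0"
    obtain N where N: "1 / Suc N < e\<^sup>2 / 4"
      using reals_Archimedean[of "e\<^sup>2 / 4"] e by (auto simp: inverse_eq_divide)
    show "\<exists>M. \<forall>m\<ge>M. \<forall>n\<ge>M. norm (s m - s n) < e"
    proof (intro exI[of _ N] allI impI)
      fix m n assume mn: "N \<le> m" "N \<le> n"
      then have "1 / Suc m \<le> 1 / Suc N" "1 / Suc n \<le> 1 / Suc N" by (auto intro!: divide_left_mono)
      then have "(norm (s m - s n))\<^sup>2 < e\<^sup>2" using par[of m n] N by linarith
      then show "norm (s m - s n) < e" using e by (simp add: power2_less_imp_less)
    qed
  qed
  then obtain p where p: "s \<longlonglongrightarrow> p" using Cauchy_convergent_iff convergent_def by blast
  have pS: "p \<in> S" using closed_sequentially[OF cl _ p] s by blast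
  have "(norm (f - p))\<^sup>2 \<le> d"
  proof (rule LIMSEQ_le)
    show "(\<lambda>n. (norm (f - s n))\<^sup>2) \<longlonglongrightarrow> (norm (f - p))\<^sup>2" by (intro tendsto_intros p)
    have "(\<lambda>n. d + 1 / Suc n) \<longlonglongrightarrow> d + 0" using LIMSEQ_inverse_real_of_nat
      by (intro tendsto_intros) (simp add: inverse_eq_divide)
    then show "(\<lambda>n. d + 1 / Suc n) \<longlonglongrightarrow> d" by simp
    show "\<exists>N. \<forall>n\<ge>N. (norm (f - s n))\<^sup>2 \<le> d + 1 / real (Suc n)" using s(2) less_imp_le by blast
  qed
  then have min: "(norm (f - p))\<^sup>2 \<le> (norm (f - q))\<^sup>2" if "q \<in> S" for q using dle[OF that] by linarith
  have "fock_cinner (f - p) q = 0" if q: "q \<in> S" for q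
  proof (cases "q = 0")
    case False
    \<comment> \<open>The optimal coefficient along \<open>q\<close>: moving \<open>p\<close> by
      \<open>c *\<^sub>C q\<close> lowers the squared distance by |<f - p, q>|^2 / |q|^2, so
      minimality forces the inner product to vanish.\<close>
    define c where "c = fock_cinner (f - p) q / of_real ((norm q)\<^sup>2)"
    have "p + c *\<^sub>C q \<in> S" using q pS by (simp add: Ssc Sadd)
    then have "(norm (f - p))\<^sup>2 \<le> (norm (f - p - c *\<^sub>C q))\<^sup>2" using min by (simp add: diff_diff_eq)
    also have "\<dots> = (norm (f - p))\<^sup>2 - 2 * Re (cnj c * fock_cinner (f - p) q) + (cmod c)\<^sup>2 * (norm q)\<^sup>2"
      by (subst norm_diff_cinner) (simp add: cinner_scale_right norm_scaleC power_mult_distrib)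
    also have "cnj c * fock_cinner (f - p) q = of_real ((cmod (fock_cinner (f - p) q))\<^sup>2 / (norm q)\<^sup>2)"
      unfolding c_def using complex_norm_square[of "fock_cinner (f - p) q"] by (simp add: mult.commute)
    also have "(cmod c)\<^sup>2 * (norm q)\<^sup>2 = (cmod (fock_cinner (f - p) q))\<^sup>2 / (norm q)\<^sup>2"
      using False by (simp add: c_def norm_divide norm_mult power_divide field_simps power2_eq_square)
    finally have "(cmod (fock_cinner (f - p) q))\<^sup>2 / (norm q)\<^sup>2 \<le> 0" by (simp del: of_real_divide of_real_power)
    then show ?thesis using False by (simp add: divide_le_0_iff)
  qed simp
  then show ?thesis using that pS by blast
qed

lemma cinner_tendsto:
  assumes "(X \<longlongrightarrow> f) F"
  shows "((\<lambda>n. fock_cinner (X n) g) \<longlongrightarrow> fock_cinner f g) F"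
proof (rule Lim_null[THEN iffD2], rule tendsto_rabs_zero_cancel[THEN tendsto_norm_zero_cancel])
  show "((\<lambda>n. \<bar>cmod (fock_cinner (X n) g - fock_cinner f g)\<bar>) \<longlongrightarrow> 0) F"
  proof (rule tendsto_sandwich[OF _ _ tendsto_const])
    show "\<forall>\<^sub>F n in F. 0 \<le> \<bar>cmod (fock_cinner (X n) g - fock_cinner f g)\<bar>" by simp
    show "\<forall>\<^sub>F n in F. \<bar>cmod (fock_cinner (X n) g - fock_cinner f g)\<bar> \<le> norm (X n - f) * norm g"
      by (intro always_eventually allI) (simp add: cinner_diff_left[symmetric] cinner_cauchy_schwarz)
    have "((\<lambda>n. norm (X n - f) * norm g) \<longlongrightarrow> 0 * norm g) F"
      using assms by (intro tendsto_intros) (simp add: LIM_zero tendsto_norm_zero)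
    then show "((\<lambda>n. norm (X n - f) * norm g) \<longlongrightarrow> 0) F" by simp
  qed
qed

lemma fock_riesz:
  fixes \<phi> :: "'n::finite fock \<Rightarrow> complex"
  assumes add: "\<And>f g. \<phi> (f + g) = \<phi> f + \<phi> g" and sc: "\<And>c f. \<phi> (c *\<^sub>C f) = c * \<phi> f"
    and bd: "\<And>f. cmod (\<phi> f) \<le> K * norm f"
  obtains g where "\<And>f. \<phi> f = fock_cinner f g"
proof (cases "\<forall>f. \<phi> f = 0")
  case True
  then show ?thesis using that[of 0] by simp
next
  case False
  then obtain f where f: "\<phi> f \<noteq> 0" by blast
  have bl: "bounded_linear \<phi>"
    by (rule bounded_linear_intro[where K=K]) (auto simp: add sc scaleR_scaleC scaleR_conv_of_real bd mult.commute)
  let ?S = "{f. \<phi> f = 0}"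
  have "fock.subspace ?S" unfolding fock.subspace_def using add sc sc[of 0 0] by auto
  moreover have "closed ?S"
    using linear_continuous_on[OF bl] by (intro closed_Collect_eq) auto
  ultimately obtain p where p: "\<phi> p = 0" "\<And>s. \<phi> s = 0 \<Longrightarrow> fock_cinner (f - p) s = 0"
    using fock_projection[of ?S f] by auto
  interpret bounded_linear \<phi> by (rule bl)
  define u where "u = f - p"
  have u: "\<phi> u \<noteq> 0" "\<And>s. \<phi> s = 0 \<Longrightarrow> fock_cinner s u = 0"
    using f p by (auto simp: u_def diff) (metis cinner_cnj complex_cnj_zero)
  have un: "u \<noteq> 0" using u(1) zero by auto
  show ?thesis
  proof (rule that[of "(cnj (\<phi> u) / of_real ((norm u)\<^sup>2)) *\<^sub>C u"])
    fix h
    have "\<phi> (h - (\<phi> h / \<phi> u) *\<^sub>C u) = 0" using u(1) by (simp add: diff sc)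
    from u(2)[OF this] have "fock_cinner h u = (\<phi> h / \<phi> u) * of_real ((norm u)\<^sup>2)"
      by (simp add: cinner_diff_left cinner_scale_left cinner_self)
    then show "\<phi> h = fock_cinner h ((cnj (\<phi> u) / of_real ((norm u)\<^sup>2)) *\<^sub>C u)"
      using un u(1) by (simp add: cinner_scale_right)
  qed
qed

section \<open>The algebra of bounded operators\<close>

lemma scaleC_scaleR_commute: "c *\<^sub>C (r *\<^sub>R f) = r *\<^sub>R (c *\<^sub>C f)" for f :: "'n::finite fock"
  by (simp add: scaleR_scaleC mult.commute)

lemma bounded_linear_scaleC_blinfun:
  fixes A :: "'n::finite fock \<Rightarrow>\<^sub>L 'n fock"
  shows "bounded_linear (\<lambda>f. c *\<^sub>C blinfun_apply A f)"
proof (rule bounded_linear_intro[where K="cmod c * norm A"])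
  fix f show "norm (c *\<^sub>C blinfun_apply A f) \<le> norm f * (cmod c * norm A)"
    using mult_left_mono[OF norm_blinfun[of A f], of "cmod c"] by (simp add: norm_scaleC mult_ac)
qed (auto simp: blinfun.add_right blinfun.scaleR_right fock.scale_right_distrib scaleC_scaleR_commute)

text \<open>Complex-linear operators form a closed real subalgebra of the bounded real-linear ones.
  With a type of their own they are an instance of \<open>real_normed_algebra_1\<close> and
  \<open>banach\<close>, so the Newton iteration can be treated abstractly; complex scalars act
  through \<open>scale_fop\<close>.\<close>

typedef (overloaded) 'n fop = "{A :: 'n::finite fock \<Rightarrow>\<^sub>L 'n fock. \<forall>c f. blinfun_apply A (c *\<^sub>C f) = c *\<^sub>C blinfun_apply A f}"
  by (intro exI[of _ 0]) (simp add: blinfun.zero_left)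

setup_lifting type_definition_fop

lift_definition app :: "'n::finite fop \<Rightarrow> 'n fock \<Rightarrow> 'n fock" (infixr "\<rhd>" 76)
  is "\<lambda>(A::'n fock \<Rightarrow>\<^sub>L 'n fock) f. blinfun_apply A f" .

lift_definition scale_fop :: "complex \<Rightarrow> 'n::finite fop \<Rightarrow> 'n fop" (infixr "\<odot>" 75)
  is "\<lambda>c A. Blinfun (\<lambda>f. c *\<^sub>C blinfun_apply A f)"
proof -
  fix c d :: complex and A :: "'n fock \<Rightarrow>\<^sub>L 'n fock" and f
  assume A: "\<And>c f. blinfun_apply A (c *\<^sub>C f) = c *\<^sub>C blinfun_apply A f"
  have "bounded_linear (\<lambda>f. c *\<^sub>C blinfun_apply A f)"
    by (rule bounded_linear_scaleC_blinfun)
  then show "blinfun_apply (Blinfun (\<lambda>f. c *\<^sub>C blinfun_apply A f)) (d *\<^sub>C f)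
     = d *\<^sub>C blinfun_apply (Blinfun (\<lambda>f. c *\<^sub>C blinfun_apply A f)) f"
    using A by (simp add: bounded_linear_Blinfun_apply mult.commute)
qed

instantiation fop :: (finite) real_normed_algebra_1
begin

lift_definition zero_fop :: "'a fop" is 0 by (simp add: blinfun.zero_left)
lift_definition one_fop :: "'a fop" is id_blinfun by simp
lift_definition plus_fop :: "'a fop \<Rightarrow> 'a fop \<Rightarrow> 'a fop" is "(+)"
  by (simp add: blinfun.add_left fock.scale_right_distrib)
lift_definition minus_fop :: "'a fop \<Rightarrow> 'a fop \<Rightarrow> 'a fop" is "(-)"
  by (simp add: blinfun.diff_left fock.scale_right_diff_distrib)
lift_definition uminus_fop :: "'a fop \<Rightarrow> 'a fop" is uminus
  by (simp add: blinfun.minus_left fock.scale_minus_right)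
lift_definition scaleR_fop :: "real \<Rightarrow> 'a fop \<Rightarrow> 'a fop" is "(*\<^sub>R)"
  by (simp add: blinfun.scaleR_left scaleR_scaleC mult.commute)
lift_definition times_fop :: "'a fop \<Rightarrow> 'a fop \<Rightarrow> 'a fop" is blinfun_compose
  by simp
lift_definition norm_fop :: "'a fop \<Rightarrow> real" is norm .
definition sgn_fop :: "'a fop \<Rightarrow> 'a fop" where "sgn_fop A = inverse (norm A) *\<^sub>R A"
definition dist_fop :: "'a fop \<Rightarrow> 'a fop \<Rightarrow> real" where "dist_fop A B = norm (A - B)"
definition uniformity_fop :: "('a fop \<times> 'a fop) filter" where
  "uniformity_fop = (INF e\<in>{0<..}. principal {(x, y). dist x y < e})"
definition open_fop :: "'a fop set \<Rightarrow> bool" where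
  "open_fop U \<longleftrightarrow> (\<forall>x\<in>U. \<forall>\<^sub>F (x', y) in uniformity. x' = x \<longrightarrow> y \<in> U)"

instance
proof
  fix A B C :: "'a fop" and r s :: real and U :: "'a fop set"
  show "A + B + C = A + (B + C)" by transfer (simp add: add.assoc)
  show "A + B = B + A" by transfer (simp add: add.commute)
  show "0 + A = A" by transfer simp
  show "- A + A = 0" by transfer simp
  show "A - B = A + - B" by transfer simp
  show "r *\<^sub>R (A + B) = r *\<^sub>R A + r *\<^sub>R B" by transfer (simp add: scaleR_right_distrib)
  show "(r + s) *\<^sub>R A = r *\<^sub>R A + s *\<^sub>R A" by transfer (simp add: scaleR_left_distrib)
  show "r *\<^sub>R s *\<^sub>R A = (r * s) *\<^sub>R A" by transfer simp
  show "1 *\<^sub>R A = A" by transfer simp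
  show "A * B * C = A * (B * C)" by (transfer, rule blinfun_eqI) simp
  show "1 * A = A" "A * 1 = A" by (transfer, simp add: blinfun_eqI)+
  show "(A + B) * C = A * C + B * C" "A * (B + C) = A * B + A * C"
    by (transfer, rule blinfun_eqI, simp add: blinfun.add_left blinfun.add_right)+
  show "r *\<^sub>R A * B = r *\<^sub>R (A * B)" "A * r *\<^sub>R B = r *\<^sub>R (A * B)"
    by (transfer, rule blinfun_eqI, simp add: blinfun.scaleR_left blinfun.scaleR_right)+
  show "sgn A = inverse (norm A) *\<^sub>R A" by (simp add: sgn_fop_def)
  show "dist A B = norm (A - B)" by (simp add: dist_fop_def)
  show "(uniformity :: ('a fop \<times> 'a fop) filter) = (INF e\<in>{0<..}. principal {(x, y). dist x y < e})"
    by (simp add: uniformity_fop_def)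
  show "open U \<longleftrightarrow> (\<forall>x\<in>U. \<forall>\<^sub>F (x', y) in uniformity. x' = x \<longrightarrow> y \<in> U)"
    by (simp add: open_fop_def)
  show "norm A = 0 \<longleftrightarrow> A = 0" by transfer simp
  show "norm (A + B) \<le> norm A + norm B" by transfer (rule norm_triangle_ineq)
  show "norm (r *\<^sub>R A) = \<bar>r\<bar> * norm A" by transfer simp
  show "norm (A * B) \<le> norm A * norm B" by transfer (rule norm_blinfun_compose)
  show one: "norm (1 :: 'a fop) = 1"
  proof transfer
    have "norm (blinfun_apply id_blinfun (vac :: 'a fock)) \<le> norm (id_blinfun :: 'a fock \<Rightarrow>\<^sub>L _) * norm (vac :: 'a fock)"
      by (rule norm_blinfun)
    moreover have "norm (id_blinfun :: 'a fock \<Rightarrow>\<^sub>L _) \<le> 1"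
      by (rule norm_blinfun_bound) auto
    ultimately show "norm (id_blinfun :: 'a fock \<Rightarrow>\<^sub>L _) = 1" by simp
  qed
  show "(0 :: 'a fop) \<noteq> 1"
  proof
    assume "0 = (1 :: 'a fop)"
    then have "norm (0 :: 'a fop) = 1" using one by simp
    moreover have "norm (0 :: 'a fop) = 0" by transfer simp
    ultimately show False by simp
  qed
qed

end

lemma dist_Rep_fop: "dist (Rep_fop A) (Rep_fop B) = dist A B"
  by (simp add: dist_norm norm_fop.rep_eq minus_fop.rep_eq)

instance fop :: (finite) banach
proof
  fix X :: "nat \<Rightarrow> 'a fop" assume "Cauchy X"
  then have "Cauchy (\<lambda>n. Rep_fop (X n))" by (simp add: Cauchy_def dist_Rep_fop)
  then obtain L where L: "(\<lambda>n. Rep_fop (X n)) \<longlonglongrightarrow> L"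
    using Cauchy_convergent_iff convergent_def by blast
  have L': "(\<lambda>n. blinfun_apply (Rep_fop (X n)) f) \<longlonglongrightarrow> blinfun_apply L f" for f
    by (intro blinfun.tendsto L tendsto_const)
  have bl: "bounded_linear ((*\<^sub>C) c :: 'a fock \<Rightarrow> _)" for c
    by (rule bounded_linear_intro[where K="cmod c"])
      (auto simp: fock.scale_right_distrib scaleR_scaleC mult.commute norm_scaleC)
  have "blinfun_apply L (c *\<^sub>C f) = c *\<^sub>C blinfun_apply L f" for c f
  proof (rule LIMSEQ_unique[OF L'])
    have "(\<lambda>n. c *\<^sub>C blinfun_apply (Rep_fop (X n)) f) \<longlonglongrightarrow> c *\<^sub>C blinfun_apply L f"
      by (rule bounded_linear.tendsto[OF bl L'])
    moreover have "blinfun_apply (Rep_fop (X n)) (c *\<^sub>C f) = c *\<^sub>C blinfun_apply (Rep_fop (X n)) f" for n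
      using Rep_fop[of "X n"] by auto
    ultimately show "(\<lambda>n. blinfun_apply (Rep_fop (X n)) (c *\<^sub>C f)) \<longlonglongrightarrow> c *\<^sub>C blinfun_apply L f"
      by (simp only:)
  qed
  then have "Rep_fop (Abs_fop L) = L" by (intro Abs_fop_inverse) auto
  then have "X \<longlonglongrightarrow> Abs_fop L"
    using L by (simp add: tendsto_iff flip: dist_Rep_fop)
  then show "convergent X" by (auto simp: convergent_def)
qed

lemma app_add_right: "A \<rhd> (f + g) = A \<rhd> f + A \<rhd> g" by transfer (rule blinfun.add_right)
lemma app_diff_right: "A \<rhd> (f - g) = A \<rhd> f - A \<rhd> g" by transfer (rule blinfun.diff_right)
lemma app_zero_right [simp]: "A \<rhd> 0 = 0" by transfer (rule blinfun.zero_right)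
lemma app_scale_right: "A \<rhd> (c *\<^sub>C f) = c *\<^sub>C (A \<rhd> f)" by transfer simp
lemma app_scaleR_right: "A \<rhd> (r *\<^sub>R f) = r *\<^sub>R (A \<rhd> f)" by transfer (rule blinfun.scaleR_right)
lemma app_sum_right: "A \<rhd> (\<Sum>i\<in>I. f i) = (\<Sum>i\<in>I. A \<rhd> f i)" by transfer (rule blinfun.sum_right)
lemma app_add_left: "(A + B) \<rhd> f = A \<rhd> f + B \<rhd> f" by transfer (rule blinfun.add_left)
lemma app_diff_left: "(A - B) \<rhd> f = A \<rhd> f - B \<rhd> f" by transfer (rule blinfun.diff_left)
lemma app_minus_left: "(- A) \<rhd> f = - (A \<rhd> f)" by transfer (rule blinfun.minus_left)
lemma app_zero_left [simp]: "0 \<rhd> f = 0" by transfer (rule blinfun.zero_left)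
lemma app_scaleR_left: "(r *\<^sub>R A) \<rhd> f = r *\<^sub>R (A \<rhd> f)" by transfer (rule blinfun.scaleR_left)
lemma app_mult: "(A * B) \<rhd> f = A \<rhd> (B \<rhd> f)" by transfer simp
lemma app_one [simp]: "1 \<rhd> f = f" by transfer simp
lemma norm_app: "norm (A \<rhd> f) \<le> norm A * norm f" by transfer (rule norm_blinfun)
lemma fop_eqI: "(\<And>f. A \<rhd> f = B \<rhd> f) \<Longrightarrow> A = B" by transfer (rule blinfun_eqI)
lemma norm_fop_bound: "0 \<le> b \<Longrightarrow> (\<And>f. norm (A \<rhd> f) \<le> b * norm f) \<Longrightarrow> norm A \<le> b"
  by transfer (rule norm_blinfun_bound)
lemma norm_fop_onorm: "norm A = onorm (app A)" by transfer (simp add: norm_blinfun.rep_eq)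

lemma app_scale_left: "(c \<odot> A) \<rhd> f = c *\<^sub>C (A \<rhd> f)"
  by transfer (simp add: bounded_linear_Blinfun_apply bounded_linear_scaleC_blinfun)

lemma scale_fop_props:
  "c \<odot> (A + B) = c \<odot> A + c \<odot> B" "(c + d) \<odot> A = c \<odot> A + d \<odot> A"
  "c \<odot> (d \<odot> A) = (c * d) \<odot> A" "(c \<odot> A) * B = c \<odot> (A * B)" "A * (c \<odot> B) = c \<odot> (A * B)"
  "r *\<^sub>R A = of_real r \<odot> A" "1 \<odot> A = A" "c \<odot> (0::'a::finite fop) = 0"
  by (rule fop_eqI; simp add: app_scale_left app_scale_right app_add_left app_mult app_scaleR_left
      scaleR_scaleC fock.scale_right_distrib fock.scale_left_distrib)+

lemma norm_scale_fop: "norm (c \<odot> A) \<le> cmod c * norm A"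
proof (rule norm_fop_bound)
  fix f show "norm ((c \<odot> A) \<rhd> f) \<le> cmod c * norm A * norm f"
    using mult_left_mono[OF norm_app[of A f], of "cmod c"] by (simp add: app_scale_left norm_scaleC mult_ac)
qed simp

lemma fop_exists:
  assumes "\<And>f g. F (f + g) = F f + F g" "\<And>c f. F (c *\<^sub>C f) = c *\<^sub>C F f" "\<And>f. norm (F f) \<le> K * norm f"
  obtains A where "\<And>f. A \<rhd> f = F f"
proof -
  have bl: "bounded_linear F"
    by (rule bounded_linear_intro[where K=K]) (auto simp: assms scaleR_scaleC mult.commute)
  have "Rep_fop (Abs_fop (Blinfun F)) = Blinfun F"
    using bl assms by (intro Abs_fop_inverse) (auto simp: bounded_linear_Blinfun_apply)
  then have "Abs_fop (Blinfun F) \<rhd> f = F f" for f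
    using bl by (simp add: app.rep_eq bounded_linear_Blinfun_apply)
  then show ?thesis using that by blast
qed

lemma fock_ops_fop: assumes "A \<in> fock_ops" obtains T where "A = app T"
proof -
  have bl: "bounded_linear A" and c: "\<And>c f. A (c *\<^sub>C f) = c *\<^sub>C A f"
    using assms by (auto simp: fock_ops_def)
  obtain T where "\<And>f. T \<rhd> f = A f"
  proof (rule fop_exists[of A "onorm A"])
    show "A (f + g) = A f + A g" for f g using bl by (simp add: bounded_linear.linear linear_add)
  qed (use c onorm[OF bl] in auto)
  then have "A = app T" by auto
  then show ?thesis by (rule that)
qed

text \<open>Riesz representation for each fixed \<open>f\<close>; linearity in \<open>f\<close>
  follows from uniqueness. Both adjoints and weak operator integrals are obtained in this
  way.\<close>

lemma sesquilinear_fop: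
  assumes "\<And>f f' g. B (f + f') g = B f g + B f' g" "\<And>c f g. B (c *\<^sub>C f) g = c * B f g"
    and "\<And>f g g'. B f (g + g') = B f g + B f g'" "\<And>c f g. B f (c *\<^sub>C g) = cnj c * B f g"
    and bd: "\<And>f g. cmod (B f g) \<le> K * norm f * norm g" and K: "K \<ge> 0"
  obtains A where "\<And>f g. fock_cinner (A \<rhd> f) g = B f g" "norm A \<le> K"
proof -
  have "\<exists>h. \<forall>g. cnj (B f g) = fock_cinner g h" for f
    by (rule fock_riesz[of "\<lambda>g. cnj (B f g)" "K * norm f"]) (use assms in auto)
  then obtain F where F: "\<And>f g. cnj (B f g) = fock_cinner g (F f)" by metis
  have F': "fock_cinner (F f) g = B f g" for f g
    using F[of f g] by (metis cinner_cnj complex_cnj_cnj)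
  have Fb: "norm (F f) \<le> K * norm f" for f
  proof -
    have "norm (F f) * norm (F f) \<le> (K * norm f) * norm (F f)"
      using bd[of f "F f"] unfolding F'[symmetric] cinner_self
      by (simp add: power2_eq_square norm_mult)
    then show ?thesis using K by (cases "F f = 0") (auto simp: mult_le_cancel_right)
  qed
  obtain A where A: "\<And>f. A \<rhd> f = F f"
    by (rule fop_exists[of F K]; (intro cinner_eqI Fb)?)
      (auto simp: F' cinner_add_left cinner_scale_left assms Fb)
  show ?thesis
  proof (rule that)
    show "fock_cinner (A \<rhd> f) g = B f g" for f g by (simp add: A F')
    show "norm A \<le> K" by (rule norm_fop_bound) (auto simp: A Fb K)
  qed
qed

section \<open>Adjoints, and translations acting by automorphisms\<close>

definition adj :: "'n::finite fop \<Rightarrow> 'n fop" where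
  "adj A = (SOME B. \<forall>f g. fock_cinner (A \<rhd> f) g = fock_cinner f (B \<rhd> g))"

lemma cinner_adj: "fock_cinner (A \<rhd> f) g = fock_cinner f (adj A \<rhd> g)"
proof -
  obtain B where "\<And>f g. fock_cinner (B \<rhd> f) g = fock_cinner f (A \<rhd> g)"
  proof (rule sesquilinear_fop[of "\<lambda>f g. fock_cinner f (A \<rhd> g)" "norm A"])
    fix f g
    have "cmod (fock_cinner f (A \<rhd> g)) \<le> norm f * norm (A \<rhd> g)" by (rule cinner_cauchy_schwarz)
    also have "\<dots> \<le> norm f * (norm A * norm g)" by (intro mult_left_mono norm_app) auto
    finally show "cmod (fock_cinner f (A \<rhd> g)) \<le> norm A * norm f * norm g" by (simp add: mult_ac)
  qed (auto simp: cinner_add_left cinner_add_right cinner_scale_left cinner_scale_right app_add_right app_scale_right)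
  then have "\<forall>f g. fock_cinner (A \<rhd> f) g = fock_cinner f (B \<rhd> g)" by (metis cinner_cnj)
  then have "\<exists>B. \<forall>f g. fock_cinner (A \<rhd> f) g = fock_cinner f (B \<rhd> g)" by blast
  from someI_ex[OF this] show ?thesis unfolding adj_def by blast
qed

lemma cinner_adj': "fock_cinner (adj A \<rhd> f) g = fock_cinner f (A \<rhd> g)"
  by (metis cinner_adj cinner_cnj)

lemma adj_eqI: "(\<And>f g. fock_cinner (A \<rhd> f) g = fock_cinner f (B \<rhd> g)) \<Longrightarrow> adj A = B"
  by (intro fop_eqI cinner_eqI) (simp add: cinner_adj', metis cinner_cnj)

lemma adj_props: "adj (A + B) = adj A + adj B" "adj (A - B) = adj A - adj B" "adj (A * B) = adj B * adj A"
  "adj 1 = 1" "adj (r *\<^sub>R A) = r *\<^sub>R adj A"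
  by (rule adj_eqI; simp add: app_add_left app_diff_left app_mult app_scaleR_left scaleR_scaleC cinner_add_left cinner_add_right
     cinner_diff_left cinner_diff_right cinner_adj cinner_scale_left cinner_scale_right)+

lemma adj_adj [simp]: "adj (adj A) = A"
  by (rule adj_eqI) (rule cinner_adj')

lemma norm_cinner_app: "cmod (fock_cinner (A \<rhd> f) g) \<le> norm A * norm f * norm g"
  using cinner_cauchy_schwarz[of "A \<rhd> f" g] mult_right_mono[OF norm_app[of A f], of "norm g"] by simp

lemma norm_fop_cinner_bound:
  assumes "0 \<le> K" "\<And>f g. cmod (fock_cinner (A \<rhd> f) g) \<le> K * norm f * norm g"
  shows "norm A \<le> K"
proof (rule norm_fop_bound[OF assms(1)])
  fix f
  have "norm (A \<rhd> f) * norm (A \<rhd> f) \<le> (K * norm f) * norm (A \<rhd> f)"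
    using assms(2)[of f "A \<rhd> f"] unfolding cinner_self by (simp add: power2_eq_square norm_mult)
  then show "norm (A \<rhd> f) \<le> K * norm f" using assms(1) by (cases "A \<rhd> f = 0") (auto simp: mult_le_cancel_right)
qed

lemma norm_adj: "norm (adj A) = norm A"
proof -
  have "norm (adj A) \<le> norm A" for A :: "'a fop"
  proof (rule norm_fop_cinner_bound)
    fix f g show "cmod (fock_cinner (adj A \<rhd> f) g) \<le> norm A * norm f * norm g"
      using norm_cinner_app[of A g f] unfolding cinner_adj' by (metis cinner_cnj complex_mod_cnj mult.assoc mult.commute)
  qed simp
  from this[of A] this[of "adj A"] show ?thesis by (simp add: adj_props)
qed

definition wop :: "complex^'n::finite \<Rightarrow> 'n fop" where "wop z = (SOME A. \<forall>f. A \<rhd> f = weyl z f)"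
definition pop :: "'n::finite fop" where "pop = (SOME A. \<forall>f. A \<rhd> f = parity f)"

lemma app_wop [simp]: "wop z \<rhd> f = weyl z f"
proof -
  have "\<exists>A. \<forall>f. A \<rhd> f = weyl z f"
    by (rule fop_exists[of "weyl z" 1]) (auto simp: weyl_add weyl_scale)
  from someI_ex[OF this] show ?thesis unfolding wop_def by blast
qed

lemma norm_parity [simp]: "norm (parity f) = norm f"
proof -
  have "complex_of_real ((norm (parity f))\<^sup>2) = of_real ((norm f)\<^sup>2)"
    unfolding cinner_self[symmetric] by (simp add: cinner_parity)
  then have "(norm (parity f))\<^sup>2 = (norm f)\<^sup>2" by (simp only: of_real_eq_iff)
  then show ?thesis by (simp add: power2_eq_iff_nonneg)
qed

lemma app_pop [simp]: "pop \<rhd> f = parity f"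
proof -
  have "\<exists>A. \<forall>f. A \<rhd> f = parity f"
    by (rule fop_exists[of "parity" 1]) (auto simp: parity_add parity_scale)
  from someI_ex[OF this] show ?thesis unfolding pop_def by blast
qed

lemma pop_pop [simp]: "pop * pop = 1"
  by (rule fop_eqI) (simp add: app_mult)

lemma wop_inverse [simp]: "wop z * wop (- z) = 1" "wop (- z) * wop z = 1"
  by (rule fop_eqI; simp add: app_mult)+

definition alpha :: "complex^'n::finite \<Rightarrow> 'n fop \<Rightarrow> 'n fop" where
  "alpha z A = wop z * A * wop (- z)"

lemma app_alpha: "alpha z A \<rhd> f = weyl z (A \<rhd> weyl (- z) f)"
  by (simp add: alpha_def app_mult)

lemma cinner_alpha: "fock_cinner (alpha z A \<rhd> f) g = fock_cinner (A \<rhd> weyl (- z) f) (weyl (- z) g)"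
  by (simp add: app_alpha cinner_weyl)

text \<open>The phase of \<open>weyl_weyl\<close> enters once from each argument of the inner
  product, the second time conjugated, and cancels: conjugation is a genuine group action.\<close>

lemma alpha_alpha: "alpha z (alpha w A) = alpha (z + w) A"
proof (intro fop_eqI cinner_eqI)
  fix f g
  let ?c = "exp (- \<i> * of_real (Im (cdot w z)) / 2)"
  have 1: "weyl (- w) (weyl (- z) f) = ?c *\<^sub>C weyl (- (z + w)) f" for f
    by (simp add: weyl_weyl add.commute)
  have "cmod ?c = 1" by (simp add: norm_exp_eq_Re)
  then have 2: "?c * cnj ?c = 1" using complex_norm_square[of ?c] by simp
  have "fock_cinner (alpha z (alpha w A) \<rhd> f) g = ?c * cnj ?c * fock_cinner (alpha (z + w) A \<rhd> f) g"
    unfolding cinner_alpha 1 app_scale_right cinner_scale_left cinner_scale_right by (simp add: mult_ac)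
  then show "fock_cinner (alpha z (alpha w A) \<rhd> f) g = fock_cinner (alpha (z + w) A \<rhd> f) g" by (simp only: 2 mult_1)
qed

lemma alpha_props: "alpha z (A + B) = alpha z A + alpha z B" "alpha z (A - B) = alpha z A - alpha z B"
  "alpha z (A * B) = alpha z A * alpha z B" "alpha z 1 = 1" "alpha z (r *\<^sub>R A) = r *\<^sub>R alpha z A" "alpha 0 A = A"
proof -
  have "wop z * (A * B) * wop (- z) = wop z * A * (wop (- z) * wop z) * (B * wop (- z))"
    by (simp add: mult.assoc)
  then show "alpha z (A * B) = alpha z A * alpha z B" unfolding alpha_def by (simp only: mult.assoc)
  show "alpha 0 A = A" by (rule fop_eqI) (simp add: app_alpha)
qed (simp_all add: alpha_def algebra_simps)

lemma adj_wop: "adj (wop z) = wop (- z)"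
  by (rule adj_eqI) (simp add: cinner_weyl)

lemma adj_pop [simp]: "adj pop = pop"
  by (rule adj_eqI) (simp add: cinner_parity)

lemma adj_alpha: "adj (alpha z A) = alpha z (adj A)"
  by (simp add: alpha_def adj_props adj_wop mult.assoc)

lemma norm_alpha_le: "norm (alpha z A) \<le> norm A"
proof (rule norm_fop_bound)
  fix f show "norm (alpha z A \<rhd> f) \<le> norm A * norm f"
    using norm_app[of A "weyl (- z) f"] by (simp add: app_alpha)
qed simp

lemma pop_alpha: "pop * alpha z A * pop = alpha (- z) (pop * A * pop)"
  by (rule fop_eqI) (simp add: app_mult app_alpha parity_weyl)

definition C1 :: "'n::finite fop set" where
  "C1 = {A. ((\<lambda>z. norm (alpha z A - A)) \<longlongrightarrow> 0) (at 0)}"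

lemma fock_C1_fop: "app T \<in> fock_C1 \<Longrightarrow> T \<in> C1"
proof -
  assume T: "app T \<in> fock_C1"
  have "(\<lambda>f. weyl z (app T (fock_adj (weyl z) f)) - app T f) = app (alpha z T - T)" for z
    by (rule ext) (simp add: fock_adj_weyl app_diff_left app_alpha)
  with T show ?thesis by (simp add: fock_C1_def C1_def norm_fop_onorm)
qed

lemma C1_adj: assumes "A \<in> C1" shows "adj A \<in> C1"
proof -
  have "norm (alpha z (adj A) - adj A) = norm (alpha z A - A)" for z
    by (simp flip: adj_alpha adj_props add: norm_adj)
  with assms show ?thesis by (simp add: C1_def)
qed

text \<open>The group law and the contraction property of \<open>alpha\<close> transport continuity
  at 0 to every point.\<close>

lemma C1_continuous:
  assumes "A \<in> C1" shows "continuous_on UNIV (\<lambda>z. alpha z A)"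
  unfolding continuous_on_def
proof
  fix w
  have "norm (alpha z A - alpha w A) \<le> norm (alpha (z - w) A - A)" for z
    using norm_alpha_le[of w "alpha (z - w) A - A"] by (simp add: alpha_props alpha_alpha)
  moreover have "((\<lambda>z. norm (alpha (z - w) A - A)) \<longlongrightarrow> 0) (at w)"
    by (rule LIM_offset_zero_cancel) (use assms in \<open>simp add: C1_def\<close>)
  ultimately have "((\<lambda>z. alpha z A - alpha w A) \<longlongrightarrow> 0) (at w)"
    by (rule Lim_null_comparison[OF always_eventually[OF allI]])
  then show "((\<lambda>z. alpha z A) \<longlongrightarrow> alpha w A) (at w within UNIV)"
    by (subst Lim_null)
qed

section \<open>Gaussian averages of translates\<close>

text \<open>The weak operator integral of \<open>w z * alpha z A\<close>; it exists for \<open>A \<in> C1\<close> and integrable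
  \<open>w\<close>.\<close>

definition smear :: "(complex^'n::finite \<Rightarrow> complex) \<Rightarrow> 'n fop \<Rightarrow> 'n fop" where
  "smear w A = (SOME J. \<forall>f g. fock_cinner (J \<rhd> f) g = (\<integral>z. w z * fock_cinner (alpha z A \<rhd> f) g \<partial>lborel))"

lemma cinner_alpha_continuous:
  assumes "A \<in> C1"
  shows "continuous_on UNIV (\<lambda>z. fock_cinner (alpha z A \<rhd> f) g)"
proof -
  have "continuous_on UNIV (\<lambda>z. alpha z A \<rhd> f)"
  proof (rule bounded_linear.continuous_on[OF _ C1_continuous[OF assms]])
    show "bounded_linear (\<lambda>A. A \<rhd> f)"
      by (rule bounded_linear_intro[where K="norm f"]) (auto simp: app_add_left app_scaleR_left norm_app)
  qed
  then show ?thesis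
    unfolding continuous_on_def by (auto intro: cinner_tendsto)
qed

lemma smear_integrable:
  assumes A: "A \<in> C1" and w: "integrable lborel w"
  shows "integrable lborel (\<lambda>z. w z * fock_cinner (alpha z A \<rhd> f) g)"
proof (rule Bochner_Integration.integrable_bound)
  show "integrable lborel (\<lambda>z. w z * of_real (norm A * norm f * norm g))" using w by simp
  have [measurable]: "(\<lambda>z. fock_cinner (alpha z A \<rhd> f) g) \<in> borel_measurable borel"
    by (rule borel_measurable_continuous_onI[OF cinner_alpha_continuous[OF A]])
  have [measurable]: "w \<in> borel_measurable lborel" using w by auto
  show "(\<lambda>z. w z * fock_cinner (alpha z A \<rhd> f) g) \<in> borel_measurable lborel" by measurable
  have "cmod (fock_cinner (alpha z A \<rhd> f) g) \<le> norm A * norm f * norm g" for z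
    by (rule order_trans[OF norm_cinner_app]) (intro mult_right_mono norm_alpha_le; simp)
  then show "AE z in lborel. norm (w z * fock_cinner (alpha z A \<rhd> f) g) \<le> norm (w z * of_real (norm A * norm f * norm g))"
    by (intro AE_I2) (simp add: norm_mult mult_left_mono)
qed

text \<open>Existence of the integral: the right-hand side is a sesquilinear form bounded by the L1
  norm of \<open>w\<close> times \<open>norm A\<close>.\<close>

lemma cinner_smear:
  assumes A: "A \<in> C1" and w: "integrable lborel w"
  shows "fock_cinner (smear w A \<rhd> f) g = (\<integral>z. w z * fock_cinner (alpha z A \<rhd> f) g \<partial>lborel)"
proof -
  note i = smear_integrable[OF A w]
  have "\<exists>J. \<forall>f g. fock_cinner (J \<rhd> f) g = (\<integral>z. w z * fock_cinner (alpha z A \<rhd> f) g \<partial>lborel)"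
  proof (rule sesquilinear_fop[of "\<lambda>f g. (\<integral>z. w z * fock_cinner (alpha z A \<rhd> f) g \<partial>lborel)"
        "(\<integral>z. cmod (w z) \<partial>lborel) * norm A"])
    fix f g
    have "cmod (\<integral>z. w z * fock_cinner (alpha z A \<rhd> f) g \<partial>lborel)
        \<le> (\<integral>z. cmod (w z) * (norm A * norm f * norm g) \<partial>lborel)"
    proof (rule Bochner_Integration.integral_norm_bound_integral[OF i])
      show "integrable lborel (\<lambda>z. cmod (w z) * (norm A * norm f * norm g))" using w by auto
      fix z
      have "cmod (fock_cinner (alpha z A \<rhd> f) g) \<le> norm A * norm f * norm g"
        by (rule order_trans[OF norm_cinner_app]) (intro mult_right_mono norm_alpha_le; simp)
      then show "cmod (w z * fock_cinner (alpha z A \<rhd> f) g) \<le> cmod (w z) * (norm A * norm f * norm g)"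
        by (simp add: norm_mult mult_left_mono)
    qed
    then show "cmod (\<integral>z. w z * fock_cinner (alpha z A \<rhd> f) g \<partial>lborel)
        \<le> (\<integral>z. cmod (w z) \<partial>lborel) * norm A * norm f * norm g" by (simp add: mult.assoc)
  next
    fix f f' g g' c
    show "(\<integral>z. w z * fock_cinner (alpha z A \<rhd> (f + f')) g \<partial>lborel) =
      (\<integral>z. w z * fock_cinner (alpha z A \<rhd> f) g \<partial>lborel) + (\<integral>z. w z * fock_cinner (alpha z A \<rhd> f') g \<partial>lborel)"
      by (simp add: app_add_right cinner_add_left distrib_left Bochner_Integration.integral_add i)
    show "(\<integral>z. w z * fock_cinner (alpha z A \<rhd> f) (g + g') \<partial>lborel) =
      (\<integral>z. w z * fock_cinner (alpha z A \<rhd> f) g \<partial>lborel) + (\<integral>z. w z * fock_cinner (alpha z A \<rhd> f) g' \<partial>lborel)"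
      by (simp add: cinner_add_right distrib_left Bochner_Integration.integral_add i)
    have "w z * (c * y) = c * (w z * y)" for z y by simp
    then show "(\<integral>z. w z * fock_cinner (alpha z A \<rhd> (c *\<^sub>C f)) g \<partial>lborel) = c * (\<integral>z. w z * fock_cinner (alpha z A \<rhd> f) g \<partial>lborel)"
      by (simp only: app_scale_right cinner_scale_left integral_mult_right_zero)
    have "w z * (cnj c * y) = cnj c * (w z * y)" for z y by simp
    then show "(\<integral>z. w z * fock_cinner (alpha z A \<rhd> f) (c *\<^sub>C g) \<partial>lborel) = cnj c * (\<integral>z. w z * fock_cinner (alpha z A \<rhd> f) g \<partial>lborel)"
      by (simp only: cinner_scale_right integral_mult_right_zero)
  qed auto
  from someI_ex[OF this] show ?thesis unfolding smear_def by blast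
qed

text \<open>A weight of total mass 1 averages the constant \<open>B\<close> to itself, so the
  difference is the average of \<open>alpha z A - B\<close>.\<close>

lemma norm_smear_diff:
  assumes A: "A \<in> C1" and w: "integrable lborel w"
    and G: "integrable lborel G" "\<And>z. cmod (w z) * norm (alpha z A - B) \<le> G z"
    and wB: "(\<integral>z. w z \<partial>lborel) = 1"
  shows "norm (smear w A - B) \<le> (\<integral>z. G z \<partial>lborel)"
proof (rule norm_fop_cinner_bound)
  have G0: "0 \<le> G z" for z using G(2)[of z] by (meson mult_nonneg_nonneg norm_ge_zero order_trans)
  then show "0 \<le> (\<integral>z. G z \<partial>lborel)" by (intro Bochner_Integration.integral_nonneg)
  fix f g
  have "fock_cinner ((smear w A - B) \<rhd> f) g
      = (\<integral>z. w z * fock_cinner (alpha z A \<rhd> f) g \<partial>lborel) - (\<integral>z. w z * fock_cinner (B \<rhd> f) g \<partial>lborel)"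
    by (simp add: app_diff_left cinner_diff_left cinner_smear[OF A w] wB)
  also have "\<dots> = (\<integral>z. w z * fock_cinner (alpha z A \<rhd> f) g - w z * fock_cinner (B \<rhd> f) g \<partial>lborel)"
    using w by (intro Bochner_Integration.integral_diff[symmetric] smear_integrable A) auto
  also have "\<dots> = (\<integral>z. w z * fock_cinner ((alpha z A - B) \<rhd> f) g \<partial>lborel)"
    by (simp add: app_diff_left cinner_diff_left right_diff_distrib)
  also have "cmod \<dots> \<le> (\<integral>z. G z * (norm f * norm g) \<partial>lborel)"
  proof (rule Bochner_Integration.integral_norm_bound_integral)
    have "integrable lborel (\<lambda>z. w z * fock_cinner (alpha z A \<rhd> f) g - w z * fock_cinner (B \<rhd> f) g)"
      using w by (intro Bochner_Integration.integrable_diff smear_integrable A) auto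
    then show "integrable lborel (\<lambda>z. w z * fock_cinner ((alpha z A - B) \<rhd> f) g)"
      by (simp add: app_diff_left cinner_diff_left right_diff_distrib)
    show "integrable lborel (\<lambda>z. G z * (norm f * norm g))" using G by auto
    fix z
    have "cmod (w z * fock_cinner ((alpha z A - B) \<rhd> f) g) \<le> cmod (w z) * (norm (alpha z A - B) * norm f * norm g)"
      unfolding norm_mult by (intro mult_left_mono norm_cinner_app) auto
    also have "\<dots> = (cmod (w z) * norm (alpha z A - B)) * (norm f * norm g)" by simp
    also have "\<dots> \<le> G z * (norm f * norm g)" by (intro mult_right_mono G) auto
    finally show "cmod (w z * fock_cinner ((alpha z A - B) \<rhd> f) g) \<le> G z * (norm f * norm g)" .
  qed
  finally show "cmod (fock_cinner ((smear w A - B) \<rhd> f) g) \<le> (\<integral>z. G z \<partial>lborel) * norm f * norm g"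
    by (simp add: mult.assoc)
qed

lemma norm_smear:
  assumes A: "A \<in> C1" and w: "integrable lborel w"
    and G: "integrable lborel G" "\<And>z. cmod (w z) \<le> G z"
  shows "norm (smear w A) \<le> (\<integral>z. G z \<partial>lborel) * norm A"
proof (rule norm_fop_cinner_bound)
  have G0: "0 \<le> G z" for z using G(2)[of z] by (meson norm_ge_zero order_trans)
  then show "0 \<le> (\<integral>z. G z \<partial>lborel) * norm A" by (intro mult_nonneg_nonneg Bochner_Integration.integral_nonneg) auto
  fix f g
  have "cmod (\<integral>z. w z * fock_cinner (alpha z A \<rhd> f) g \<partial>lborel) \<le> (\<integral>z. G z * (norm A * norm f * norm g) \<partial>lborel)"
  proof (rule Bochner_Integration.integral_norm_bound_integral)
    show "integrable lborel (\<lambda>z. G z * (norm A * norm f * norm g))" using G by auto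
    fix z
    have "cmod (fock_cinner (alpha z A \<rhd> f) g) \<le> norm A * norm f * norm g"
      by (rule order_trans[OF norm_cinner_app]) (intro mult_right_mono norm_alpha_le; simp)
    then show "cmod (w z * fock_cinner (alpha z A \<rhd> f) g) \<le> G z * (norm A * norm f * norm g)"
      unfolding norm_mult by (intro mult_mono G G0) auto
  qed (rule smear_integrable[OF A w])
  then show "cmod (fock_cinner (smear w A \<rhd> f) g) \<le> (\<integral>z. G z \<partial>lborel) * norm A * norm f * norm g"
    by (simp add: cinner_smear[OF A w] mult.assoc)
qed

lemma smear_diff:
  assumes "A \<in> C1" "integrable lborel w" "integrable lborel u"
  shows "smear (\<lambda>z. w z - u z) A = smear w A - smear u A"
proof (intro fop_eqI cinner_eqI)
  fix f g
  show "fock_cinner (smear (\<lambda>z. w z - u z) A \<rhd> f) g = fock_cinner ((smear w A - smear u A) \<rhd> f) g"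
    using assms by (simp add: cinner_smear app_diff_left cinner_diff_left left_diff_distrib smear_integrable)
qed

lemma smear_scale:
  assumes "A \<in> C1" "integrable lborel w"
  shows "smear (\<lambda>z. c * w z) A = c \<odot> smear w A"
proof (intro fop_eqI cinner_eqI)
  fix f g
  show "fock_cinner (smear (\<lambda>z. c * w z) A \<rhd> f) g = fock_cinner ((c \<odot> smear w A) \<rhd> f) g"
    using assms by (simp add: cinner_smear app_scale_left cinner_scale_left mult.assoc)
qed

text \<open>Translating the average amounts to translating the weight. Analyticity of an orbit is
  thus inherited from the weight, whatever the regularity of \<open>A\<close>.\<close>

lemma smear_shift:
  assumes A: "A \<in> C1" and w: "integrable lborel w"
  shows "alpha x (smear w A) = smear (\<lambda>z. w (z - x)) A"
proof (intro fop_eqI cinner_eqI)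
  fix f g
  have [measurable]: "(\<lambda>z. fock_cinner (alpha z A \<rhd> f) g) \<in> borel_measurable borel"
    by (rule borel_measurable_continuous_onI[OF cinner_alpha_continuous[OF A]])
  have [measurable]: "w \<in> borel_measurable borel" using w by auto
  have "fock_cinner (alpha x (smear w A) \<rhd> f) g = (\<integral>z. w z * fock_cinner (alpha z A \<rhd> weyl (- x) f) (weyl (- x) g) \<partial>lborel)"
    unfolding cinner_alpha[of x] by (rule cinner_smear[OF A w])
  also have "\<dots> = (\<integral>z. w ((z + x) - x) * fock_cinner (alpha (z + x) A \<rhd> f) g \<partial>lborel)"
    by (simp add: cinner_alpha[of x, symmetric] alpha_alpha add.commute)
  also have "\<dots> = (\<integral>z. w (z - x) * fock_cinner (alpha z A \<rhd> f) g \<partial>lborel)"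
    using integral_lborel_shift[of "\<lambda>z. w (z - x) * fock_cinner (alpha z A \<rhd> f) g" "- x"] by simp
  also have "\<dots> = fock_cinner (smear (\<lambda>z. w (z - x)) A \<rhd> f) g"
    by (rule cinner_smear[symmetric, OF A integrable_lborel_shift[OF w]])
  finally show "fock_cinner (alpha x (smear w A) \<rhd> f) g = fock_cinner (smear (\<lambda>z. w (z - x)) A \<rhd> f) g" .
qed

lemma smear_adj:
  assumes A: "A \<in> C1" and w: "integrable lborel w" and real: "\<And>z. cnj (w z) = w z"
  shows "adj (smear w A) = smear w (adj A)"
proof (rule adj_eqI)
  fix f g
  have "cnj (fock_cinner (smear w (adj A) \<rhd> g) f) = (\<integral>z. cnj (w z * fock_cinner (alpha z (adj A) \<rhd> g) f) \<partial>lborel)"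
    unfolding cinner_smear[OF C1_adj[OF A] w] by (rule Bochner_Integration.integral_cnj[symmetric])
  also have "\<dots> = (\<integral>z. w z * fock_cinner (alpha z A \<rhd> f) g \<partial>lborel)"
    by (simp add: real cinner_cnj cinner_adj adj_alpha)
  finally show "fock_cinner (smear w A \<rhd> f) g = fock_cinner f (smear w (adj A) \<rhd> g)"
    unfolding cinner_smear[OF A w] cinner_cnj ..
qed

text \<open>Parity reverses translations, and an even weight does not notice the reversal.\<close>

lemma smear_odd:
  assumes A: "A \<in> C1" and w: "integrable lborel w" and even: "\<And>z. w (- z) = w z"
    and odd: "pop * A * pop = - A"
  shows "pop * smear w A * pop = - smear w A"
proof (intro fop_eqI cinner_eqI)
  fix f g
  have [measurable]: "(\<lambda>z. fock_cinner (alpha z A \<rhd> f) g) \<in> borel_measurable borel"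
    by (rule borel_measurable_continuous_onI[OF cinner_alpha_continuous[OF A]])
  have [measurable]: "w \<in> borel_measurable borel" using w by auto
  let ?h = "\<lambda>z. w z * fock_cinner (alpha z A \<rhd> f) g"
  have neg: "fock_cinner (alpha z A \<rhd> parity f) (parity g) = - fock_cinner (alpha (- z) A \<rhd> f) g" for z
  proof -
    have "fock_cinner (alpha z A \<rhd> parity f) (parity g) = fock_cinner ((pop * alpha z A * pop) \<rhd> f) g"
      by (simp add: app_mult cinner_parity)
    also have "\<dots> = - fock_cinner (alpha (- z) A \<rhd> f) g"
      unfolding pop_alpha odd by (simp add: alpha_def app_minus_left cinner_minus_left)
    finally show ?thesis .
  qed
  have m1: "(- 1) *s z = - z" for z :: "complex^'a" by (simp add: vec_eq_iff)
  have "fock_cinner ((pop * smear w A * pop) \<rhd> f) g = fock_cinner (smear w A \<rhd> parity f) (parity g)"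
    by (simp add: app_mult cinner_parity)
  also have "\<dots> = (\<integral>z. - ?h (- z) \<partial>lborel)"
    unfolding cinner_smear[OF A w] neg by (simp add: even)
  also have "\<dots> = - (\<integral>z. ?h z \<partial>lborel)"
    using integral_lborel_rotate(2)[of ?h "-1"] unfolding m1 by simp
  finally show "fock_cinner ((pop * smear w A * pop) \<rhd> f) g = fock_cinner ((- smear w A) \<rhd> f) g"
    by (simp add: app_minus_left cinner_minus_left cinner_smear[OF A w])
qed

text \<open>For real \<open>t\<close> and unit \<open>e\<close> this is the normalized Gaussian
  centred at \<open>t e\<close>. The square is multiplied out so that the expression is entire in
  \<open>t\<close>; \<open>l\<close> is the inverse squared width.\<close>

definition gauss_weight :: "real \<Rightarrow> complex^'n::finite \<Rightarrow> complex \<Rightarrow> complex^'n \<Rightarrow> complex" where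
  "gauss_weight l e t z = of_real ((l / pi) ^ CARD('n))
     * exp (- of_real (l * (norm z)\<^sup>2) + 2 * of_real l * t * of_real (z \<bullet> e) - of_real l * t\<^sup>2)"

lemma gauss_weight_zero: "gauss_weight l e 0 z = of_real ((l / pi) ^ CARD('n) * exp (- l * (norm z)\<^sup>2))" for z :: "complex^'n::finite"
  by (simp add: gauss_weight_def exp_of_real[symmetric])

text \<open>The majorant is the same for all unit directions \<open>e\<close>. This uniformity is
  essential, since the decay estimate chooses the direction according to the pair of points at which
  the kernel is evaluated.\<close>

lemma gauss_weight_bound:
  fixes z e :: "complex^'n::finite"
  assumes l: "l > 0" and e: "norm e = 1"
  shows "cmod (gauss_weight l e t z) \<le> (l / pi) ^ CARD('n) * exp (l * (cmod t)\<^sup>2) * exp (- l * (norm z)\<^sup>2 + 2 * l * cmod t * norm z)"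
proof -
  have "l * (Re t * (z \<bullet> e)) \<le> l * (cmod t * norm z)"
  proof (rule mult_left_mono)
    have "Re t * (z \<bullet> e) \<le> \<bar>Re t\<bar> * \<bar>z \<bullet> e\<bar>" by (metis abs_ge_self abs_mult)
    also have "\<dots> \<le> cmod t * norm z"
      using Cauchy_Schwarz_ineq2[of z e] e by (intro mult_mono abs_Re_le_cmod) auto
    finally show "Re t * (z \<bullet> e) \<le> cmod t * norm z" .
  qed (use l in simp)
  moreover have "- (l * Re (t\<^sup>2)) \<le> l * (cmod t)\<^sup>2"
  proof -
    have "- Re (t\<^sup>2) \<le> (cmod t)\<^sup>2" using abs_Re_le_cmod[of "t\<^sup>2"] by (simp add: norm_power)
    from mult_left_mono[OF this, of l] l show ?thesis by simp
  qed
  ultimately have "Re (- of_real (l * (norm z)\<^sup>2) + 2 * of_real l * t * of_real (z \<bullet> e) - of_real l * t\<^sup>2)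
     \<le> l * (cmod t)\<^sup>2 + (- l * (norm z)\<^sup>2 + 2 * l * cmod t * norm z)"
    by (simp add: mult.assoc del: of_real_power)
  then have "exp (Re (- of_real (l * (norm z)\<^sup>2) + 2 * of_real l * t * of_real (z \<bullet> e) - of_real l * t\<^sup>2))
     \<le> exp (l * (cmod t)\<^sup>2) * exp (- l * (norm z)\<^sup>2 + 2 * l * cmod t * norm z)"
    unfolding exp_add[symmetric] exp_le_cancel_iff .
  moreover have "cmod (of_real ((l / pi) ^ CARD('n))) = (l / pi) ^ CARD('n)" using l by (simp add: norm_power norm_divide)
  moreover have "0 \<le> (l / pi) ^ CARD('n)" using l by simp
  ultimately show ?thesis
    unfolding gauss_weight_def norm_mult norm_exp_eq_Re mult.assoc by (metis mult_left_mono)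
qed

lemma gauss_weight_measurable [measurable]: "gauss_weight l e t \<in> borel_measurable borel"
  unfolding gauss_weight_def by (intro borel_measurable_continuous_onI continuous_intros)

lemma gauss_weight_integrable:
  fixes e :: "complex^'n::finite"
  assumes l: "l > 0" and e: "norm e = 1"
  shows "integrable lborel (gauss_weight l e t)"
proof (rule Bochner_Integration.integrable_bound)
  show "integrable lborel (\<lambda>z::complex^'n. (l / pi) ^ CARD('n) * exp (l * (cmod t)\<^sup>2) * exp (- l * (norm z)\<^sup>2 + 2 * l * cmod t * norm z))"
    by (intro integrable_mult_right gaussian_integrable_linear l)
  show "AE z in lborel. norm (gauss_weight l e t z) \<le> norm ((l / pi) ^ CARD('n) * exp (l * (cmod t)\<^sup>2) * exp (- l * (norm z)\<^sup>2 + 2 * l * cmod t * norm z))"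
    using gauss_weight_bound[OF l e, of t] l by (intro AE_I2) (simp add: abs_mult)
qed simp

lemma gauss_weight_integral:
  fixes e :: "complex^'n::finite"
  assumes l: "l > 0"
  shows "(\<integral>z. gauss_weight l e 0 z \<partial>lborel) = 1"
proof -
  have "(\<integral>z. (l / pi) ^ CARD('n) * exp (- l * (norm z)\<^sup>2) \<partial>(lborel :: (complex^'n) measure)) = 1"
    using gaussian_integral[OF l, where 'n='n] l by (simp add: power_divide)
  then show ?thesis unfolding gauss_weight_zero integral_complex_of_real by simp
qed

text \<open>A change of the centre multiplies the weight by the exponential of a quadratic
  polynomial in \<open>h\<close>, so increments in \<open>t\<close> reduce to Taylor estimates for
  \<open>exp\<close>.\<close>

lemma gauss_weight_step:
  "gauss_weight l e (t + h) z = gauss_weight l e t z * exp (h * (2 * of_real l * (of_real (z \<bullet> e) - t)) - of_real l * h\<^sup>2)"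
proof -
  have "gauss_weight l e t z * exp (h * (2 * of_real l * (of_real (z \<bullet> e) - t)) - of_real l * h\<^sup>2)
    = of_real ((l / pi) ^ CARD('a)) * exp (- of_real (l * (norm z)\<^sup>2) + 2 * of_real l * t * of_real (z \<bullet> e) - of_real l * t\<^sup>2
       + (h * (2 * of_real l * (of_real (z \<bullet> e) - t)) - of_real l * h\<^sup>2))"
    unfolding gauss_weight_def exp_add by (simp only: mult.assoc)
  also have "- of_real (l * (norm z)\<^sup>2) + 2 * of_real l * t * of_real (z \<bullet> e) - of_real l * t\<^sup>2
       + (h * (2 * of_real l * (of_real (z \<bullet> e) - t)) - of_real l * h\<^sup>2)
    = - of_real (l * (norm z)\<^sup>2) + 2 * of_real l * (t + h) * of_real (z \<bullet> e) - of_real l * (t + h)\<^sup>2"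
    by (simp add: power2_eq_square algebra_simps)
  finally show ?thesis by (simp only: gauss_weight_def[of l e "t + h" z])
qed

text \<open>Taylor remainders of \<open>exp\<close> at \<open>a = h * b - l * h^2\<close>, where |a|
  is at most |h| times \<beta> = |b| + l. Powers of \<beta> are absorbed by a second factor exp
  \<beta>, which explains the 2 in the exponent; in the second bound, \<open>l\<close> accounts for
  replacing \<open>a\<close> by \<open>h * b\<close>. Since \<open>b\<close> will be affine in
  \<open>z\<close>, the bounds remain integrable against a Gaussian.\<close>

lemma exp_step_bounds:
  fixes b h :: complex
  assumes h: "cmod h \<le> 1" and l: "l > 0"
  shows "cmod (exp (h * b - of_real l * h\<^sup>2) - 1) \<le> cmod h * exp (2 * (cmod b + l))"
    and "cmod (exp (h * b - of_real l * h\<^sup>2) - 1 - h * b) \<le> (cmod h)\<^sup>2 * ((2 + l) * exp (2 * (cmod b + l)))"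
proof -
  define a where "a = h * b - of_real l * h\<^sup>2"
  define \<beta> where "\<beta> = cmod b + l"
  have \<beta>: "\<beta> > 0" using l by (simp add: \<beta>_def add_nonneg_pos)
  have "cmod (of_real l * h\<^sup>2) = l * (cmod h * cmod h)" using l by (simp add: norm_mult norm_power power2_eq_square)
  also have "\<dots> \<le> l * (cmod h * 1)" using l h by (intro mult_left_mono) auto
  finally have "cmod a \<le> cmod h * cmod b + l * cmod h"
    unfolding a_def using norm_triangle_ineq4[of "h * b" "of_real l * h\<^sup>2"] by (simp add: norm_mult)
  then have a: "cmod a \<le> cmod h * \<beta>" by (simp add: \<beta>_def algebra_simps)
  have ab: "cmod a \<le> \<beta>" using a mult_right_mono[OF h, of \<beta>] \<beta> by linarith
  have e1: "\<beta> \<le> exp \<beta>" using exp_ge_add_one_self[of \<beta>] by linarith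
  have e2: "\<beta>\<^sup>2 \<le> 2 * exp \<beta>"
    using exp_lower_Taylor_quadratic[of \<beta>] \<beta> by simp
  have ee: "exp \<beta> * exp \<beta> = exp (2 * \<beta>)" by (simp add: exp_add[symmetric])
  have "cmod (exp a - 1) \<le> exp (cmod a) * cmod a" using Taylor_exp_field[of a 0] by simp
  also have "\<dots> \<le> exp \<beta> * (cmod h * \<beta>)" using a ab by (intro mult_mono) auto
  also have "\<dots> \<le> exp \<beta> * (cmod h * exp \<beta>)" using e1 by (intro mult_left_mono) auto
  finally show "cmod (exp (h * b - of_real l * h\<^sup>2) - 1) \<le> cmod h * exp (2 * (cmod b + l))"
    unfolding a_def \<beta>_def[symmetric] ee[symmetric] by (simp add: mult_ac)
  have "cmod (exp a - 1 - a) \<le> exp (cmod a) * (cmod a)\<^sup>2"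
    using Taylor_exp_field[of a 1] by (simp add: power2_eq_square diff_diff_eq)
  also have "\<dots> \<le> exp \<beta> * (cmod h * \<beta>)\<^sup>2" using a ab by (intro mult_mono power_mono) auto
  also have "\<dots> = (cmod h)\<^sup>2 * (exp \<beta> * \<beta>\<^sup>2)" by (simp add: power_mult_distrib)
  also have "\<dots> \<le> (cmod h)\<^sup>2 * (exp \<beta> * (2 * exp \<beta>))" using e2 by (intro mult_left_mono) auto
  finally have 1: "cmod (exp a - 1 - a) \<le> (cmod h)\<^sup>2 * (2 * exp (2 * \<beta>))" unfolding ee[symmetric] by (simp only: mult_ac)
  have eq: "exp a - 1 - h * b = (exp a - 1 - a) - of_real l * h\<^sup>2" by (simp add: a_def)
  have "cmod ((exp a - 1 - a) - of_real l * h\<^sup>2) \<le> cmod (exp a - 1 - a) + l * (cmod h)\<^sup>2"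
    using norm_triangle_ineq4[of "exp a - 1 - a" "of_real l * h\<^sup>2"] l by (simp add: norm_mult norm_power)
  then have "cmod (exp a - 1 - h * b) \<le> cmod (exp a - 1 - a) + l * (cmod h)\<^sup>2" unfolding eq .
  also have "\<dots> \<le> (cmod h)\<^sup>2 * (2 * exp (2 * \<beta>)) + l * (cmod h)\<^sup>2 * exp (2 * \<beta>)"
  proof (rule add_mono[OF 1])
    have "l * (cmod h)\<^sup>2 * 1 \<le> l * (cmod h)\<^sup>2 * exp (2 * \<beta>)"
      using \<beta> l by (intro mult_left_mono) auto
    then show "l * (cmod h)\<^sup>2 \<le> l * (cmod h)\<^sup>2 * exp (2 * \<beta>)" by simp
  qed
  finally show "cmod (exp (h * b - of_real l * h\<^sup>2) - 1 - h * b) \<le> (cmod h)\<^sup>2 * ((2 + l) * exp (2 * (cmod b + l)))"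
    unfolding a_def \<beta>_def by (simp add: algebra_simps)
qed

section \<open>Analytic continuation of orbits\<close>

text \<open>Holomorphy in operator norm on the whole plane; complex linearity of the derivative is
  expressed by its shape \<open>h \<odot> T'\<close>.\<close>

definition hol_family :: "(complex \<Rightarrow> 'n::finite fop) \<Rightarrow> bool" where
  "hol_family T \<longleftrightarrow> (\<forall>t. \<exists>T'. (T has_derivative (\<lambda>h. h \<odot> T')) (at t))"

text \<open>\<open>orbit_ext e C T\<close>: \<open>T\<close> is the analytic continuation of the orbit of \<open>C\<close> under translations in
  direction \<open>e\<close> to complex times.\<close>

definition orbit_ext :: "complex^'n::finite \<Rightarrow> 'n fop \<Rightarrow> (complex \<Rightarrow> 'n fop) \<Rightarrow> bool" where
  "orbit_ext e C T \<longleftrightarrow> hol_family T \<and> (\<forall>t::real. T (of_real t) = alpha (of_real t *s e) C)"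

lemma bounded_linear_scale_fop: "bounded_linear (\<lambda>h. h \<odot> A)"
  by (rule bounded_linear_intro[where K="norm A"])
     (auto simp: scale_fop_props scaleR_conv_of_real norm_scale_fop)

lemma hol_family_const: "hol_family (\<lambda>_. A)"
  unfolding hol_family_def by (intro allI exI[of _ 0]) (simp add: scale_fop_props)

lemma hol_family_add: assumes "hol_family S" "hol_family T" shows "hol_family (\<lambda>t. S t + T t)"
  unfolding hol_family_def
proof
  fix t
  obtain S' T' where "(S has_derivative (\<lambda>h. h \<odot> S')) (at t)" "(T has_derivative (\<lambda>h. h \<odot> T')) (at t)"
    using assms unfolding hol_family_def by meson
  from has_derivative_add[OF this] show "\<exists>D. ((\<lambda>t. S t + T t) has_derivative (\<lambda>h. h \<odot> D)) (at t)"
    by (intro exI[of _ "S' + T'"]) (simp add: scale_fop_props)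
qed

lemma hol_family_mult: assumes "hol_family S" "hol_family T" shows "hol_family (\<lambda>t. S t * T t)"
  unfolding hol_family_def
proof
  fix t
  obtain S' T' where "(S has_derivative (\<lambda>h. h \<odot> S')) (at t)" "(T has_derivative (\<lambda>h. h \<odot> T')) (at t)"
    using assms unfolding hol_family_def by meson
  from has_derivative_mult[OF this] show "\<exists>D. ((\<lambda>t. S t * T t) has_derivative (\<lambda>h. h \<odot> D)) (at t)"
    by (intro exI[of _ "S t * T' + S' * T t"]) (simp add: scale_fop_props)
qed

lemma orbit_ext_one: "orbit_ext e 1 (\<lambda>_. 1)"
  by (simp add: orbit_ext_def hol_family_const alpha_props)

lemma orbit_ext_add: "orbit_ext e C S \<Longrightarrow> orbit_ext e D T \<Longrightarrow> orbit_ext e (C + D) (\<lambda>t. S t + T t)"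
  by (simp add: orbit_ext_def hol_family_add alpha_props)

text \<open>\<open>alpha z\<close> is multiplicative, so the continuation of a word is the word in
  the continuations.\<close>

lemma orbit_ext_mult: "orbit_ext e C S \<Longrightarrow> orbit_ext e D T \<Longrightarrow> orbit_ext e (C * D) (\<lambda>t. S t * T t)"
  by (simp add: orbit_ext_def hol_family_mult alpha_props)

lemma orbit_ext_scaleR: "orbit_ext e C S \<Longrightarrow> orbit_ext e (r *\<^sub>R C) (\<lambda>t. r *\<^sub>R S t)"
  using hol_family_mult[OF hol_family_const[of "r *\<^sub>R 1"], of S] by (simp add: orbit_ext_def alpha_props)

lemma orbit_ext_diff: "orbit_ext e C S \<Longrightarrow> orbit_ext e D T \<Longrightarrow> orbit_ext e (C - D) (\<lambda>t. S t - T t)"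
  using orbit_ext_add[of e C S "(-1) *\<^sub>R D" "\<lambda>t. (-1) *\<^sub>R T t"] orbit_ext_scaleR[of e D T "-1"] by simp

lemma orbit_ext_power: "orbit_ext e C S \<Longrightarrow> orbit_ext e (C ^ k) (\<lambda>t. S t ^ k)"
  by (induction k) (auto intro: orbit_ext_one orbit_ext_mult)

section \<open>Gaussian averages at complex times and for small width\<close>

definition mollify :: "real \<Rightarrow> 'n::finite fop \<Rightarrow> 'n fop" where
  "mollify l A = smear (gauss_weight l 0 0) A"

definition mollify_ext :: "real \<Rightarrow> complex^'n::finite \<Rightarrow> 'n fop \<Rightarrow> complex \<Rightarrow> 'n fop" where
  "mollify_ext l e A t = smear (gauss_weight l e t) A"

lemma mollify_ext_0: "mollify_ext l e A 0 = mollify l A"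
proof -
  have "gauss_weight l e 0 = gauss_weight l 0 0" by (rule ext) (simp only: gauss_weight_zero)
  then show ?thesis by (simp add: mollify_ext_def mollify_def)
qed

lemma gauss_step_integrable:
  "l > 0 \<Longrightarrow> integrable lborel (\<lambda>z::complex^'n::finite. c * exp (- l * (norm z)\<^sup>2 + b * norm z))"
  by (intro integrable_mult_right gaussian_integrable_linear)

lemma gauss_weight_factor_bound:
  fixes z e :: "complex^'n::finite"
  assumes l: "l > 0" and e: "norm e = 1"
  shows "exp (2 * (cmod (2 * of_real l * (of_real (z \<bullet> e) - t)) + l)) \<le> exp (4 * l * cmod t + 2 * l) * exp (4 * l * norm z)"
proof -
  have "cmod (of_real (z \<bullet> e) - t) \<le> norm z + cmod t"
    using norm_triangle_ineq4[of "of_real (z \<bullet> e) :: complex" t] Cauchy_Schwarz_ineq2[of z e] e by simp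
  from mult_left_mono[OF this, of "2 * l"] l
  have "cmod (2 * of_real l * (of_real (z \<bullet> e) - t)) \<le> 2 * l * (norm z + cmod t)" by (simp add: norm_mult)
  then show ?thesis by (simp add: algebra_simps flip: exp_add)
qed

lemma le_exp_double:
  fixes x l :: real
  assumes "0 \<le> x" "0 < l" shows "x \<le> exp (2 * (x + l))"
proof -
  have "x \<le> 1 + 2 * (x + l)" using assms by simp
  also have "\<dots> \<le> exp (2 * (x + l))" by (rule exp_ge_add_one_self)
  finally show ?thesis .
qed

text \<open>At real times the weight is a translate of the centred Gaussian and
  \<open>smear_shift\<close> applies; holomorphy is differentiation under the integral, with a
  remainder of second order.\<close>

lemma orbit_ext_mollify_ext:
  fixes e :: "complex^'n::finite"
  assumes A: "A \<in> C1" and l: "l > 0" and e: "norm e = 1"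
  shows "orbit_ext e (mollify l A) (mollify_ext l e A)"
  unfolding orbit_ext_def
proof
  note int = gauss_weight_integrable[OF l e]
  show "\<forall>s::real. mollify_ext l e A (of_real s) = alpha (of_real s *s e) (mollify l A)"
  proof
    fix s :: real
    have "gauss_weight l e 0 (z - of_real s *s e) = gauss_weight l e (of_real s) z" for z
    proof -
      have "of_real s *s e = s *\<^sub>R e" by (simp add: vec_eq_iff scaleR_conv_of_real[where 'a=complex])
      then have "(norm (z - of_real s *s e))\<^sup>2 = (norm z)\<^sup>2 - 2 * s * (z \<bullet> e) + s\<^sup>2 * (norm e)\<^sup>2"
        by (simp add: power2_norm_eq_inner inner_diff inner_commute power2_eq_square[of s] algebra_simps)
      then have n: "(norm (z - of_real s *s e))\<^sup>2 = (norm z)\<^sup>2 - 2 * s * (z \<bullet> e) + s\<^sup>2" using e by simp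
      show ?thesis unfolding gauss_weight_def n by (simp add: algebra_simps)
    qed
    then show "mollify_ext l e A (of_real s) = alpha (of_real s *s e) (mollify l A)"
      unfolding mollify_ext_0[of l e, symmetric] unfolding mollify_ext_def by (subst smear_shift[OF A int]) simp
  qed
  show "hol_family (mollify_ext l e A)"
    unfolding hol_family_def
  proof
    fix t :: complex
    define b where "b z = 2 * of_real l * (of_real (z \<bullet> e) - t)" for z :: "complex^'n"
    \<comment> \<open>The derivative of the weight with respect to \<open>t\<close>.\<close>
    define w where "w z = gauss_weight l e t z * b z" for z
    define N where "N = (l / pi) ^ CARD('n) * exp (l * (cmod t)\<^sup>2)"
    have N: "N \<ge> 0" using l by (simp add: N_def)
    \<comment> \<open>A common majorant of the weight times the exponential from
      \<open>exp_step_bounds\<close>: the first contributes the rate \<open>2 * l * cmod t\<close>,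
      the second \<open>4 * l\<close>.\<close>
    define G where "G z = N * (exp (4 * l * cmod t + 2 * l)) * exp (- l * (norm z)\<^sup>2 + (2 * l * cmod t + 4 * l) * norm z)" for z :: "complex^'n"
    have Gi: "integrable lborel G" unfolding G_def by (rule gauss_step_integrable[OF l])
    have gG: "cmod (gauss_weight l e t z) * exp (2 * (cmod (b z) + l)) \<le> G z" for z
    proof -
      have "cmod (gauss_weight l e t z) * exp (2 * (cmod (b z) + l))
        \<le> (N * exp (- l * (norm z)\<^sup>2 + 2 * l * cmod t * norm z)) * (exp (4 * l * cmod t + 2 * l) * exp (4 * l * norm z))"
        unfolding b_def N_def by (intro mult_mono gauss_weight_bound gauss_weight_factor_bound l e) (use l in auto)
      also have "\<dots> = G z" unfolding G_def distrib_right add.assoc[symmetric] exp_add by (simp add: mult_ac)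
      finally show ?thesis .
    qed
    have wi: "integrable lborel w"
    proof (rule Bochner_Integration.integrable_bound[OF Gi])
      have "b \<in> borel_measurable borel" unfolding b_def
        by (intro borel_measurable_continuous_onI continuous_intros)
      then show "w \<in> borel_measurable lborel" unfolding w_def by simp
      have "cmod (b z) \<le> exp (2 * (cmod (b z) + l))" for z
        by (rule le_exp_double[OF norm_ge_zero l])
      then have "cmod (w z) \<le> G z" for z
        unfolding w_def norm_mult by (intro order_trans[OF _ gG] mult_left_mono) auto
      moreover have "G z \<le> norm (G z)" for z by simp
      ultimately show "AE z in lborel. norm (w z) \<le> norm (G z)" by (intro AE_I2) (meson order_trans)
    qed
    define K where "K = (\<integral>z. (2 + l) * G z \<partial>lborel) * norm A"
    have "(mollify_ext l e A has_derivative (\<lambda>h. h \<odot> smear w A)) (at t)"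
    proof (rule has_derivativeI_sandwich[where e=1 and H="\<lambda>y. K * cmod (y - t)"])
      show "bounded_linear (\<lambda>h. h \<odot> smear w A)" by (rule bounded_linear_scale_fop)
      have "((\<lambda>y. K * cmod (y - t)) \<longlongrightarrow> K * cmod (t - t)) (at t)" by (intro tendsto_intros)
      then show "((\<lambda>y. K * cmod (y - t)) \<longlongrightarrow> 0) (at t)" by simp
      fix y assume y: "y \<noteq> t" "dist y t < 1"
      define h where "h = y - t"
      have h: "cmod h \<le> 1" "h \<noteq> 0" "y = t + h" using y by (auto simp: h_def dist_norm)
      have hw: "integrable lborel (\<lambda>z. h * w z)" using wi by simp
      have "mollify_ext l e A y - mollify_ext l e A t - h \<odot> smear w A = smear (\<lambda>z. (gauss_weight l e y z - gauss_weight l e t z) - h * w z) A"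
        unfolding mollify_ext_def
        by (simp only: smear_diff[OF A Bochner_Integration.integrable_diff[OF int int] hw] smear_diff[OF A int int] smear_scale[OF A wi])
      also have "norm \<dots> \<le> (\<integral>z. (cmod h)\<^sup>2 * ((2 + l) * G z) \<partial>lborel) * norm A"
      proof (rule norm_smear[OF A])
        show "integrable lborel (\<lambda>z. (gauss_weight l e y z - gauss_weight l e t z) - h * w z)"
          by (intro Bochner_Integration.integrable_diff int hw)
        show "integrable lborel (\<lambda>z. (cmod h)\<^sup>2 * ((2 + l) * G z))" using Gi by simp
        fix z
        have "(gauss_weight l e y z - gauss_weight l e t z) - h * w z = gauss_weight l e t z * (exp (h * b z - of_real l * h\<^sup>2) - 1 - h * b z)"
          unfolding h(3) gauss_weight_step w_def b_def by (simp add: algebra_simps)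
        then have "cmod ((gauss_weight l e y z - gauss_weight l e t z) - h * w z) \<le> cmod (gauss_weight l e t z) * ((cmod h)\<^sup>2 * ((2 + l) * exp (2 * (cmod (b z) + l))))"
          using exp_step_bounds(2)[OF h(1) l, of "b z"] by (simp add: norm_mult mult_left_mono)
        also have "\<dots> = (cmod h)\<^sup>2 * ((2 + l) * (cmod (gauss_weight l e t z) * exp (2 * (cmod (b z) + l))))" by simp
        also have "\<dots> \<le> (cmod h)\<^sup>2 * ((2 + l) * G z)" using l gG by (intro mult_left_mono) auto
        finally show "cmod ((gauss_weight l e y z - gauss_weight l e t z) - h * w z) \<le> (cmod h)\<^sup>2 * ((2 + l) * G z)" .
      qed
      also have "\<dots> = (cmod h)\<^sup>2 * K" unfolding K_def by simp
      finally show "norm (mollify_ext l e A y - mollify_ext l e A t - (y - t) \<odot> smear w A) / norm (y - t) \<le> K * cmod (y - t)"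
        using h(2) unfolding h_def[symmetric] by (simp add: pos_divide_le_eq power2_eq_square mult_ac)
    qed simp
    then show "\<exists>T'. (mollify_ext l e A has_derivative (\<lambda>h. h \<odot> T')) (at t)" by blast
  qed
qed

text \<open>A first-order estimate with one constant for all directions: it allows one complex time
  to be fixed before the direction is known.\<close>

lemma mollify_ext_near:
  assumes A: "A \<in> C1" and l: "l > 0"
  obtains K where "K \<ge> 0" "\<And>e t. norm e = 1 \<Longrightarrow> cmod t \<le> 1 \<Longrightarrow> norm (mollify_ext l e A t - mollify l A) \<le> cmod t * K"
proof -
  define G where "G z = (l / pi) ^ CARD('a) * exp (2 * l) * exp (- l * (norm z)\<^sup>2 + (4 * l) * norm z)" for z :: "complex^'a"
  have Gi: "integrable lborel G" unfolding G_def by (rule gauss_step_integrable[OF l])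
  define K where "K = (\<integral>z. G z \<partial>lborel) * norm A"
  show ?thesis
  proof (rule that[of K])
    show "K \<ge> 0" unfolding K_def G_def using l by (intro mult_nonneg_nonneg Bochner_Integration.integral_nonneg) auto
    fix e :: "complex^'a" and t assume e: "norm e = 1" and t: "cmod t \<le> 1"
    note int = gauss_weight_integrable[OF l e]
    have "mollify_ext l e A t - mollify l A = smear (\<lambda>z. gauss_weight l e t z - gauss_weight l e 0 z) A"
      unfolding mollify_ext_0[of l e, symmetric] unfolding mollify_ext_def by (simp only: smear_diff[OF A int int])
    also have "norm \<dots> \<le> (\<integral>z. cmod t * G z \<partial>lborel) * norm A"
    proof (rule norm_smear[OF A])
      show "integrable lborel (\<lambda>z. gauss_weight l e t z - gauss_weight l e 0 z)"
        by (intro Bochner_Integration.integrable_diff int)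
      show "integrable lborel (\<lambda>z. cmod t * G z)" using Gi by simp
      fix z
      let ?b = "2 * of_real l * (of_real (z \<bullet> e) - 0) :: complex"
      have "gauss_weight l e t z - gauss_weight l e 0 z = gauss_weight l e 0 z * (exp (t * ?b - of_real l * t\<^sup>2) - 1)"
        using gauss_weight_step[of l e 0 t z] by (simp add: algebra_simps)
      then have "cmod (gauss_weight l e t z - gauss_weight l e 0 z) \<le> cmod (gauss_weight l e 0 z) * (cmod t * exp (2 * (cmod ?b + l)))"
        using exp_step_bounds(1)[OF t l, of ?b] by (simp add: norm_mult mult_left_mono)
      also have "\<dots> = cmod t * (cmod (gauss_weight l e 0 z) * exp (2 * (cmod ?b + l)))" by simp
      also have "\<dots> \<le> cmod t * (((l / pi) ^ CARD('a) * exp (- l * (norm z)\<^sup>2)) * (exp (2 * l) * exp (4 * l * norm z)))"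
        using gauss_weight_bound[OF l e, of 0 z] gauss_weight_factor_bound[OF l e, of z 0] l by (intro mult_left_mono mult_mono) auto
      also have "\<dots> = cmod t * G z" unfolding G_def exp_add by (simp add: mult_ac)
      finally show "cmod (gauss_weight l e t z - gauss_weight l e 0 z) \<le> cmod t * G z" .
    qed
    also have "\<dots> = cmod t * K" unfolding K_def by simp
    finally show "norm (mollify_ext l e A t - mollify l A) \<le> cmod t * K" .
  qed
qed

lemma gauss_weight0_integrable: "l > 0 \<Longrightarrow> integrable lborel (gauss_weight l (0::complex^'n::finite) 0)"
proof -
  assume l: "l > 0"
  have "gauss_weight l 0 0 = (\<lambda>z::complex^'n. of_real ((l / pi) ^ CARD('n) * exp (- l * (norm z)\<^sup>2)))"
    by (rule ext) (rule gauss_weight_zero)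
  moreover have "integrable lborel (\<lambda>z::complex^'n. complex_of_real ((l / pi) ^ CARD('n) * exp (- l * (norm z)\<^sup>2)))"
    by (intro integrable_of_real integrable_mult_right gaussian_integrable l)
  ultimately show ?thesis by simp
qed

lemma mollify_tendsto:
  fixes A :: "'n::finite fop"
  assumes A: "A \<in> C1" and eps: "eps > 0"
  obtains l0 where "l0 > 0" "\<And>l. l \<ge> l0 \<Longrightarrow> norm (mollify l A - A) \<le> eps"
proof -
  have "eventually (\<lambda>z. norm (alpha z A - A) < eps / 2) (at 0)"
    using order_tendstoD(2)[of "\<lambda>z. norm (alpha z A - A)" 0 "at 0" "eps / 2"] A eps by (simp add: C1_def)
  then obtain r where r: "r > 0" "\<And>z. z \<noteq> 0 \<Longrightarrow> norm z < r \<Longrightarrow> norm (alpha z A - A) < eps / 2"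
    unfolding eventually_at by (auto simp: dist_norm)
  \<comment> \<open>The power of 2 is the ratio of the Gaussian integrals with parameters
    \<open>l / 2\<close> and \<open>l\<close>.\<close>
  define M where "M = 2 * norm A * 2 ^ CARD('n)"
  have M: "M \<ge> 0" by (simp add: M_def)
  \<comment> \<open>Outside the ball of radius \<open>r\<close> the trivial bound
    \<open>2 * norm A\<close> is multiplied by a factor at least 1. That factor uses up half of the
    Gaussian weight and leaves exp (- l r^2 / 2), which tends to 0 as \<open>l\<close>
    grows.\<close>
  have near: "norm (alpha z A - A) \<le> eps / 2 + 2 * norm A * exp (l * (norm z)\<^sup>2 / 2 - l * r\<^sup>2 / 2)" if l: "l > 0" for z l
  proof (cases "norm z < r")
    case True
    then have "norm (alpha z A - A) \<le> eps / 2" using r(2)[of z] eps by (cases "z = 0") (auto simp: alpha_props less_imp_le)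
    then show ?thesis by (simp add: add_increasing2)
  next
    case False
    then have "r\<^sup>2 \<le> (norm z)\<^sup>2" using r by (intro power_mono) auto
    from mult_left_mono[OF this, of "l/2"] l
    have "1 \<le> exp (l * (norm z)\<^sup>2 / 2 - l * r\<^sup>2 / 2)" by simp
    from mult_left_mono[OF this, of "2 * norm A"]
    have "2 * norm A \<le> 2 * norm A * exp (l * (norm z)\<^sup>2 / 2 - l * r\<^sup>2 / 2)" by simp
    moreover have "norm (alpha z A - A) \<le> 2 * norm A"
      using norm_triangle_ineq4[of "alpha z A" A] norm_alpha_le[of z A] by linarith
    ultimately show ?thesis using eps by linarith
  qed
  have bound: "norm (mollify l A - A) \<le> eps / 2 + M * exp (- l * r\<^sup>2 / 2)" if l: "l > 0" for l
  proof -
    define N where "N = (l / pi) ^ CARD('n)"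
    have N: "N > 0" using l by (simp add: N_def)
    let ?G = "\<lambda>z::complex^'n. N * (eps / 2) * exp (- l * (norm z)\<^sup>2) + N * (2 * norm A * exp (- l * r\<^sup>2 / 2)) * exp (- (l/2) * (norm z)\<^sup>2)"
    have i1: "integrable lborel (\<lambda>z::complex^'n. exp (- l * (norm z)\<^sup>2))" "integrable lborel (\<lambda>z::complex^'n. exp (- (l/2) * (norm z)\<^sup>2))"
      using gaussian_integrable[of l, where 'n='n] gaussian_integrable[of "l/2", where 'n='n] l by auto
    have "norm (mollify l A - A) \<le> (\<integral>z. ?G z \<partial>lborel)"
      unfolding mollify_def
    proof (rule norm_smear_diff[OF A gauss_weight0_integrable[OF l]])
      show "integrable lborel ?G" using i1 by (intro Bochner_Integration.integrable_add integrable_mult_right) 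
      show "(\<integral>z. gauss_weight l 0 0 z \<partial>(lborel :: (complex^'n) measure)) = 1" by (rule gauss_weight_integral[OF l])
      fix z :: "complex^'n"
      have "cmod (gauss_weight l 0 0 z) = N * exp (- l * (norm z)\<^sup>2)"
        unfolding gauss_weight_zero norm_of_real N_def using l by (simp add: abs_mult)
      then have "cmod (gauss_weight l 0 0 z) * norm (alpha z A - A)
        \<le> N * exp (- l * (norm z)\<^sup>2) * (eps / 2 + 2 * norm A * exp (l * (norm z)\<^sup>2 / 2 - l * r\<^sup>2 / 2))"
        using near[OF l, of z] N by (auto intro!: mult_left_mono)
      also have "\<dots> = N * (eps / 2) * exp (- l * (norm z)\<^sup>2)
          + N * (2 * norm A) * (exp (- l * (norm z)\<^sup>2) * exp (l * (norm z)\<^sup>2 / 2 - l * r\<^sup>2 / 2))"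
        by (simp add: algebra_simps)
      also have "exp (- l * (norm z)\<^sup>2) * exp (l * (norm z)\<^sup>2 / 2 - l * r\<^sup>2 / 2) = exp (- l * r\<^sup>2 / 2) * exp (- (l/2) * (norm z)\<^sup>2)"
        unfolding exp_add[symmetric] by (rule arg_cong[where f=exp]) (simp add: field_simps)
      finally show "cmod (gauss_weight l 0 0 z) * norm (alpha z A - A) \<le> ?G z" by (simp add: mult_ac)
    qed
    also have "\<dots> = N * (eps / 2) * (pi / l) ^ CARD('n) + N * (2 * norm A * exp (- l * r\<^sup>2 / 2)) * (pi / (l/2)) ^ CARD('n)"
      using gaussian_integral[of l, where 'n='n] gaussian_integral[of "l/2", where 'n='n] l i1
      by (subst Bochner_Integration.integral_add) (auto simp del: mult_minus_left)
    also have "\<dots> = eps / 2 + M * exp (- l * r\<^sup>2 / 2)"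
    proof -
      have n: "N * (pi / l) ^ CARD('n) = 1" "N * (pi / (l/2)) ^ CARD('n) = 2 ^ CARD('n)"
        using l by (simp_all add: N_def power_mult_distrib[symmetric] del: power_divide)
      have "N * (eps / 2) * (pi / l) ^ CARD('n) + N * (2 * norm A * exp (- l * r\<^sup>2 / 2)) * (pi / (l/2)) ^ CARD('n)
        = (eps / 2) * (N * (pi / l) ^ CARD('n)) + (2 * norm A * exp (- l * r\<^sup>2 / 2)) * (N * (pi / (l/2)) ^ CARD('n))"
        by (simp only: mult.assoc mult.left_commute)
      then show ?thesis unfolding n M_def by (simp only: mult_1_right mult.assoc mult.left_commute mult.commute)
    qed
    finally show ?thesis .
  qed
  have "((\<lambda>l. eps / 2 + M * exp (- l * r\<^sup>2 / 2)) \<longlongrightarrow> eps / 2 + M * 0) at_top"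
  proof (intro tendsto_intros)
    have "filterlim (\<lambda>l. (r\<^sup>2 / 2) * l) at_top at_top"
      using r by (intro filterlim_tendsto_pos_mult_at_top[OF tendsto_const]) (auto simp: filterlim_ident)
    then have "filterlim (\<lambda>l. - ((r\<^sup>2 / 2) * l)) at_bot at_top" by (simp add: filterlim_uminus_at_top)
    from filterlim_compose[OF exp_at_bot this] show "((\<lambda>l. exp (- l * r\<^sup>2 / 2)) \<longlongrightarrow> 0) at_top" by (simp add: mult.commute)
  qed
  from order_tendstoD(2)[OF this, of eps] eps
  have "eventually (\<lambda>l. eps / 2 + M * exp (- l * r\<^sup>2 / 2) < eps) at_top" by simp
  then obtain L where L: "\<And>l. l \<ge> L \<Longrightarrow> eps / 2 + M * exp (- l * r\<^sup>2 / 2) < eps"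
    by (auto simp: eventually_at_top_linorder)
  show ?thesis
  proof (rule that[of "max L 1"])
    fix l assume "max L 1 \<le> l"
    then show "norm (mollify l A - A) \<le> eps" using bound[of l] L[of l] by linarith
  qed simp
qed

section \<open>Off-diagonal decay from analytic orbits\<close>

definition kerv :: "complex^'n::finite \<Rightarrow> 'n fock" where
  "kerv w = exp (of_real ((norm w)\<^sup>2) / 4) *\<^sub>C coh w"

text \<open>Unlike \<open>coh w\<close>, this unnormalized kernel depends antiholomorphically on
  \<open>w\<close>, which makes it suitable for analytic continuation.\<close>

lemma Rep_kerv: "Rep_fock (kerv w) z = exp (cdot z w / 2)"
  by (simp add: kerv_def Rep_coh nrk_def flip: exp_add)

lemma cinner_kerv: "fock_cinner f (kerv w) = Rep_fock f w"
  unfolding Rep_eq_cinner kerv_def by (simp add: cinner_scale_right exp_cnj)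

lemma norm_kerv: "norm (kerv w) = exp ((norm w)\<^sup>2 / 4)"
  by (simp add: kerv_def norm_scaleC norm_exp_eq_Re)

lemma Rep_app_kerv: "Rep_fock (A \<rhd> kerv w) u = cnj (Rep_fock (adj A \<rhd> kerv u) w)"
  by (metis cinner_kerv cinner_adj cinner_cnj)

lemma Rep_app_kerv_bound: "cmod (Rep_fock (A \<rhd> kerv w) u) \<le> norm A * exp ((norm w)\<^sup>2 / 4) * exp ((norm u)\<^sup>2 / 4)"
  using norm_cinner_app[of A "kerv w" "kerv u"] by (simp add: cinner_kerv norm_kerv)

text \<open>Conjugating both argument and value preserves holomorphy. Through
  \<open>Rep_app_kerv\<close> this handles the dependence on the kernel point.\<close>

lemma holomorphic_antilinear_line:
  assumes "entire f"
  shows "(\<lambda>t. cnj (f (v + cnj t *s e))) holomorphic_on UNIV"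
  unfolding holomorphic_on_def
proof
  fix t
  obtain D where "((\<lambda>t. f (v + t *s e)) has_field_derivative D) (at (cnj t))"
    using entire_line_holomorphic[OF assms, of v e] unfolding holomorphic_on_def field_differentiable_def by auto
  then have D: "((\<lambda>t. f (v + t *s e)) has_derivative (\<lambda>h. h * D)) (at (cnj t))"
    by (simp add: has_field_derivative_def mult_commute_abs)
  have c: "(cnj has_derivative cnj) F" for F
    by (rule bounded_linear_imp_has_derivative[OF bounded_linear_cnj])
  have "((\<lambda>t. f (v + cnj t *s e)) has_derivative (\<lambda>h. cnj h * D)) (at t)"
    using has_derivative_compose[OF c[of "at t"] D] .
  from has_derivative_compose[OF this c[of "at _"]]
  have "((\<lambda>t. cnj (f (v + cnj t *s e))) has_derivative (\<lambda>h. h * cnj D)) (at t)" by simp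
  then have "((\<lambda>t. cnj (f (v + cnj t *s e))) has_field_derivative cnj D) (at t)"
    by (simp add: has_field_derivative_def mult_commute_abs)
  then show "(\<lambda>t. cnj (f (v + cnj t *s e))) field_differentiable at t within UNIV"
    by (auto simp: field_differentiable_def)
qed

text \<open>The time enters twice, through the operator and, conjugated, through the kernel vector.
  Both dependences are holomorphic, and a product-rule argument combines them.\<close>

lemma hol_family_eval:
  fixes e :: "complex^'n::finite"
  assumes T: "hol_family T"
  shows "(\<lambda>t. Rep_fock (T t \<rhd> kerv (v + cnj t *s e)) u) holomorphic_on UNIV"
  unfolding holomorphic_on_def
proof
  fix t :: complex
  define q where "q A s = Rep_fock (A \<rhd> kerv (v + cnj s *s e)) u" for A s
  have qh: "(\<lambda>s. q A s) holomorphic_on UNIV" for A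
  proof -
    have "(\<lambda>s. q A s) = (\<lambda>s. cnj (Rep_fock (adj A \<rhd> kerv u) (v + cnj s *s e)))"
      unfolding q_def by (rule ext) (rule Rep_app_kerv)
    then show ?thesis by (simp only: holomorphic_antilinear_line[OF entire_Rep])
  qed
  have qb: "cmod (q A s) \<le> norm A * (exp ((norm v + cmod s * norm e)\<^sup>2 / 4) * exp ((norm u)\<^sup>2 / 4))" for A s
  proof -
    have "norm (v + cnj s *s e) \<le> norm v + cmod s * norm e"
      using norm_triangle_ineq[of v "cnj s *s e"] by (simp add: norm_vec_smult)
    then have "(norm (v + cnj s *s e))\<^sup>2 \<le> (norm v + cmod s * norm e)\<^sup>2" by (intro power_mono) auto
    then have "norm A * (exp ((norm (v + cnj s *s e))\<^sup>2 / 4) * exp ((norm u)\<^sup>2 / 4))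
       \<le> norm A * (exp ((norm v + cmod s * norm e)\<^sup>2 / 4) * exp ((norm u)\<^sup>2 / 4))"
      by (intro mult_left_mono mult_right_mono) auto
    then show ?thesis using Rep_app_kerv_bound[of A "v + cnj s *s e" u] unfolding q_def by simp
  qed
  have qdiff: "q (A - B) s = q A s - q B s" "q (c \<odot> A) s = c * q A s" for A B s c
    by (simp_all add: q_def app_diff_left app_scale_left)
  obtain T' where T': "(T has_derivative (\<lambda>h. h \<odot> T')) (at t)" using T unfolding hol_family_def by blast
  obtain D where D: "((\<lambda>s. q (T t) s) has_field_derivative D) (at t)"
    using qh[of "T t"] unfolding holomorphic_on_def field_differentiable_def by auto
  define R where "R s = T s - T t - (s - t) \<odot> T'" for s
  have "((\<lambda>s. norm (R s) / norm (s - t)) \<longlongrightarrow> 0) (at t)"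
    using T' unfolding has_derivative_iff_norm R_def by simp
  moreover have "((\<lambda>s. exp ((norm v + cmod s * norm e)\<^sup>2 / 4) * exp ((norm u)\<^sup>2 / 4)) \<longlongrightarrow>
     exp ((norm v + cmod t * norm e)\<^sup>2 / 4) * exp ((norm u)\<^sup>2 / 4)) (at t)"
    by (intro tendsto_intros) auto
  ultimately have RB: "((\<lambda>s. norm (R s) / norm (s - t) * (exp ((norm v + cmod s * norm e)\<^sup>2 / 4) * exp ((norm u)\<^sup>2 / 4))) \<longlongrightarrow> 0) (at t)"
    using tendsto_mult by fastforce
  have Rlim: "((\<lambda>s. q (R s) s / (s - t)) \<longlongrightarrow> 0) (at t)"
  proof (rule Lim_null_comparison[OF always_eventually[OF allI] RB])
    fix s
    show "norm (q (R s) s / (s - t)) \<le> norm (R s) / norm (s - t) * (exp ((norm v + cmod s * norm e)\<^sup>2 / 4) * exp ((norm u)\<^sup>2 / 4))"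
      using divide_right_mono[OF qb[of "R s" s], of "cmod (s - t)"] by (simp add: norm_divide)
  qed
  have "((\<lambda>s. q T' s + q (R s) s / (s - t) + (q (T t) s - q (T t) t) / (s - t)) \<longlongrightarrow> q T' t + 0 + D) (at t)"
  proof (intro tendsto_add Rlim)
    show "((\<lambda>s. q T' s) \<longlongrightarrow> q T' t) (at t)"
      using holomorphic_on_imp_continuous_on[OF qh[of T']] by (simp add: continuous_on_def)
    show "((\<lambda>s. (q (T t) s - q (T t) t) / (s - t)) \<longlongrightarrow> D) (at t)"
      using D by (simp add: has_field_derivative_iff)
  qed
  moreover have "eventually (\<lambda>s. q T' s + q (R s) s / (s - t) + (q (T t) s - q (T t) t) / (s - t) = (q (T s) s - q (T t) t) / (s - t)) (at t)"
    unfolding eventually_at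
  proof (intro exI[of _ 1] conjI ballI impI)
    fix s assume "s \<noteq> t \<and> dist s t < 1"
    then show "q T' s + q (R s) s / (s - t) + (q (T t) s - q (T t) t) / (s - t) = (q (T s) s - q (T t) t) / (s - t)"
      unfolding R_def qdiff by (simp add: diff_divide_distrib)
  qed simp
  ultimately have "((\<lambda>s. (q (T s) s - q (T t) t) / (s - t)) \<longlongrightarrow> q T' t + 0 + D) (at t)"
    by (rule Lim_transform_eventually)
  then show "(\<lambda>t. Rep_fock (T t \<rhd> kerv (v + cnj t *s e)) u) field_differentiable at t within UNIV"
    unfolding field_differentiable_def has_field_derivative_iff q_def by auto
qed

lemma weyl_kerv:
  assumes e: "norm e = 1"
  shows "weyl (of_real t *s e) (kerv v) = exp (- (of_real t)\<^sup>2 / 4 - of_real t * cdot e v / 2) *\<^sub>C kerv (v + of_real t *s e)"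
proof (rule fock_eqI)
  fix z
  have "nrk (of_real t *s e) z * exp (cdot (z - of_real t *s e) v / 2)
    = exp (- (of_real t)\<^sup>2 / 4 - of_real t * cdot e v / 2) * exp (cdot z (v + of_real t *s e) / 2)"
    unfolding nrk_def exp_add[symmetric]
    by (rule arg_cong[where f=exp]) (simp add: cdot_diff_left cdot_add cdot_smult norm_vec_smult e field_simps)
  then show "Rep_fock (weyl (of_real t *s e) (kerv v)) z
    = Rep_fock (exp (- (of_real t)\<^sup>2 / 4 - of_real t * cdot e v / 2) *\<^sub>C kerv (v + of_real t *s e)) z"
    by (simp add: weyl.rep_eq Rep_kerv)
qed

text \<open>For real \<open>t\<close> both sides compute the translate of
  \<open>C \<rhd> kerv v\<close> at \<open>u\<close>, up to a common factor: either the resulting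
  function is shifted, or the translation is first moved past \<open>C\<close> to the kernel vector.
  Both sides are entire in \<open>t\<close>, hence equal. For non-real \<open>t\<close> the points
  become \<open>v + cnj t *s e\<close> and \<open>u - t *s e\<close>.\<close>

lemma orbit_ext_identity:
  assumes ext: "orbit_ext e C T" and e: "norm e = 1"
  shows "exp (- t\<^sup>2 / 4 - t * cdot e v / 2) * Rep_fock (T t \<rhd> kerv (v + cnj t *s e)) u
     = exp (t * cdot u e / 2 - t\<^sup>2 / 4) * Rep_fock (C \<rhd> kerv v) (u - t *s e)"
proof -
  define F where "F t = exp (- t\<^sup>2 / 4 - t * cdot e v / 2) * Rep_fock (T t \<rhd> kerv (v + cnj t *s e)) u
     - exp (t * cdot u e / 2 - t\<^sup>2 / 4) * Rep_fock (C \<rhd> kerv v) (u - t *s e)" for t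
  have "(\<lambda>t. Rep_fock (C \<rhd> kerv v) (u - t *s e)) holomorphic_on UNIV"
    using entire_line_holomorphic[OF entire_Rep, of "C \<rhd> kerv v" u "- e"] by (simp add: vector_smult_rneg)
  then have "F holomorphic_on UNIV"
    unfolding F_def using hol_family_eval ext unfolding orbit_ext_def by (intro holomorphic_intros) auto
  moreover have "F z = 0" if z: "z \<in> \<real>" for z
  proof -
    obtain s where s: "z = of_real s" using z unfolding Reals_def by auto
    have "weyl (of_real s *s e) (C \<rhd> kerv v) = alpha (of_real s *s e) C \<rhd> weyl (of_real s *s e) (kerv v)"
      by (simp add: app_alpha)
    also have "\<dots> = exp (- (of_real s)\<^sup>2 / 4 - of_real s * cdot e v / 2) *\<^sub>C (T (of_real s) \<rhd> kerv (v + of_real s *s e))"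
      using ext unfolding orbit_ext_def weyl_kerv[OF e] app_scale_right by simp
    finally have "Rep_fock (weyl (of_real s *s e) (C \<rhd> kerv v)) u
       = exp (- (of_real s)\<^sup>2 / 4 - of_real s * cdot e v / 2) * Rep_fock (T (of_real s) \<rhd> kerv (v + of_real s *s e)) u"
      by simp
    moreover have "nrk (of_real s *s e) u = exp (of_real s * cdot u e / 2 - (of_real s)\<^sup>2 / 4)"
      unfolding nrk_def by (rule arg_cong[where f=exp]) (simp add: cdot_smult norm_vec_smult e)
    ultimately show ?thesis unfolding F_def s by (simp add: weyl.rep_eq)
  qed
  moreover have "(0::complex) islimpt \<real>"
    unfolding islimpt_approachable
  proof (intro allI impI)
    fix r :: real assume "r > 0"
    then show "\<exists>x'\<in>\<real>. x' \<noteq> (0::complex) \<and> dist x' 0 < r"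
      by (intro bexI[of _ "of_real (r / 2)"]) auto
  qed
  ultimately have "F t = 0"
    by (intro analytic_continuation[of F UNIV \<real> 0 t]) auto
  then show ?thesis by (simp add: F_def)
qed

lemma unit_direction:
  obtains d :: "complex^'n::finite" where "norm d = 1" "cdot x d = of_real (norm x)"
proof (cases "x = 0")
  case True
  obtain d :: "complex^'n" where "norm d = 1" using vector_choose_size[of 1] by auto
  then show ?thesis using True by (intro that[of d]) auto
next
  case False
  have "cdot x (of_real (1 / norm x) *s x) = of_real (1 / norm x * (norm x)\<^sup>2)"
    by (simp add: cdot_smult cdot_self)
  then show ?thesis using False
    by (intro that[of "of_real (1 / norm x) *s x"]) (auto simp: norm_vec_smult norm_divide power2_eq_square)
qed

text \<open>Choose \<open>d\<close> as the unit direction from \<open>v\<close> to \<open>p\<close>,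
  the translation direction \<open>\<i> *s d\<close> and the time \<open>\<i> * \<delta>\<close>.
  The kernel of \<open>C\<close> at \<open>v\<close>, \<open>p\<close> is then expressed by that of
  the continuation at \<open>v + \<delta> d\<close> and \<open>p - \<delta> d\<close>, where only
  the operator norm is used; the change in the Gaussian factors produces the decay.\<close>

lemma orbit_ext_decay:
  fixes C :: "'n::finite fop"
  assumes ext: "\<And>e. norm e = 1 \<Longrightarrow> orbit_ext e C (T e) \<and> norm (T e (\<i> * of_real \<delta>)) \<le> M" and M: "M \<ge> 0"
  shows "cmod (fock_cinner (C \<rhd> coh v) (coh p)) \<le> M * exp (\<delta>\<^sup>2) * exp (- \<delta> * norm (p - v))"
proof -
  obtain d where d: "norm d = 1" "cdot (p - v) d = of_real (norm (p - v))" by (rule unit_direction)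
  define e where "e = \<i> *s d"
  have e: "norm e = 1" using d by (simp add: e_def norm_vec_smult)
  define t where "t = \<i> * of_real \<delta>"
  have te: "t *s e = - (of_real \<delta> *s d)" "cnj t *s e = of_real \<delta> *s d"
  proof -
    have c: "t * \<i> = - of_real \<delta>" "cnj t * \<i> = of_real \<delta>" by (simp_all add: t_def complex_eq_iff)
    show "t *s e = - (of_real \<delta> *s d)" "cnj t *s e = of_real \<delta> *s d"
      unfolding e_def vector_smult_assoc c by (simp_all add: vector_smult_lneg)
  qed
  define u where "u = p + t *s e"
  have up: "u = p - of_real \<delta> *s d" unfolding u_def te by simp
  define r where "r = Rep_fock (C \<rhd> kerv v) p"
  have t2: "t\<^sup>2 = of_real (- \<delta>\<^sup>2)" by (simp add: t_def power_mult_distrib)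
  have re1: "Re (- t\<^sup>2 / 4 - t * cdot e v / 2) = \<delta>\<^sup>2 / 4 + \<delta> * Re (cdot d v) / 2"
    unfolding t2 by (simp add: t_def e_def cdot_smult)
  have re2: "Re (t * cdot u e / 2 - t\<^sup>2 / 4) = \<delta> * Re (cdot p d) / 2 - \<delta>\<^sup>2 / 2 + \<delta>\<^sup>2 / 4"
    unfolding t2 up by (simp add: t_def e_def cdot_smult cdot_diff_left cdot_self d(1) power2_eq_square field_simps)
  have nv: "(norm (v + cnj t *s e))\<^sup>2 = (norm v)\<^sup>2 + \<delta>\<^sup>2 + 2 * \<delta> * Re (cdot d v)"
  proof -
    have "Re (cdot v d) = Re (cdot d v)" using cnj_cdot[of v d] by (metis cnj.simps(1))
    then show ?thesis unfolding te norm_add_cdot by (simp add: norm_vec_smult d(1) cdot_smult)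
  qed
  have nu: "(norm u)\<^sup>2 = (norm p)\<^sup>2 + \<delta>\<^sup>2 - 2 * \<delta> * Re (cdot p d)"
    using norm_add_cdot[of p "- (of_real \<delta> *s d)"] unfolding up by (simp add: norm_vec_smult d(1) cdot_smult)
  have "exp (\<delta> * Re (cdot p d) / 2 - \<delta>\<^sup>2 / 2 + \<delta>\<^sup>2 / 4) * cmod r
      = cmod (exp (- t\<^sup>2 / 4 - t * cdot e v / 2) * Rep_fock (T e t \<rhd> kerv (v + cnj t *s e)) u)"
  proof -
    have "u - t *s e = p" by (simp add: u_def)
    then have "cmod (exp (- t\<^sup>2 / 4 - t * cdot e v / 2) * Rep_fock (T e t \<rhd> kerv (v + cnj t *s e)) u)
       = cmod (exp (t * cdot u e / 2 - t\<^sup>2 / 4) * r)"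
      using orbit_ext_identity[OF conjunct1[OF ext[OF e]] e, of t v u] unfolding r_def by (simp only:)
    then show ?thesis unfolding norm_mult[of _ r] norm_exp_eq_Re re2 ..
  qed
  also have "\<dots> \<le> exp (\<delta>\<^sup>2 / 4 + \<delta> * Re (cdot d v) / 2) * (M * exp ((norm (v + cnj t *s e))\<^sup>2 / 4) * exp ((norm u)\<^sup>2 / 4))"
    unfolding norm_mult norm_exp_eq_Re re1
    using conjunct2[OF ext[OF e]] unfolding t_def[symmetric]
    by (intro mult_left_mono order_trans[OF Rep_app_kerv_bound] mult_right_mono) auto
  finally have main: "exp (\<delta> * Re (cdot p d) / 2 - \<delta>\<^sup>2 / 2 + \<delta>\<^sup>2 / 4) * cmod r
     \<le> M * exp (\<delta>\<^sup>2 / 4 + \<delta> * Re (cdot d v) / 2 + ((norm v)\<^sup>2 + \<delta>\<^sup>2 + 2 * \<delta> * Re (cdot d v)) / 4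
         + ((norm p)\<^sup>2 + \<delta>\<^sup>2 - 2 * \<delta> * Re (cdot p d)) / 4)"
    unfolding nv nu exp_add by (simp add: mult_ac)
  define Z where "Z = \<delta>\<^sup>2 / 4 + \<delta> * Re (cdot d v) / 2 + ((norm v)\<^sup>2 + \<delta>\<^sup>2 + 2 * \<delta> * Re (cdot d v)) / 4
         + ((norm p)\<^sup>2 + \<delta>\<^sup>2 - 2 * \<delta> * Re (cdot p d)) / 4"
  define X where "X = \<delta> * Re (cdot p d) / 2 - \<delta>\<^sup>2 / 2 + \<delta>\<^sup>2 / 4"
  have dv: "Re (cdot p d) - Re (cdot d v) = norm (p - v)"
  proof -
    have "Re (cdot v d) = Re (cdot d v)" using cnj_cdot[of v d] by (metis cnj.simps(1))
    then show ?thesis using d(2) by (metis Re_complex_of_real cdot_diff_left minus_complex.sel(1))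
  qed
  have ip: "fock_cinner (C \<rhd> coh v) (coh p) = exp (- of_real ((norm v)\<^sup>2) / 4) * exp (- of_real ((norm p)\<^sup>2) / 4) * r"
  proof -
    have "coh v = exp (- of_real ((norm v)\<^sup>2) / 4) *\<^sub>C kerv v"
      by (simp add: kerv_def flip: exp_add)
    then show ?thesis unfolding r_def by (simp add: app_scale_right cinner_scale_left cinner_coh[of _ p])
  qed
  have "cmod r = exp (- X) * (exp X * cmod r)" by (simp add: exp_minus)
  also have "\<dots> \<le> exp (- X) * (M * exp Z)"
    using main unfolding X_def Z_def by (intro mult_left_mono) auto
  finally have "cmod r \<le> exp (- X) * (M * exp Z)" .
  then have "exp (- (norm v)\<^sup>2 / 4) * exp (- (norm p)\<^sup>2 / 4) * cmod r
     \<le> exp (- (norm v)\<^sup>2 / 4) * exp (- (norm p)\<^sup>2 / 4) * (exp (- X) * (M * exp Z))"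
    by (intro mult_left_mono) auto
  also have "\<dots> = M * exp (- (norm v)\<^sup>2 / 4 + - (norm p)\<^sup>2 / 4 + (- X) + Z)"
    unfolding exp_add by (simp only: mult_ac)
  \<comment> \<open>The squares of the norms cancel against the normalization of the coherent
    states; by the choice of \<open>d\<close>, the linear terms combine to
    \<open>norm (p - v)\<close>.\<close>
  also have "- (norm v)\<^sup>2 / 4 + - (norm p)\<^sup>2 / 4 + (- X) + Z = \<delta>\<^sup>2 + - \<delta> * norm (p - v)"
    unfolding X_def Z_def dv[symmetric] by (simp add: field_simps)
  finally show ?thesis
    unfolding ip norm_mult norm_exp_eq_Re exp_add by (simp add: mult.assoc)
qed

section \<open>The twisted trace\<close>

lemma cinner_Complex: "fock_cinner f g = Complex (f \<bullet> g) (((- \<i>) *\<^sub>C f) \<bullet> g)"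
  by (simp add: complex_eq_iff inner_fock_def cinner_scale_left cinner_minus_left)

lemma bounded_linear_scaleC: "bounded_linear ((*\<^sub>C) c :: 'n::finite fock \<Rightarrow> _)"
  by (rule bounded_linear_intro[where K="cmod c"])
     (auto simp: fock.scale_right_distrib scaleC_scaleR_commute norm_scaleC)

lemma continuous_on_cinner [continuous_intros]:
  assumes "continuous_on S f" "continuous_on S g"
  shows "continuous_on S (\<lambda>x. fock_cinner (f x) (g x))"
  unfolding cinner_Complex Complex_eq
  by (intro continuous_intros assms bounded_linear.continuous_on[OF bounded_linear_scaleC])

lemma bounded_linear_app: "bounded_linear (app A)"
  by (rule bounded_linear_intro[where K="norm A"])
     (auto simp: app_add_right app_scaleR_right norm_app mult.commute[of _ "norm A"])

text \<open>For unit vectors the squared distance is 2 - 2 Re of the overlap, so continuity of the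
  explicit overlap suffices.\<close>

lemma continuous_coh: "continuous_on UNIV coh"
  unfolding continuous_on_def
proof
  fix w :: "complex^'a"
  have c: "((\<lambda>v. Re (fock_cinner (coh v) (coh w))) \<longlongrightarrow> Re (fock_cinner (coh w) (coh w))) (at w)"
  proof -
    have "continuous_on UNIV (\<lambda>v. Re (fock_cinner (coh v) (coh w)))"
      unfolding cinner_coh Rep_coh nrk_def cdot_def by (intro continuous_intros) auto
    then show ?thesis by (simp add: continuous_on_def)
  qed
  have "((\<lambda>v. 2 - 2 * Re (fock_cinner (coh v) (coh w))) \<longlongrightarrow> 2 - 2 * Re (fock_cinner (coh w) (coh w))) (at w)"
    by (intro tendsto_intros c)
  moreover have "2 - 2 * Re (fock_cinner (coh v) (coh w)) = (norm (coh v - coh w))\<^sup>2" for v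
    by (simp add: norm_diff_cinner)
  ultimately have "((\<lambda>v. (norm (coh v - coh w))\<^sup>2) \<longlongrightarrow> 0) (at w)" by (simp add: cinner_self)
  then have "((\<lambda>v. sqrt ((norm (coh v - coh w))\<^sup>2)) \<longlongrightarrow> sqrt 0) (at w)" by (rule tendsto_real_sqrt)
  then show "(coh \<longlongrightarrow> coh w) (at w within UNIV)"
    by (simp add: Lim_null[of coh] tendsto_norm_zero_iff)
qed

lemma continuous_on_coh [continuous_intros]: "continuous_on S f \<Longrightarrow> continuous_on S (\<lambda>x. coh (f x))"
  by (rule continuous_on_compose2[OF continuous_coh]) auto

lemma continuous_on_app [continuous_intros]: "continuous_on S f \<Longrightarrow> continuous_on S (\<lambda>x. A \<rhd> f x)"
  by (rule bounded_linear.continuous_on[OF bounded_linear_app])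

definition decay :: "real \<Rightarrow> real \<Rightarrow> 'n::finite fop \<Rightarrow> bool" where
  "decay M d C \<longleftrightarrow> (\<forall>v p. cmod (fock_cinner (C \<rhd> coh v) (coh p)) \<le> M * exp (- d * norm (p - v)))"

text \<open>A regularization of \<open>(2 pi)^n Tr (C U)\<close>, with \<open>U\<close> the parity operator, that is
  defined on operators with off-diagonal decay.\<close>

definition ptrace :: "'n::finite fop \<Rightarrow> complex" where
  "ptrace C = (\<integral>z. fock_cinner (C \<rhd> coh (- z)) (coh z) \<partial>lborel)"

lemma ptrace_measurable: "(\<lambda>z. fock_cinner (C \<rhd> coh (- z)) (coh z)) \<in> borel_measurable borel"
  by (intro borel_measurable_continuous_onI continuous_intros)

lemma decay_diag:
  assumes "decay M d C"
  shows "cmod (fock_cinner (C \<rhd> coh (- z)) (coh z)) \<le> M * exp (- (2 * d) * norm z)"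
proof -
  have "norm (z - (- z)) = 2 * norm z" by (simp flip: scaleR_2)
  then show ?thesis using assms[unfolded decay_def, rule_format, of "- z" z] by (simp add: mult_ac)
qed

lemma ptrace_integrable:
  fixes C :: "'n::finite fop"
  assumes C: "decay M d C" and d: "d > 0"
  shows "integrable lborel (\<lambda>z. fock_cinner (C \<rhd> coh (- z)) (coh z))"
proof (rule Bochner_Integration.integrable_bound)
  show "integrable lborel (\<lambda>z::complex^'n. M * exp (- (2 * d) * norm z))"
    using exp_norm_integrable[of "2 * d", where 'n='n] d by simp
  show "AE z in lborel. norm (fock_cinner (C \<rhd> coh (- z)) (coh z)) \<le> norm (M * exp (- (2 * d) * norm z))"
    by (intro AE_I2 order_trans[OF decay_diag[OF C]]) simp
qed (use ptrace_measurable in simp)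

lemma ptrace_diff: "decay M d A \<Longrightarrow> decay M' d' B \<Longrightarrow> d > 0 \<Longrightarrow> d' > 0 \<Longrightarrow> ptrace (A - B) = ptrace A - ptrace B"
  unfolding ptrace_def by (simp add: app_diff_left cinner_diff_left ptrace_integrable)

lemma ptrace_one: "ptrace (1 :: 'n::finite fop) = of_real (pi ^ CARD('n))"
proof -
  have "ptrace (1 :: 'n fop) = of_real (\<integral>z. exp (- 1 * (norm (z :: complex^'n))\<^sup>2) \<partial>lborel)"
    unfolding ptrace_def by (subst integral_complex_of_real[symmetric]) (simp add: cinner_coh_coh)
  then show ?thesis unfolding gaussian_integral[OF zero_less_one] by simp
qed

lemma kernel_mult:
  fixes A B :: "'n::finite fop"
  shows "(\<integral>w. fock_cinner (B \<rhd> coh v) (coh w) * fock_cinner (A \<rhd> coh w) (coh p) \<partial>lborel)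
     = (2 * pi) ^ CARD('n) * fock_cinner ((A * B) \<rhd> coh v) (coh p)"
  using cinner_resolution(2)[of "B \<rhd> coh v" "adj A \<rhd> coh p"] by (simp add: cinner_adj app_mult)

lemma ptrace_twisted:
  fixes A B :: "'n::finite fop"
  assumes A: "decay M d A" and B: "decay M' d B" and d: "d > 0" and odd: "pop * B * pop = - B"
  shows "ptrace (A * B) = - ptrace (B * A)"
proof -
  let ?c = "complex_of_real ((2 * pi) ^ CARD('n))"
  have c: "?c \<noteq> 0" by simp
  \<comment> \<open>The common integrand of both traces. Integration over \<open>z\<close> gives the
    kernel of \<open>B * A\<close>. For \<open>A * B\<close>, oddness of \<open>B\<close> and the
    substitution of \<open>- w\<close> for \<open>w\<close> give minus the integral over
    \<open>w\<close>.\<close>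
  define H where "H z w = fock_cinner (A \<rhd> coh (- w)) (coh z) * fock_cinner (B \<rhd> coh z) (coh w)" for z w
  have M: "M \<ge> 0" "M' \<ge> 0"
  proof -
    have "cmod (fock_cinner (A \<rhd> coh 0) (coh 0)) \<le> M" "cmod (fock_cinner (B \<rhd> coh 0) (coh 0)) \<le> M'"
      using A[unfolded decay_def, rule_format, of 0 0] B[unfolded decay_def, rule_format, of 0 0] by auto
    then show "M \<ge> 0" "M' \<ge> 0" by (meson norm_ge_zero order_trans)+
  qed
  have Hb: "cmod (H z w) \<le> M * M' * (exp (- d * norm z) * exp (- d * norm w))" for z w
  proof -
    have "2 * norm z = norm ((z + w) + (z - w))" "2 * norm w = norm ((z + w) - (z - w))"
      by (simp_all flip: scaleR_2 add: add.commute)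
    then have "norm z + norm w \<le> norm (z + w) + norm (z - w)"
      using norm_triangle_ineq[of "z + w" "z - w"] norm_triangle_ineq4[of "z + w" "z - w"] by linarith
    then have n: "d * (norm z + norm w) \<le> d * (norm (z + w) + norm (z - w))" using d by (intro mult_left_mono) auto
    have "cmod (H z w) \<le> (M * exp (- d * norm (z + w))) * (M' * exp (- d * norm (w - z)))"
      unfolding H_def norm_mult using A[unfolded decay_def, rule_format, of "- w" z] B[unfolded decay_def, rule_format, of z w] M
      by (intro mult_mono) auto
    also have "\<dots> = M * M' * exp (- (d * (norm (z + w) + norm (z - w))))"
      by (simp add: norm_minus_commute[of w z] distrib_left exp_add exp_minus exp_diff field_simps)
    also have "\<dots> \<le> M * M' * exp (- (d * (norm z + norm w)))"
      using n M by (intro mult_left_mono) auto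
    also have "\<dots> = M * M' * (exp (- d * norm z) * exp (- d * norm w))"
      by (simp add: distrib_left flip: exp_add)
    finally show ?thesis .
  qed
  have "continuous_on UNIV (\<lambda>x. H (fst x) (snd x))"
    unfolding H_def by (intro continuous_intros)
  then have "(\<lambda>x. H (fst x) (snd x)) \<in> borel_measurable (borel \<Otimes>\<^sub>M borel)"
    unfolding borel_prod by (rule borel_measurable_continuous_onI)
  then have Hm: "(\<lambda>(z, w). H z w) \<in> borel_measurable (lborel \<Otimes>\<^sub>M lborel)"
    unfolding case_prod_beta by simp
  have ei: "integrable lborel (\<lambda>z::complex^'n. exp (- d * norm z))" by (rule exp_norm_integrable[OF d])
  have Ei: "integrable (lborel \<Otimes>\<^sub>M lborel) (\<lambda>(z::complex^'n, w::complex^'n). M * M' * (exp (- d * norm z) * exp (- d * norm w)))"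
  proof (rule lborel_pair.Fubini_integrable)
    show "(\<lambda>(z::complex^'n, w::complex^'n). M * M' * (exp (- d * norm z) * exp (- d * norm w))) \<in> borel_measurable (lborel \<Otimes>\<^sub>M lborel)"
      by measurable
    have "(\<integral>(w::complex^'n). norm (case (z::complex^'n, w) of (z, w) \<Rightarrow> M * M' * (exp (- d * norm z) * exp (- d * norm w))) \<partial>lborel)
        = M * M' * exp (- d * norm z) * (\<integral>(w::complex^'n). exp (- d * norm w) \<partial>lborel)" for z
      using M by (simp add: abs_mult)
    then show "integrable lborel (\<lambda>z::complex^'n. \<integral>(w::complex^'n). norm (case (z, w) of (z, w) \<Rightarrow> M * M' * (exp (- d * norm z) * exp (- d * norm w))) \<partial>lborel)"
      using ei by (simp only:) (intro integrable_mult_left integrable_mult_right)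
    show "AE (z::complex^'n) in lborel. integrable lborel (\<lambda>w::complex^'n. case (z, w) of (z, w) \<Rightarrow> M * M' * (exp (- d * norm z) * exp (- d * norm w)))"
      using ei by (intro AE_I2, simp only: prod.case) (intro integrable_mult_right)
  qed
  have Hi: "integrable (lborel \<Otimes>\<^sub>M lborel) (\<lambda>(z, w). H z w)"
  proof (rule Bochner_Integration.integrable_bound[OF Ei Hm])
    show "AE x in lborel \<Otimes>\<^sub>M lborel. norm (case x of (z, w) \<Rightarrow> H z w)
      \<le> norm (case x of (z::complex^'n, w::complex^'n) \<Rightarrow> M * M' * (exp (- d * norm z) * exp (- d * norm w)))"
      using Hb M by (intro AE_I2) (auto simp: abs_mult split: prod.splits)
  qed
  have m1: "(- 1) *s z = - z" for z :: "complex^'n" by (simp add: vec_eq_iff)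
  have "?c * ptrace (A * B) = (\<integral>z. ?c * fock_cinner ((A * B) \<rhd> coh (- z)) (coh z) \<partial>lborel)"
    unfolding ptrace_def by (rule integral_mult_right_zero[symmetric])
  also have "\<dots> = (\<integral>z. \<integral>w. fock_cinner (B \<rhd> coh (- z)) (coh w) * fock_cinner (A \<rhd> coh w) (coh z) \<partial>lborel \<partial>lborel)"
    by (simp only: kernel_mult)
  also have "\<dots> = (\<integral>z. - (\<integral>w. H z w \<partial>lborel) \<partial>lborel)"
  proof (rule Bochner_Integration.integral_cong[OF refl])
    fix z
    have flip: "fock_cinner (B \<rhd> coh (- z)) (coh w) = - fock_cinner (B \<rhd> coh z) (coh (- w))" for w
    proof -
      have "fock_cinner (B \<rhd> coh (- z)) (coh w) = fock_cinner ((pop * B * pop) \<rhd> coh z) (coh (- w))"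
        by (simp add: app_mult cinner_parity parity_coh)
      then show ?thesis unfolding odd by (simp add: app_minus_left cinner_minus_left)
    qed
    have [measurable]: "(\<lambda>w. H z w) \<in> borel_measurable borel"
      unfolding H_def by (intro borel_measurable_continuous_onI continuous_intros)
    have "(\<integral>w. fock_cinner (B \<rhd> coh (- z)) (coh w) * fock_cinner (A \<rhd> coh w) (coh z) \<partial>lborel)
      = (\<integral>w. - H z (- w) \<partial>lborel)"
      unfolding H_def flip by (simp add: mult.commute)
    also have "\<dots> = - (\<integral>w. H z w \<partial>lborel)"
      using integral_lborel_rotate(2)[of "H z" "-1"] unfolding m1 by simp
    finally show "(\<integral>w. fock_cinner (B \<rhd> coh (- z)) (coh w) * fock_cinner (A \<rhd> coh w) (coh z) \<partial>lborel) = - (\<integral>w. H z w \<partial>lborel)" .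
  qed
  also have "\<dots> = - (\<integral>w. \<integral>z. H z w \<partial>lborel \<partial>lborel)"
    using lborel_pair.Fubini_integral[OF Hi] by simp
  also have "\<dots> = - (\<integral>w. ?c * fock_cinner ((B * A) \<rhd> coh (- w)) (coh w) \<partial>lborel)"
    unfolding H_def kernel_mult ..
  also have "\<dots> = ?c * (- ptrace (B * A))" unfolding ptrace_def integral_mult_right_zero by simp
  finally show ?thesis using c by (simp only: mult_cancel_left) blast
qed

text \<open>Parity moves from the coherent state to \<open>e\<close>, after which the resolution of
  the identity evaluates each term.\<close>

lemma ptrace_finite_rank:
  fixes P :: "'n::finite fop"
  assumes P: "\<And>f. P \<rhd> f = (\<Sum>e\<in>E. fock_cinner f e *\<^sub>C e)"
  shows "ptrace P = (2 * pi) ^ CARD('n) * (\<Sum>e\<in>E. fock_cinner e (parity e))"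
proof -
  have *: "fock_cinner (P \<rhd> coh (- z)) (coh z) = (\<Sum>e\<in>E. fock_cinner e (coh z) * fock_cinner (coh z) (parity e))" for z
    unfolding P cinner_sum_left cinner_scale_left
    by (intro sum.cong refl) (simp add: cinner_parity[symmetric] parity_coh)
  show ?thesis
    unfolding ptrace_def * by (simp add: Bochner_Integration.integral_sum cinner_resolution sum_distrib_left)
qed

text \<open>Dominated convergence. Norm convergence alone gives only pointwise convergence of the
  integrands; the common decay constants supply the majorant.\<close>

lemma ptrace_tendsto:
  fixes Y :: "nat \<Rightarrow> 'n::finite fop"
  assumes Y: "\<And>j. decay M d (Y j)" and d: "d > 0" and lim: "Y \<longlonglongrightarrow> P"
  shows "(\<lambda>j. ptrace (Y j)) \<longlonglongrightarrow> ptrace P"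
  unfolding ptrace_def
proof (rule integral_dominated_convergence)
  show "integrable lborel (\<lambda>z::complex^'n. M * exp (- (2 * d) * norm z))"
    using exp_norm_integrable[of "2 * d", where 'n='n] d by simp
  show "AE z in lborel. norm (fock_cinner (Y j \<rhd> coh (- z)) (coh z)) \<le> M * exp (- (2 * d) * norm z)" for j
    by (intro AE_I2 decay_diag Y)
  show "AE z in lborel. (\<lambda>j. fock_cinner (Y j \<rhd> coh (- z)) (coh z)) \<longlonglongrightarrow> fock_cinner (P \<rhd> coh (- z)) (coh z)"
  proof (intro AE_I2 cinner_tendsto)
    fix z :: "complex^'n"
    have "bounded_linear (\<lambda>A. A \<rhd> coh (- z))"
      by (rule bounded_linear_intro[where K=1]) (use norm_app[of _ "coh (- z)"] in \<open>auto simp: app_add_left app_scaleR_left\<close>)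
    from bounded_linear.tendsto[OF this lim] show "(\<lambda>j. Y j \<rhd> coh (- z)) \<longlonglongrightarrow> P \<rhd> coh (- z)" .
  qed
qed (use ptrace_measurable in simp_all)

section \<open>Approximate inverses and Newton iteration\<close>

text \<open>The cubic 3 y^2 - 2 y^3 fixes 0 and 1 and has zero derivative at both, so it attracts
  near-idempotents to idempotents quadratically.\<close>

definition newton :: "'a::real_normed_algebra_1 \<Rightarrow> 'a" where
  "newton Y = 3 *\<^sub>R (Y * Y) - 2 *\<^sub>R (Y * Y * Y)"

lemma newton_diff: "newton Y - Y = - ((2 *\<^sub>R Y - 1) * (Y * Y - Y))"
proof -
  have "3 *\<^sub>R x = 2 *\<^sub>R x + x" for x :: 'a by (metis scaleR_left_distrib scaleR_one numeral_plus_one semiring_norm(5))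
  then show ?thesis by (simp add: newton_def algebra_simps)
qed

text \<open>With \<open>Z = 2 Y - 1\<close> one has \<open>Z^2 = 1 + 4 D\<close> and
  \<open>newton Y = Y - Z * D\<close>. Everything commutes, and \<open>D * D\<close> factors out of
  the new defect.\<close>

lemma newton_defect:
  fixes Y :: "'a::real_normed_algebra_1"
  defines "D \<equiv> Y * Y - Y"
  shows "newton Y * newton Y - newton Y = (D * D) * (4 *\<^sub>R D - 3 *\<^sub>R 1)"
proof -
  define Z where "Z = 2 *\<^sub>R Y - 1"
  have three: "3 *\<^sub>R x = 2 *\<^sub>R x + x" for x :: 'a by (metis scaleR_left_distrib scaleR_one numeral_plus_one semiring_norm(5))
  have two: "2 *\<^sub>R x = x + x" for x :: 'a by (simp add: scaleR_2)
  have "4 *\<^sub>R x = 2 *\<^sub>R 2 *\<^sub>R x" for x :: 'a by simp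
  then have four: "4 *\<^sub>R x = x + x + (x + x)" for x :: 'a unfolding two .
  have Z2: "Z * Z = 1 + 4 *\<^sub>R D" unfolding Z_def D_def four two by (simp add: algebra_simps)
  have comm: "Y * D = D * Y" "Z * D = D * Z" unfolding Z_def D_def by (simp_all add: algebra_simps)
  have YZ: "Y * Z + Z * Y = Z + Z * Z" unfolding Z_def two by (simp add: algebra_simps)
  have Y: "newton Y = Y - Z * D" using newton_diff[of Y] unfolding Z_def D_def by (simp add: algebra_simps)
  have c2: "Z * D * Y = Z * Y * D" "Z * D * (Z * D) = (Z * Z) * (D * D)"
    using comm by (metis mult.assoc)+
  have "newton Y * newton Y - newton Y = D - (Y * Z + Z * Y) * D + Z * D + (Z * Z) * (D * D)"
    unfolding Y D_def[symmetric] using c2 by (simp add: algebra_simps D_def) 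
  also have "\<dots> = D - (Z * Z) * D + (Z * Z) * (D * D)" unfolding YZ by (simp add: algebra_simps)
  also have "\<dots> = (D * D) * (4 *\<^sub>R D - 3 *\<^sub>R 1)" unfolding Z2 by (simp add: algebra_simps) (simp add: three two four algebra_simps)
  finally show ?thesis .
qed

text \<open>As long as the norm stays at most 3, a step is at most 7 times the defect. A defect of
  at most 1/16 shrinks by the factor (1/16) * 4 = 1/4, so the steps sum to at most 7 d * 4/3 = 28/3
  d <= 7/12, which keeps the norm below 3.\<close>

lemma newton_iter_bounds:
  fixes Y :: "'a::real_normed_algebra_1"
  assumes Y: "norm Y \<le> 2" and d: "norm (Y * Y - Y) \<le> d" "d \<le> 1/16"
  defines "X \<equiv> \<lambda>j. (newton ^^ j) Y"
  shows "norm (X j * X j - X j) \<le> d * (1/4)^j \<and> norm (X j - Y) \<le> 28/3 * d * (1 - (1/4)^j)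
     \<and> norm (X j) \<le> 3 \<and> norm (X (Suc j) - X j) \<le> 7 * d * (1/4)^j"
proof -
  have d0: "d \<ge> 0" using d(1) norm_ge_zero order_trans by blast
  have step: "norm (newton Z - Z) \<le> 7 * norm (Z * Z - Z)" if "norm Z \<le> 3" for Z :: 'a
  proof -
    have "norm (2 *\<^sub>R Z - 1) \<le> 7" using norm_triangle_ineq4[of "2 *\<^sub>R Z" 1] that by simp
    then show ?thesis unfolding newton_diff norm_minus_cancel
      by (intro order_trans[OF norm_mult_ineq] mult_right_mono) auto
  qed
  have three: "norm (X j) \<le> 3" if "norm (X j - Y) \<le> 28/3 * d * (1 - (1/4)^j)" for j
  proof -
    have "28/3 * d * (1 - (1/4)^j) \<le> 28/3 * (1/16) * 1"
      using d(2) d0 by (intro mult_mono) (auto simp: power_le_one)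
    then show ?thesis using norm_triangle_sub[of "X j" Y] that Y by linarith
  qed
  have main: "norm (X j * X j - X j) \<le> d * (1/4)^j \<and> norm (X j - Y) \<le> 28/3 * d * (1 - (1/4)^j)" for j
  proof (induction j)
    case 0
    then show ?case using d by (simp add: X_def)
  next
    case (Suc j)
    define D where "D = X j * X j - X j"
    have D: "norm D \<le> d * (1/4)^j" using Suc by (simp add: D_def)
    have "d * (1/4)^j \<le> (1/16) * 1" using d(2) d0 by (intro mult_mono) (auto simp: power_le_one)
    then have D16: "norm D \<le> 1/16" using D by linarith
    have XS: "X (Suc j) = newton (X j)" by (simp add: X_def)
    have "norm (X (Suc j) * X (Suc j) - X (Suc j)) = norm ((D * D) * (4 *\<^sub>R D - 3 *\<^sub>R 1))"
      unfolding XS D_def newton_defect ..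
    also have "\<dots> \<le> norm (D * D) * norm (4 *\<^sub>R D - 3 *\<^sub>R 1)" by (rule norm_mult_ineq)
    also have "\<dots> \<le> (norm D * (1/16)) * 4"
    proof (rule mult_mono)
      show "norm (D * D) \<le> norm D * (1/16)"
        using D16 by (intro order_trans[OF norm_mult_ineq] mult_left_mono) auto
      have "norm (4 *\<^sub>R D - 3 *\<^sub>R 1) \<le> 4 * norm D + 3"
        using norm_triangle_ineq4[of "4 *\<^sub>R D" "3 *\<^sub>R 1"] by simp
      then show "norm (4 *\<^sub>R D - 3 *\<^sub>R 1) \<le> 4" using D16 by linarith
    qed auto
    also have "\<dots> \<le> d * (1/4)^j * (1/4)" using D by simp
    finally have 1: "norm (X (Suc j) * X (Suc j) - X (Suc j)) \<le> d * (1/4)^Suc j" by simp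
    have "norm (X (Suc j) - X j) \<le> 7 * norm D"
      unfolding XS D_def using step[OF three] Suc by blast
    then have "norm (X (Suc j) - Y) \<le> 28/3 * d * (1 - (1/4)^j) + 7 * (d * (1/4)^j)"
      using norm_triangle_ineq[of "X (Suc j) - X j" "X j - Y"] Suc D by simp
    also have "\<dots> = 28/3 * d * (1 - (1/4)^Suc j)" by (simp add: field_simps)
    finally show ?case using 1 by blast
  qed
  have "norm (X (Suc j) - X j) \<le> 7 * norm (X j * X j - X j)"
    using step[OF three[OF conjunct2[OF main[of j]]]] by (simp add: X_def)
  also have "\<dots> \<le> 7 * (d * (1/4)^j)" using main[of j] by simp
  finally show ?thesis using main[of j] three by simp
qed

lemma newton_limit:
  fixes Y :: "'a::{real_normed_algebra_1, banach}"
  assumes Y: "norm Y \<le> 2" and d: "norm (Y * Y - Y) \<le> d" "d \<le> 1/16"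
  obtains P where "(\<lambda>j. (newton ^^ j) Y) \<longlonglongrightarrow> P" "P * P = P" "norm (P - Y) \<le> 28/3 * d"
proof -
  define X where "X j = (newton ^^ j) Y" for j
  note b = newton_iter_bounds[OF Y d, folded X_def]
  have "summable (\<lambda>j. X (Suc j) - X j)"
  proof (rule summable_comparison_test'[where N=0])
    show "summable (\<lambda>j. 7 * d * (1/4)^j)" by (intro summable_mult summable_geometric) simp
    show "norm (X (Suc j) - X j) \<le> 7 * d * (1/4)^j" for j using b[of j] by simp
  qed
  then have "convergent (\<lambda>n. \<Sum>j<n. X (Suc j) - X j)" by (simp add: summable_iff_convergent)
  moreover have "(\<Sum>j<n. X (Suc j) - X j) = X n - X 0" for n by (rule sum_lessThan_telescope)
  ultimately obtain L where "(\<lambda>n. X n - X 0) \<longlonglongrightarrow> L" by (auto simp: convergent_def)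
  then have "(\<lambda>n. X n - X 0 + X 0) \<longlonglongrightarrow> L + X 0" by (intro tendsto_intros)
  then obtain P where P: "X \<longlonglongrightarrow> P" by auto
  have "(\<lambda>j. X j * X j - X j) \<longlonglongrightarrow> 0"
  proof (rule Lim_null_comparison[OF always_eventually[OF allI]])
    show "norm (X j * X j - X j) \<le> d * (1/4)^j" for j using b[of j] by simp
    have "(\<lambda>j. d * (1/4)^j) \<longlonglongrightarrow> d * 0" by (intro tendsto_intros LIMSEQ_power_zero) simp
    then show "(\<lambda>j. d * (1/4)^j) \<longlonglongrightarrow> 0" by simp
  qed
  moreover have "(\<lambda>j. X j * X j - X j) \<longlonglongrightarrow> P * P - P" by (intro tendsto_intros P)
  ultimately have "P * P - P = 0" using LIMSEQ_unique by blast
  moreover have "norm (P - Y) \<le> 28/3 * d"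
  proof (rule LIMSEQ_le_const2)
    show "(\<lambda>j. norm (X j - Y)) \<longlonglongrightarrow> norm (P - Y)" by (intro tendsto_intros P)
    have d0: "d \<ge> 0" using d(1) norm_ge_zero order_trans by blast
    have "28/3 * d * (1 - (1/4)^j) \<le> 28/3 * d * 1" for j using d0 by (intro mult_left_mono) auto
    then have "norm (X n - Y) \<le> 28/3 * d" for n
      using b[of n] by (metis mult_1_right order_trans)
    then show "\<exists>N. \<forall>n\<ge>N. norm (X n - Y) \<le> 28/3 * d" by blast
  qed
  ultimately show ?thesis using that P unfolding X_def by simp
qed

text \<open>The constants fit together: 0.01 * 1.01 + 0.01 + 0.01 <= 31/1000 <= 1/16, and the Newton
  limit stays within 28/3 * 31/1000 + 1/100 < 1 of \<open>P\<close>, close enough to preserve the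
  rank.\<close>

lemma near_idempotent:
  fixes Y :: "'a::real_normed_algebra_1"
  assumes "P * P = P" "norm P \<le> 1" "norm (Y - P) \<le> 1/100"
  shows "norm Y \<le> 2" "norm (Y * Y - Y) \<le> 31/1000"
proof -
  have n: "norm Y \<le> 101/100" using norm_triangle_sub[of Y P] assms by linarith
  then show "norm Y \<le> 2" by simp
  have "Y * Y - Y = (Y - P) * Y + P * (Y - P) - (Y - P)" using assms(1) by (simp add: algebra_simps)
  also have "norm \<dots> \<le> norm ((Y - P) * Y) + norm (P * (Y - P)) + norm (Y - P)"
    by (meson add_mono norm_triangle_ineq norm_triangle_ineq4 order_refl order_trans)
  also have "\<dots> \<le> (1/100) * (101/100) + 1 * (1/100) + 1/100"
    using assms n by (intro add_mono order_trans[OF norm_mult_ineq] mult_mono) auto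
  finally show "norm (Y * Y - Y) \<le> 31/1000" by simp
qed

text \<open>\<open>par\<close> is a sequence of approximate inverses of \<open>X\<close>, to be used with \<open>S\<close> the adjoint of \<open>X\<close>; its
  defects \<open>1 - par j * X\<close> and \<open>1 - X * par j\<close> are the iterates of \<open>newton\<close> on powers
  of \<open>1 - c S X\<close> and \<open>1 - c X S\<close>.\<close>

fun par :: "real \<Rightarrow> nat \<Rightarrow> 'a::real_normed_algebra_1 \<Rightarrow> 'a \<Rightarrow> nat \<Rightarrow> 'a" where
  "par c k X S 0 = (\<Sum>i<k. c *\<^sub>R ((1 - c *\<^sub>R (S * X)) ^ i * S))"
| "par c k X S (Suc j) = par c k X S j * X * par c k X S j * (3 *\<^sub>R 1 - 2 *\<^sub>R (X * par c k X S j))"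

text \<open>Applied to \<open>V = B * X\<close> this shows that a Newton step preserves the form
  \<open>1 - B * X\<close>, with \<open>B * X * B * (3 - 2 X * B)\<close> as the new
  \<open>B\<close>; the same new \<open>B\<close> serves for \<open>V = X * B\<close>. This is the
  recursion in \<open>par\<close>.\<close>

lemma newton_one_minus: "newton (1 - V) = 1 - V * V * (3 *\<^sub>R 1 - 2 *\<^sub>R V)"
proof -
  have three: "3 *\<^sub>R x = x + x + x" for x :: 'a
    by (metis scaleR_left_distrib scaleR_one numeral_plus_one semiring_norm(5) scaleR_2)
  have "V * V * (3 *\<^sub>R 1 - 2 *\<^sub>R V) = 3 *\<^sub>R (V * V) - 2 *\<^sub>R (V * V * V)"
    by (simp only: right_diff_distrib mult_scaleR_right mult_1_right)
  then show ?thesis unfolding newton_def three scaleR_2 by (simp add: algebra_simps)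
qed

lemma par_defect:
  "1 - par c k X S j * X = (newton ^^ j) ((1 - c *\<^sub>R (S * X)) ^ k)"
  "1 - X * par c k X S j = (newton ^^ j) ((1 - c *\<^sub>R (X * S)) ^ k)"
proof (induction j)
  case 0
  define Z W where "Z = 1 - c *\<^sub>R (S * X)" and "W = 1 - c *\<^sub>R (X * S)"
  have "(\<Sum>i<m. c *\<^sub>R (Z ^ i * S)) * X = 1 - Z ^ m" for m
  proof (induction m)
    case (Suc m)
    have "c *\<^sub>R (Z ^ m * S) * X = Z ^ m * (1 - Z)" by (simp add: Z_def mult.assoc)
    also have "\<dots> = Z ^ m - Z ^ Suc m" by (simp add: right_diff_distrib power_commutes)
    finally show ?case using Suc by (simp add: distrib_right)
  qed simp
  \<comment> \<open>The intertwining relation that allows one geometric sum to serve as left and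
    right approximate inverse.\<close>
  moreover have XZ: "X * Z ^ m = W ^ m * X" for m
  proof (induction m)
    case (Suc m)
    have "X * Z ^ Suc m = X * Z * Z ^ m" by (simp add: mult.assoc)
    also have "X * Z = W * X" by (simp add: Z_def W_def algebra_simps)
    finally show ?case using Suc by (simp add: mult.assoc)
  qed simp
  moreover have "X * (\<Sum>i<m. c *\<^sub>R (Z ^ i * S)) = 1 - W ^ m" for m
  proof (induction m)
    case (Suc m)
    have "X * c *\<^sub>R (Z ^ m * S) = c *\<^sub>R (W ^ m * X * S)"
      using XZ[of m] by (simp add: mult.assoc[symmetric])
    also have "\<dots> = W ^ m * (1 - W)" by (simp add: W_def mult.assoc)
    also have "\<dots> = W ^ m - W ^ Suc m" by (simp add: right_diff_distrib power_commutes)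
    finally show ?case using Suc by (simp add: distrib_left)
  qed simp
  ultimately show "1 - par c k X S 0 * X = (newton ^^ 0) ((1 - c *\<^sub>R (S * X)) ^ k)"
    "1 - X * par c k X S 0 = (newton ^^ 0) ((1 - c *\<^sub>R (X * S)) ^ k)"
    unfolding Z_def W_def by auto
next
  case (Suc j)
  define B where "B = par c k X S j"
  have B: "par c k X S (Suc j) = B * X * B * (3 *\<^sub>R 1 - 2 *\<^sub>R (X * B))" by (simp add: B_def)
  have "par c k X S (Suc j) * X = (B * X) * (B * X) * (3 *\<^sub>R 1 - 2 *\<^sub>R (B * X))"
    unfolding B by (simp add: algebra_simps)
  then have "1 - par c k X S (Suc j) * X = newton (1 - B * X)" unfolding newton_one_minus by simp
  then show "1 - par c k X S (Suc j) * X = (newton ^^ Suc j) ((1 - c *\<^sub>R (S * X)) ^ k)"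
    using Suc(1) by (simp add: B_def)
  have "X * par c k X S (Suc j) = (X * B) * (X * B) * (3 *\<^sub>R 1 - 2 *\<^sub>R (X * B))"
    unfolding B by (simp add: mult.assoc)
  then have "1 - X * par c k X S (Suc j) = newton (1 - X * B)" unfolding newton_one_minus by simp
  then show "1 - X * par c k X S (Suc j) = (newton ^^ Suc j) ((1 - c *\<^sub>R (X * S)) ^ k)"
    using Suc(2) by (simp add: B_def)
qed

section \<open>Continuation, bounds and symmetries of the approximate inverses\<close>

lemma orbit_ext_sum: "(\<And>i. i < (k::nat) \<Longrightarrow> orbit_ext e (C i) (T i)) \<Longrightarrow> orbit_ext e (\<Sum>i<k. C i) (\<lambda>t. \<Sum>i<k. T i t)"
proof (induction k)
  case 0
  then show ?case by (simp add: orbit_ext_def hol_family_const alpha_def)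
next
  case (Suc k)
  then show ?case by (auto intro: orbit_ext_add)
qed

lemma orbit_ext_par:
  assumes X: "orbit_ext e X TX" and S: "orbit_ext e S TS"
  shows "orbit_ext e (par c k X S j) (\<lambda>t. par c k (TX t) (TS t) j)"
proof (induction j)
  case 0
  show ?case unfolding par.simps
    by (intro orbit_ext_sum orbit_ext_scaleR orbit_ext_mult orbit_ext_power orbit_ext_diff orbit_ext_one X S)
next
  case (Suc j)
  show ?case unfolding par.simps
    by (intro orbit_ext_scaleR orbit_ext_mult orbit_ext_diff orbit_ext_one X Suc)
qed

text \<open>What matters is uniformity in \<open>X\<close> and \<open>S\<close>, to be applied to
  the continuations in all directions at once. The bound may grow with \<open>j\<close>, since the
  trace identity is used for each \<open>j\<close> separately.\<close>

lemma par_bound: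
  obtains M where "\<And>X S :: 'a::real_normed_algebra_1. norm X \<le> r \<Longrightarrow> norm S \<le> r \<Longrightarrow> norm (par c k X S j) \<le> M"
proof -
  have "\<exists>M. \<forall>X S :: 'a. norm X \<le> r \<longrightarrow> norm S \<le> r \<longrightarrow> norm (par c k X S j) \<le> M"
  proof (induction j)
    case 0
    show ?case
    proof (intro exI allI impI)
      fix X S :: 'a assume XS: "norm X \<le> r" "norm S \<le> r"
      have r: "r \<ge> 0" using XS norm_ge_zero order_trans by blast
      have "norm (S * X) \<le> r * r" using XS r by (intro order_trans[OF norm_mult_ineq] mult_mono) auto
      then have "\<bar>c\<bar> * norm (S * X) \<le> \<bar>c\<bar> * (r * r)" by (intro mult_left_mono) auto
      then have Z: "norm (1 - c *\<^sub>R (S * X)) \<le> 1 + \<bar>c\<bar> * (r * r)"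
        using norm_triangle_ineq4[of 1 "c *\<^sub>R (S * X)"] by simp
      have "norm (c *\<^sub>R ((1 - c *\<^sub>R (S * X)) ^ i * S)) \<le> \<bar>c\<bar> * ((1 + \<bar>c\<bar> * (r * r)) ^ i * r)" for i
        unfolding norm_scaleR
        by (intro mult_left_mono order_trans[OF norm_mult_ineq] mult_mono order_trans[OF norm_power_ineq] power_mono Z XS) (use r in auto)
      then show "norm (par c k X S 0) \<le> (\<Sum>i<k. \<bar>c\<bar> * ((1 + \<bar>c\<bar> * (r * r)) ^ i * r))"
        unfolding par.simps by (intro order_trans[OF norm_sum] sum_mono)
    qed
  next
    case (Suc j)
    then obtain M where M: "\<And>X S :: 'a. norm X \<le> r \<Longrightarrow> norm S \<le> r \<Longrightarrow> norm (par c k X S j) \<le> M" by blast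
    show ?case
    proof (intro exI allI impI)
      fix X S :: 'a assume XS: "norm X \<le> r" "norm S \<le> r"
      define B where "B = par c k X S j"
      have B: "norm B \<le> M" using M XS by (simp add: B_def)
      have r: "r \<ge> 0" "M \<ge> 0" using XS B norm_ge_zero order_trans by blast+
      have "norm (X * B) \<le> r * M" using XS B r by (intro order_trans[OF norm_mult_ineq] mult_mono) auto
      then have "norm (3 *\<^sub>R 1 - 2 *\<^sub>R (X * B)) \<le> 3 + 2 * (r * M)"
        using norm_triangle_ineq4[of "3 *\<^sub>R 1" "2 *\<^sub>R (X * B)"] by simp
      then show "norm (par c k X S (Suc j)) \<le> M * r * M * (3 + 2 * (r * M))"
        unfolding par.simps B_def[symmetric]
        by (intro order_trans[OF norm_mult_ineq] mult_mono B XS) (use r in auto)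
    qed
  qed
  then show ?thesis using that by blast
qed

lemma pop_conj_mult: "pop * (A * B) * pop = (pop * A * pop) * (pop * B * pop)"
proof -
  have "(pop * A * pop) * (pop * B * pop) = pop * A * (pop * pop) * B * pop" by (simp only: mult.assoc)
  then show ?thesis by (simp add: mult.assoc)
qed

lemma pop_conj_even_power: "pop * Z * pop = Z \<Longrightarrow> pop * Z ^ k * pop = Z ^ k"
  by (induction k) (auto simp: pop_conj_mult)

lemma pop_conj_lin: "pop * (A - B) * pop = pop * A * pop - pop * B * pop" "pop * (r *\<^sub>R A) * pop = r *\<^sub>R (pop * A * pop)"
  "pop * 1 * pop = 1"
  by (simp_all add: algebra_simps)

text \<open>Every word occurring in \<open>par\<close> has odd total degree in \<open>X\<close> and
  \<open>S\<close>.\<close>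

lemma pop_par:
  assumes X: "pop * X * pop = - X" and S: "pop * S * pop = - S"
  shows "pop * par c k X S j * pop = - par c k X S j"
proof (induction j)
  case 0
  have Z: "pop * (1 - c *\<^sub>R (S * X)) * pop = 1 - c *\<^sub>R (S * X)"
    by (simp only: pop_conj_lin pop_conj_mult X S) simp
  have "pop * (c *\<^sub>R ((1 - c *\<^sub>R (S * X)) ^ i * S)) * pop = - (c *\<^sub>R ((1 - c *\<^sub>R (S * X)) ^ i * S))" for i
    by (simp only: pop_conj_lin(2) pop_conj_mult S pop_conj_even_power[OF Z]) simp
  then show ?case unfolding par.simps by (simp only: sum_distrib_left sum_distrib_right sum_negf)
next
  case (Suc j)
  show ?case unfolding par.simps
    by (simp only: pop_conj_lin pop_conj_mult X Suc) simp
qed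

lemma adj_power: "adj (A ^ k) = adj A ^ k"
  by (induction k) (simp_all add: adj_props power_commutes)

lemma adj_newton: "adj (newton Y) = newton (adj Y)"
  by (simp add: newton_def adj_props mult.assoc)

lemma adj_newton_iter: "adj Y = Y \<Longrightarrow> adj ((newton ^^ j) Y) = (newton ^^ j) Y"
  by (induction j) (simp_all add: adj_newton)

lemma adj_tendsto: "(X \<longlongrightarrow> A) F \<Longrightarrow> ((\<lambda>n. adj (X n)) \<longlongrightarrow> adj A) F"
  unfolding tendsto_iff dist_norm by (simp flip: adj_props(2) add: norm_adj)

text \<open>Continuity of a fixed word, with \<open>X\<close> and \<open>T\<close> varied
  independently: it must also cover complex times, where the second variable is not the adjoint of
  the first.\<close>

lemma word_near:
  fixes A S :: "'a::real_normed_algebra_1"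
  assumes "norm ((1 - c *\<^sub>R (S * A)) ^ k - P) < eps"
  obtains \<eta> where "\<eta> > 0" "\<And>X T. norm (X - A) < \<eta> \<Longrightarrow> norm (T - S) < \<eta> \<Longrightarrow> norm ((1 - c *\<^sub>R (T * X)) ^ k - P) < eps"
proof -
  have "continuous_on UNIV (\<lambda>p. norm ((1 - c *\<^sub>R (snd p * fst p)) ^ k - P))"
    by (intro continuous_intros)
  then have "((\<lambda>p. norm ((1 - c *\<^sub>R (snd p * fst p)) ^ k - P)) \<longlongrightarrow> norm ((1 - c *\<^sub>R (snd (A, S) * fst (A, S))) ^ k - P)) (at (A, S))"
    by (simp add: continuous_on_def)
  from order_tendstoD(2)[OF this, of eps] assms
  obtain d where d: "d > 0" "\<And>p. p \<noteq> (A, S) \<Longrightarrow> dist p (A, S) < d \<Longrightarrow> norm ((1 - c *\<^sub>R (snd p * fst p)) ^ k - P) < eps"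
    unfolding eventually_at by auto
  show ?thesis
  proof (rule that[of "d / 2"])
    fix X T assume XT: "norm (X - A) < d / 2" "norm (T - S) < d / 2"
    have "dist (X, T) (A, S) \<le> dist X A + dist T S"
      unfolding dist_Pair_Pair by (rule sqrt_sum_squares_le_sum) auto
    then have "dist (X, T) (A, S) < d" using XT by (simp add: dist_norm)
    then show "norm ((1 - c *\<^sub>R (T * X)) ^ k - P) < eps"
      using d(2)[of "(X, T)"] assms by (cases "(X, T) = (A, S)") auto
  qed (use d in simp)
qed

lemma decay_of_orbit_ext:
  assumes "\<And>e. norm e = 1 \<Longrightarrow> orbit_ext e C (T e)" "\<And>e. norm e = 1 \<Longrightarrow> norm (T e (\<i> * of_real \<delta>)) \<le> M" "M \<ge> 0"
  shows "decay (M * exp (\<delta>\<^sup>2)) \<delta> C"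
  unfolding decay_def by (intro allI orbit_ext_decay[where T=T]) (use assms in auto)

lemma mollify_adj: "A \<in> C1 \<Longrightarrow> l > 0 \<Longrightarrow> adj (mollify l A) = mollify l (adj A)"
  unfolding mollify_def by (intro smear_adj gauss_weight0_integrable) (auto simp only: gauss_weight_zero complex_cnj_complex_of_real)

lemma mollify_odd: "A \<in> C1 \<Longrightarrow> l > 0 \<Longrightarrow> pop * A * pop = - A \<Longrightarrow> pop * mollify l A * pop = - mollify l A"
  unfolding mollify_def by (intro smear_odd gauss_weight0_integrable) (auto simp only: gauss_weight_zero norm_minus_cancel)

lemma adj_odd: assumes "pop * A * pop = - A" shows "pop * adj A * pop = - adj A"
proof -
  have "adj (pop * A * pop) = pop * adj A * pop" by (simp add: adj_props mult.assoc)
  moreover have "adj (- A) = - adj A" using adj_props(5)[of "-1" A] by simp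
  ultimately show ?thesis using assms by simp
qed

text \<open>\<open>P0\<close> and \<open>P1\<close> will be the projections onto the kernels of
  \<open>A\<close> and its adjoint. The tolerance \<eta>, the averaging parameter \<open>l\<close>
  and the time \<delta> are fixed in this order, before the iteration starts.\<close>

theorem twisted_index_formula:
  fixes A :: "'n::finite fop"
  assumes A: "A \<in> C1" and odd: "pop * A * pop = - A"
    and P0: "P0 * P0 = P0" "norm P0 \<le> 1" and P1: "P1 * P1 = P1" "norm P1 \<le> 1"
    and n0: "norm ((1 - c *\<^sub>R (adj A * A)) ^ k - P0) < 1/100"
    and n1: "norm ((1 - c *\<^sub>R (A * adj A)) ^ k - P1) < 1/100"
  obtains P P' where "P * P = P" "adj P = P" "pop * P * pop = P" "norm (P - P0) < 1"
    "P' * P' = P'" "adj P' = P'" "pop * P' * pop = P'" "norm (P' - P1) < 1"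
    "ptrace P + ptrace P' = 2 * of_real (pi ^ CARD('n))"
proof -
  obtain \<eta>0 where \<eta>0: "\<eta>0 > 0" "\<And>X T. norm (X - A) < \<eta>0 \<Longrightarrow> norm (T - adj A) < \<eta>0 \<Longrightarrow> norm ((1 - c *\<^sub>R (T * X)) ^ k - P0) < 1/100"
    using word_near[OF n0] by blast
  obtain \<eta>1 where \<eta>1: "\<eta>1 > 0" "\<And>X T. norm (X - adj A) < \<eta>1 \<Longrightarrow> norm (T - A) < \<eta>1 \<Longrightarrow> norm ((1 - c *\<^sub>R (T * X)) ^ k - P1) < 1/100"
    using word_near[OF n1] by blast
  define \<eta> where "\<eta> = min \<eta>0 \<eta>1"
  have \<eta>: "\<eta> > 0" using \<eta>0 \<eta>1 by (simp add: \<eta>_def)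
  note adjA = C1_adj[OF A]
  obtain l0 where l0: "l0 > 0" "\<And>l. l \<ge> l0 \<Longrightarrow> norm (mollify l A - A) \<le> \<eta> / 4"
    using mollify_tendsto[OF A, of "\<eta> / 4"] \<eta> by auto
  obtain l1 where l1: "l1 > 0" "\<And>l. l \<ge> l1 \<Longrightarrow> norm (mollify l (adj A) - adj A) \<le> \<eta> / 4"
    using mollify_tendsto[OF adjA, of "\<eta> / 4"] \<eta> by auto
  define l where "l = max l0 l1"
  have l: "l > 0" using l0 by (simp add: l_def)
  define X S where "X = mollify l A" and "S = mollify l (adj A)"
  have XA: "norm (X - A) \<le> \<eta> / 4" and SA: "norm (S - adj A) \<le> \<eta> / 4"
    using l0(2)[of l] l1(2)[of l] by (simp_all add: X_def S_def l_def)
  have S: "adj X = S" unfolding X_def S_def by (rule mollify_adj[OF A l])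
  have Xodd: "pop * X * pop = - X" unfolding X_def by (rule mollify_odd[OF A l odd])
  have Sodd: "pop * S * pop = - S" unfolding S[symmetric] by (rule adj_odd[OF Xodd])
  obtain K0 where K0: "K0 \<ge> 0" "\<And>e t. norm e = 1 \<Longrightarrow> cmod t \<le> 1 \<Longrightarrow> norm (mollify_ext l e A t - X) \<le> cmod t * K0"
    unfolding X_def using mollify_ext_near[OF A l] by blast
  obtain K1 where K1: "K1 \<ge> 0" "\<And>e t. norm e = 1 \<Longrightarrow> cmod t \<le> 1 \<Longrightarrow> norm (mollify_ext l e (adj A) t - S) \<le> cmod t * K1"
    unfolding S_def using mollify_ext_near[OF adjA l] by blast
  \<comment> \<open>At time \<open>\<i> * \<delta>\<close> the continuations are then within
    \<eta>/4 of \<open>X\<close> and \<open>S\<close>, hence within \<eta>/2 of \<open>A\<close> and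
    its adjoint. The minimum with 1 keeps the time in the disc covered by
    \<open>mollify_ext_near\<close>.\<close>
  define \<delta> where "\<delta> = min 1 (\<eta> / (4 * (K0 + K1 + 1)))"
  have K: "K0 + K1 + 1 > 0" using K0 K1 by simp
  have \<delta>: "\<delta> > 0" "\<delta> \<le> 1" using \<eta> K by (simp_all add: \<delta>_def)
  have "\<delta> \<le> \<eta> / (4 * (K0 + K1 + 1))" by (simp add: \<delta>_def)
  then have \<delta>K: "\<delta> * (K0 + K1 + 1) \<le> \<eta> / 4" using K by (simp add: field_simps)
  define t where "t = \<i> * complex_of_real \<delta>"
  have t: "cmod t = \<delta>" using \<delta> by (simp add: t_def norm_mult)
  have near: "norm (mollify_ext l e A t - A) < \<eta>" "norm (mollify_ext l e (adj A) t - adj A) < \<eta>" if e: "norm e = 1" for e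
  proof -
    have "\<delta> * K0 \<le> \<delta> * (K0 + K1 + 1)" "\<delta> * K1 \<le> \<delta> * (K0 + K1 + 1)"
      using K0 K1 \<delta> by (auto intro!: mult_left_mono)
    moreover have "norm (mollify_ext l e A t - X) \<le> \<delta> * K0" "norm (mollify_ext l e (adj A) t - S) \<le> \<delta> * K1"
      using K0(2)[OF e, of t] K1(2)[OF e, of t] t \<delta> by simp_all
    ultimately have "norm (mollify_ext l e A t - X) \<le> \<eta> / 4" "norm (mollify_ext l e (adj A) t - S) \<le> \<eta> / 4"
      using \<delta>K by linarith+
    then show "norm (mollify_ext l e A t - A) < \<eta>" "norm (mollify_ext l e (adj A) t - adj A) < \<eta>"
      using norm_triangle_ineq[of "mollify_ext l e A t - X" "X - A"] norm_triangle_ineq[of "mollify_ext l e (adj A) t - S" "S - adj A"] XA SA \<eta>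
      by auto
  qed
  note eX = orbit_ext_mollify_ext[OF A l, folded X_def] and eS = orbit_ext_mollify_ext[OF adjA l, folded S_def]
  define B where "B j = par c k X S j" for j
  define TB where "TB e j s = par c k (mollify_ext l e A s) (mollify_ext l e (adj A) s) j" for e j s
  have eB: "orbit_ext e (B j) (TB e j)" if "norm e = 1" for e j
    unfolding B_def TB_def by (intro orbit_ext_par eX eS that)
  define Y Y' where "Y j = 1 - B j * X" and "Y' j = 1 - X * B j" for j
  define r where "r = norm A + norm (adj A) + \<eta>"
  have rb: "norm (mollify_ext l e A t) \<le> r" "norm (mollify_ext l e (adj A) t) \<le> r" if "norm e = 1" for e
    using near[OF that] norm_triangle_sub[of "mollify_ext l e A t" A] norm_triangle_sub[of "mollify_ext l e (adj A) t" "adj A"]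
    norm_ge_zero[of A] norm_ge_zero[of "adj A"] unfolding r_def by linarith+
  have dX: "decay (r * exp (\<delta>\<^sup>2)) \<delta> X"
    using \<eta> by (intro decay_of_orbit_ext[where T="\<lambda>e. mollify_ext l e A"] eX rb[unfolded t_def]) (auto simp: r_def)
  have dB: "\<exists>M. decay M \<delta> (B j)" for j
  proof -
    obtain M where M: "\<And>X S :: 'n fop. norm X \<le> r \<Longrightarrow> norm S \<le> r \<Longrightarrow> norm (par c k X S j) \<le> M"
      using par_bound[of r c k j] by blast
    have "decay (max M 0 * exp (\<delta>\<^sup>2)) \<delta> (B j)"
    proof (rule decay_of_orbit_ext[where T="\<lambda>e. TB e j"])
      fix e :: "complex^'n" assume "norm e = 1"
      then show "norm (TB e j (\<i> * of_real \<delta>)) \<le> max M 0"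
        using M[OF rb] unfolding TB_def t_def[symmetric] by (simp add: le_max_iff_disj)
    qed (auto intro: eB)
    then show ?thesis by blast
  qed
  have d1: "decay (1 * exp (\<delta>\<^sup>2)) \<delta> (1 :: 'n fop)"
    by (intro decay_of_orbit_ext[where T="\<lambda>e t. 1"] orbit_ext_one) auto
  \<comment> \<open>By \<open>par_defect\<close> the continuation of \<open>Y j\<close> is itself a
    Newton iterate, started near \<open>P0\<close>. Its norm is therefore at most 3 for all
    \<open>j\<close>, which gives the decay constant common to the whole sequence.\<close>
  have dY: "decay (3 * exp (\<delta>\<^sup>2)) \<delta> (Y j)" for j
  proof (rule decay_of_orbit_ext[where T="\<lambda>e s. 1 - TB e j s * mollify_ext l e A s"])
    fix e :: "complex^'n" assume e: "norm e = 1"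
    show "orbit_ext e (Y j) (\<lambda>s. 1 - TB e j s * mollify_ext l e A s)"
      unfolding Y_def by (intro orbit_ext_diff orbit_ext_one orbit_ext_mult eB eX e)
    have "norm ((1 - c *\<^sub>R (mollify_ext l e (adj A) t * mollify_ext l e A t)) ^ k - P0) \<le> 1/100"
      using \<eta>0(2)[of "mollify_ext l e A t" "mollify_ext l e (adj A) t"] near[OF e] by (simp add: \<eta>_def)
    note ni = near_idempotent[OF P0 this]
    show "norm (1 - TB e j (\<i> * of_real \<delta>) * mollify_ext l e A (\<i> * of_real \<delta>)) \<le> 3"
      unfolding TB_def t_def[symmetric] par_defect using newton_iter_bounds[OF ni, of j] by simp
  qed simp
  have dY': "decay (3 * exp (\<delta>\<^sup>2)) \<delta> (Y' j)" for j
  proof (rule decay_of_orbit_ext[where T="\<lambda>e s. 1 - mollify_ext l e A s * TB e j s"])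
    fix e :: "complex^'n" assume e: "norm e = 1"
    show "orbit_ext e (Y' j) (\<lambda>s. 1 - mollify_ext l e A s * TB e j s)"
      unfolding Y'_def by (intro orbit_ext_diff orbit_ext_one orbit_ext_mult eB eX e)
    have "norm ((1 - c *\<^sub>R (mollify_ext l e A t * mollify_ext l e (adj A) t)) ^ k - P1) \<le> 1/100"
      using \<eta>1(2)[of "mollify_ext l e (adj A) t" "mollify_ext l e A t"] near[OF e] by (simp add: \<eta>_def)
    note ni = near_idempotent[OF P1 this]
    show "norm (1 - mollify_ext l e A (\<i> * of_real \<delta>) * TB e j (\<i> * of_real \<delta>)) \<le> 3"
      unfolding TB_def t_def[symmetric] par_defect using newton_iter_bounds[OF ni, of j] by simp
  qed simp
  \<comment> \<open>The decay constant of \<open>B j\<close> may depend on \<open>j\<close>, but the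
    resulting value does not, so the identity survives the limit.\<close>
  have sum: "ptrace (Y j) + ptrace (Y' j) = 2 * of_real (pi ^ CARD('n))" for j
  proof -
    obtain M where M: "decay M \<delta> (B j)" using dB by blast
    have "ptrace (B j * X) = - ptrace (X * B j)" by (rule ptrace_twisted[OF M dX \<delta>(1) Xodd])
    moreover have "ptrace (B j * X) = ptrace (1 :: 'n fop) - ptrace (Y j)"
      using ptrace_diff[OF d1 dY \<delta>(1) \<delta>(1), of j] by (simp add: Y_def)
    moreover have "ptrace (X * B j) = ptrace (1 :: 'n fop) - ptrace (Y' j)"
      using ptrace_diff[OF d1 dY' \<delta>(1) \<delta>(1), of j] by (simp add: Y'_def)
    ultimately show ?thesis by (simp add: ptrace_one algebra_simps)
  qed
  have Y_it: "Y j = (newton ^^ j) ((1 - c *\<^sub>R (S * X)) ^ k)" "Y' j = (newton ^^ j) ((1 - c *\<^sub>R (X * S)) ^ k)" for j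
    unfolding Y_def Y'_def B_def by (rule par_defect)+
  have XA': "norm (X - A) < \<eta>" "norm (S - adj A) < \<eta>" using XA SA \<eta> by auto
  have N0: "norm ((1 - c *\<^sub>R (S * X)) ^ k - P0) \<le> 1/100"
    using \<eta>0(2)[of X S] XA' by (simp add: \<eta>_def)
  have N1: "norm ((1 - c *\<^sub>R (X * S)) ^ k - P1) \<le> 1/100"
    using \<eta>1(2)[of S X] XA' by (simp add: \<eta>_def)
  have n16: "31/1000 \<le> (1/16::real)" by simp
  obtain P where P: "Y \<longlonglongrightarrow> P" "P * P = P" "norm (P - (1 - c *\<^sub>R (S * X)) ^ k) \<le> 28/3 * (31/1000)"
    using newton_limit[OF near_idempotent[OF P0 N0] n16] unfolding Y_it[abs_def] by blast
  obtain P' where P': "Y' \<longlonglongrightarrow> P'" "P' * P' = P'" "norm (P' - (1 - c *\<^sub>R (X * S)) ^ k) \<le> 28/3 * (31/1000)"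
    using newton_limit[OF near_idempotent[OF P1 N1] n16] unfolding Y_it[abs_def] by blast
  have Bodd: "pop * B j * pop = - B j" for j unfolding B_def by (rule pop_par[OF Xodd Sodd])
  have Yev: "pop * Y j * pop = Y j" "pop * Y' j * pop = Y' j" for j
    unfolding Y_def Y'_def by (simp_all only: pop_conj_lin pop_conj_mult Xodd Bodd) simp_all
  have "adj ((1 - c *\<^sub>R (S * X)) ^ k) = (1 - c *\<^sub>R (S * X)) ^ k" "adj ((1 - c *\<^sub>R (X * S)) ^ k) = (1 - c *\<^sub>R (X * S)) ^ k"
    using S by (auto simp: adj_power adj_props)
  then have Ysa: "adj (Y j) = Y j" "adj (Y' j) = Y' j" for j
    unfolding Y_it by (auto intro: adj_newton_iter)
  show ?thesis
  proof (rule that)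
    show "P * P = P" "P' * P' = P'" by (rule P P')+
    show "adj P = P" "adj P' = P'"
      using adj_tendsto[OF P(1)] adj_tendsto[OF P'(1)] P(1) P'(1) LIMSEQ_unique by (auto simp: Ysa)
    have "(\<lambda>j. pop * Y j * pop) \<longlonglongrightarrow> pop * P * pop" "(\<lambda>j. pop * Y' j * pop) \<longlonglongrightarrow> pop * P' * pop"
      by (intro tendsto_intros P P')+
    then show "pop * P * pop = P" "pop * P' * pop = P'"
      unfolding Yev using P(1) P'(1) LIMSEQ_unique by auto
    show "norm (P - P0) < 1"
      using norm_triangle_ineq[of "P - (1 - c *\<^sub>R (S * X)) ^ k" "(1 - c *\<^sub>R (S * X)) ^ k - P0"] P(3) N0 by simp
    show "norm (P' - P1) < 1"
      using norm_triangle_ineq[of "P' - (1 - c *\<^sub>R (X * S)) ^ k" "(1 - c *\<^sub>R (X * S)) ^ k - P1"] P'(3) N1 by simp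
    have "(\<lambda>j. ptrace (Y j) + ptrace (Y' j)) \<longlonglongrightarrow> ptrace P + ptrace P'"
      by (intro tendsto_add ptrace_tendsto[OF dY \<delta>(1) P(1)] ptrace_tendsto[OF dY' \<delta>(1) P'(1)])
    then show "ptrace P + ptrace P' = 2 * of_real (pi ^ CARD('n))"
      unfolding sum using LIMSEQ_unique tendsto_const by blast
  qed
qed

section \<open>Finite-rank projections\<close>

definition orthonormal :: "'n::finite fock set \<Rightarrow> bool" where
  "orthonormal E \<longleftrightarrow> finite E \<and> (\<forall>e\<in>E. \<forall>f\<in>E. fock_cinner e f = (if e = f then 1 else 0))"

definition proj :: "'n::finite fock set \<Rightarrow> 'n fop" where
  "proj E = (SOME P. \<forall>f. P \<rhd> f = (\<Sum>e\<in>E. fock_cinner f e *\<^sub>C e))"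

lemma app_proj: "proj E \<rhd> f = (\<Sum>e\<in>E. fock_cinner f e *\<^sub>C e)"
proof -
  have "\<exists>P. \<forall>f. P \<rhd> f = (\<Sum>e\<in>E. fock_cinner f e *\<^sub>C e)"
  proof (rule fop_exists[of "\<lambda>f. \<Sum>e\<in>E. fock_cinner f e *\<^sub>C e" "\<Sum>e\<in>E. norm e * norm e"])
    fix f g c
    show "(\<Sum>e\<in>E. fock_cinner (f + g) e *\<^sub>C e) = (\<Sum>e\<in>E. fock_cinner f e *\<^sub>C e) + (\<Sum>e\<in>E. fock_cinner g e *\<^sub>C e)"
      by (simp add: cinner_add_left fock.scale_left_distrib sum.distrib)
    show "(\<Sum>e\<in>E. fock_cinner (c *\<^sub>C f) e *\<^sub>C e) = c *\<^sub>C (\<Sum>e\<in>E. fock_cinner f e *\<^sub>C e)"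
      by (simp add: cinner_scale_left fock.scale_sum_right)
    have "norm (fock_cinner f e *\<^sub>C e) \<le> norm e * norm e * norm f" for e
      using mult_right_mono[OF cinner_cauchy_schwarz[of f e], of "norm e"] by (simp add: norm_scaleC mult_ac)
    then show "norm (\<Sum>e\<in>E. fock_cinner f e *\<^sub>C e) \<le> (\<Sum>e\<in>E. norm e * norm e) * norm f"
      unfolding sum_distrib_right by (intro order_trans[OF norm_sum] sum_mono)
  qed blast
  from someI_ex[OF this] show ?thesis unfolding proj_def by blast
qed

lemma cinner_proj: "orthonormal E \<Longrightarrow> e \<in> E \<Longrightarrow> fock_cinner (proj E \<rhd> f) e = fock_cinner f e"
proof -
  assume E: "orthonormal E" "e \<in> E"
  have "fock_cinner (proj E \<rhd> f) e = (\<Sum>e'\<in>E. fock_cinner f e' * (if e' = e then 1 else 0))"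
    unfolding app_proj cinner_sum_left cinner_scale_left
    using E by (intro sum.cong refl) (auto simp: orthonormal_def)
  also have "\<dots> = fock_cinner f e"
    using E by (simp add: orthonormal_def if_distrib cong: if_cong)
  finally show ?thesis .
qed

lemma proj_in_span: "proj E \<rhd> f \<in> fock.span E"
  unfolding app_proj by (intro fock.span_sum fock.span_scale fock.span_base)

lemma proj_span: assumes E: "orthonormal E" and f: "f \<in> fock.span E" shows "proj E \<rhd> f = f"
  using f
proof (induction rule: fock.span_induct_alt)
  case (step c x y)
  have "proj E \<rhd> x = (\<Sum>e\<in>E. (if x = e then 1 else 0) *\<^sub>C e)"
    unfolding app_proj using E step by (intro sum.cong refl) (auto simp: orthonormal_def)
  also have "\<dots> = x" using E step by (simp add: orthonormal_def if_distrib[of "\<lambda>c. c *\<^sub>C _"] cong: if_cong)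
  finally show ?case using step by (simp add: app_add_right app_scale_right)
qed simp

lemma proj_zero: "(\<And>e. e \<in> E \<Longrightarrow> fock_cinner f e = 0) \<Longrightarrow> proj E \<rhd> f = 0"
  by (simp add: app_proj)

lemma proj_idem: "orthonormal E \<Longrightarrow> proj E * proj E = proj E"
  by (rule fop_eqI) (simp add: app_mult proj_span proj_in_span)

lemma cinner_proj_left: "orthonormal E \<Longrightarrow> fock_cinner (proj E \<rhd> f) g = fock_cinner f (proj E \<rhd> g)"
proof -
  have "fock_cinner (proj E \<rhd> f) g = (\<Sum>e\<in>E. fock_cinner f e * fock_cinner e g)"
    by (simp add: app_proj cinner_sum_left cinner_scale_left)
  also have "\<dots> = fock_cinner f (proj E \<rhd> g)"
    by (simp add: app_proj cinner_sum_right cinner_scale_right cinner_cnj mult.commute)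
  finally show ?thesis .
qed

lemma norm_proj_compl: assumes "orthonormal E" shows "norm (proj E \<rhd> f) \<le> norm f" "norm (f - proj E \<rhd> f) \<le> norm f"
proof -
  have "fock_cinner f (proj E \<rhd> f) = fock_cinner (proj E \<rhd> f) (proj E \<rhd> f)"
    using cinner_proj_left[OF assms, of f "proj E \<rhd> f"] proj_span[OF assms proj_in_span] by simp
  then have "Re (fock_cinner f (proj E \<rhd> f)) = (norm (proj E \<rhd> f))\<^sup>2"
    by (simp add: cinner_self del: of_real_power)
  then have e: "(norm (f - proj E \<rhd> f))\<^sup>2 = (norm f)\<^sup>2 - (norm (proj E \<rhd> f))\<^sup>2"
    by (simp add: norm_diff_cinner)
  show "norm (proj E \<rhd> f) \<le> norm f"
    by (rule power2_le_imp_le[OF _ norm_ge_zero]) (use e zero_le_power2[of "norm (f - proj E \<rhd> f)"] in linarith)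
  show "norm (f - proj E \<rhd> f) \<le> norm f"
    by (rule power2_le_imp_le[OF _ norm_ge_zero]) (use e zero_le_power2[of "norm (proj E \<rhd> f)"] in linarith)
qed

lemma norm_proj: "orthonormal E \<Longrightarrow> norm (proj E) \<le> 1"
  by (rule norm_fop_bound) (auto simp: norm_proj_compl)

lemma orthonormal_combination_zero:
  assumes E: "orthonormal E" and s: "(\<Sum>e\<in>E. u e *\<^sub>C e) = 0" and e: "e \<in> E"
  shows "u e = 0"
proof -
  have "fock_cinner (\<Sum>e\<in>E. u e *\<^sub>C e) e = (\<Sum>e'\<in>E. u e' * (if e' = e then 1 else 0))"
    unfolding cinner_sum_left cinner_scale_left using E e by (intro sum.cong refl) (auto simp: orthonormal_def)
  also have "\<dots> = u e" using E e by (simp add: orthonormal_def if_distrib cong: if_cong)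
  finally show ?thesis unfolding s by simp
qed

lemma orthonormal_independent: "orthonormal E \<Longrightarrow> fock.independent E"
  by (rule fock.independent_if_scalars_zero) (auto simp: orthonormal_def intro: orthonormal_combination_zero[unfolded orthonormal_def])

text \<open>The projection onto the span of \<open>E\<close> is injective on the span of
  \<open>F\<close>, so it maps \<open>F\<close> to an independent set of the same size.\<close>

lemma orthonormal_card_le:
  assumes E: "orthonormal E" and F: "orthonormal F" and inj: "\<And>x. x \<in> fock.span F \<Longrightarrow> proj E \<rhd> x = 0 \<Longrightarrow> x = 0"
  shows "card F \<le> card E"
proof -
  have finF: "finite F" and finE: "finite E" using E F by (auto simp: orthonormal_def)
  have inj': "inj_on (app (proj E)) F"
  proof (rule inj_onI)
    fix x y assume xy: "x \<in> F" "y \<in> F" "proj E \<rhd> x = proj E \<rhd> y"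
    then have "proj E \<rhd> (x - y) = 0" by (simp add: app_diff_right)
    moreover have "x - y \<in> fock.span F" using xy by (intro fock.span_diff fock.span_base)
    ultimately have "x - y = 0" by (intro inj[of "x - y"])
    then show "x = y" by simp
  qed
  have "fock.independent (app (proj E) ` F)"
  proof (rule fock.independent_if_scalars_zero)
    fix u x assume s: "(\<Sum>x\<in>app (proj E) ` F. u x *\<^sub>C x) = 0" and x: "x \<in> app (proj E) ` F"
    obtain f where f: "f \<in> F" "x = proj E \<rhd> f" using x by auto
    have "proj E \<rhd> (\<Sum>f\<in>F. u (proj E \<rhd> f) *\<^sub>C f) = 0"
      using s by (simp add: sum.reindex[OF inj'] app_sum_right app_scale_right)
    then have "(\<Sum>f\<in>F. u (proj E \<rhd> f) *\<^sub>C f) = 0"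
      by (rule inj[rotated]) (intro fock.span_sum fock.span_scale fock.span_base)
    from orthonormal_combination_zero[OF F this f(1)] show "u x = 0" using f by simp
  qed (use finF in simp)
  moreover have "app (proj E) ` F \<subseteq> fock.span E" using proj_in_span by auto
  ultimately have "card (app (proj E) ` F) \<le> card E"
    using fock.independent_span_bound[OF finE] by blast
  then show ?thesis using card_image[OF inj'] by simp
qed

section \<open>Parity eigenbases and the trace of an almost known projection\<close>

definition parity_eigen :: "'n::finite fock set \<Rightarrow> bool" where
  "parity_eigen E \<longleftrightarrow> (\<forall>e\<in>E. parity e = e \<or> parity e = - e)"

lemma parity_minus: "parity (- f) = - parity f"
  using parity_scale[of "-1" f] by simp

text \<open>The bound \<open>m\<close> yields a largest orthonormal system of parity eigenvectors in
  \<open>V\<close>. A vector outside its span would allow the system to be enlarged.\<close>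

lemma parity_eigen_onb_exists:
  fixes V :: "'n::finite fock set"
  assumes V: "fock.subspace V" and par: "\<And>f. f \<in> V \<Longrightarrow> parity f \<in> V"
    and bd: "\<And>E. orthonormal E \<Longrightarrow> E \<subseteq> V \<Longrightarrow> card E \<le> m"
  obtains E where "orthonormal E" "parity_eigen E" "fock.span E = V"
proof -
  let ?S = "\<lambda>E. orthonormal E \<and> parity_eigen E \<and> E \<subseteq> V"
  have "?S {}" by (simp add: orthonormal_def parity_eigen_def)
  moreover have "\<forall>E. ?S E \<longrightarrow> card E \<le> m" using bd by blast
  ultimately obtain E where E: "?S E" and max: "\<And>F. ?S F \<Longrightarrow> card F \<le> card E"
    using ex_has_greatest_nat[of ?S "{}" card "Suc m"] by (auto simp: less_Suc_eq_le)
  have finE: "finite E" using E by (auto simp: orthonormal_def)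
  have "f \<in> fock.span E" if f: "f \<in> V" for f
  proof (rule ccontr)
    assume nf: "f \<notin> fock.span E"
    define g where "g = f - proj E \<rhd> f"
    have spanV: "fock.span E \<subseteq> V" using E V by (simp add: fock.span_minimal)
    have gV: "g \<in> V" unfolding g_def using f spanV proj_in_span V by (intro fock.subspace_diff) auto
    have g0: "g \<noteq> 0" using nf proj_in_span[of E f] unfolding g_def by auto
    have go: "fock_cinner g e = 0" if "e \<in> E" for e
      using cinner_proj[of E e f] E that by (simp add: g_def cinner_diff_left)
    have go': "fock_cinner (parity g) e = 0" if "e \<in> E" for e
      using E go[OF that] that unfolding parity_eigen_def cinner_parity by (auto simp: cinner_minus_right)
    \<comment> \<open>The even and odd parts of \<open>g\<close> cannot both vanish; a nonzero one
      is an eigenvector and still orthogonal to \<open>E\<close>, since parity preserves the lines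
      spanned by \<open>E\<close>.\<close>
    have "\<exists>s. (s = 1 \<or> s = - 1) \<and> g + s *\<^sub>R parity g \<noteq> 0"
    proof (rule ccontr)
      assume "\<nexists>s. (s = 1 \<or> s = - 1) \<and> g + s *\<^sub>R parity g \<noteq> 0"
      then have a: "g + 1 *\<^sub>R parity g = 0" "g + (- 1) *\<^sub>R parity g = 0" by blast+
      have "g + g = (g + 1 *\<^sub>R parity g) + (g + (- 1) *\<^sub>R parity g)" by simp
      then have "g + g = 0" unfolding a by simp
      then show False using g0 by (simp flip: scaleR_2)
    qed
    then obtain s :: real where s: "s = 1 \<or> s = - 1" "g + s *\<^sub>R parity g \<noteq> 0" by blast
    define h where "h = g + s *\<^sub>R parity g"
    define u where "u = (1 / norm h) *\<^sub>R h"
    have h0: "norm h \<noteq> 0" using s by (simp add: h_def)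
    have hV: "h \<in> V" unfolding h_def scaleR_scaleC by (intro fock.subspace_add[OF V] fock.subspace_scale[OF V] gV par)
    have uV: "u \<in> V" unfolding u_def scaleR_scaleC by (intro fock.subspace_scale[OF V] hV)
    have ho: "fock_cinner h e = 0" if "e \<in> E" for e
      using go[OF that] go'[OF that] by (simp add: h_def cinner_add_left scaleR_scaleC cinner_scale_left)
    have uo: "fock_cinner u e = 0" "fock_cinner e u = 0" if "e \<in> E" for e
      using ho[OF that] cinner_cnj[of h e] by (simp_all add: u_def scaleR_scaleC cinner_scale_left cinner_scale_right)
    have un: "fock_cinner u u = 1" unfolding cinner_self using h0 by (simp add: u_def)
    have pu: "parity h = s *\<^sub>R h"
      using s(1) by (auto simp: h_def scaleR_scaleC parity_add parity_scale parity_minus)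
    have "parity u = s *\<^sub>R u"
      using pu unfolding u_def scaleR_scaleC parity_scale by simp
    then have eu: "parity u = u \<or> parity u = - u" using s(1) by auto
    have uE: "u \<notin> E" using uo[of u] un by auto
    have "?S (insert u E)"
      using E uV eu uo un finE by (auto simp: orthonormal_def parity_eigen_def)
    then have "card (insert u E) \<le> card E" by (rule max)
    then show False using uE finE by simp
  qed
  moreover have "fock.span E \<subseteq> V" using E V by (simp add: fock.span_minimal)
  ultimately have "fock.span E = V" by auto
  then show ?thesis using that E by blast
qed

text \<open>Distance less than 1 makes each projection injective on the range of the other, so the
  ranks agree. In a parity eigenbasis the trace is a sum of signs, and such a sum has the parity of
  its number of terms.\<close>

lemma ptrace_projection:
  fixes P :: "'n::finite fop"
  assumes P: "P * P = P" "adj P = P" "pop * P * pop = P" and E: "orthonormal E" and n: "norm (P - proj E) < 1"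
  obtains m :: int where "ptrace P = (2 * pi) ^ CARD('n) * of_int m" "even m \<longleftrightarrow> even (card E)"
proof -
  define V where "V = {f. P \<rhd> f = f}"
  have V: "fock.subspace V"
    unfolding V_def fock.subspace_def by (auto simp: app_add_right app_scale_right)
  have par: "parity f \<in> V" if "f \<in> V" for f
  proof -
    have "P * pop = pop * P * pop * pop" using P(3) by simp
    also have "\<dots> = pop * P" by (simp add: mult.assoc)
    finally have "(P * pop) \<rhd> f = (pop * P) \<rhd> f" by simp
    then show ?thesis using that by (simp add: V_def app_mult)
  qed
  have zero: "x = 0" if "norm x \<le> norm (P - proj E) * norm x" for x :: "'n fock"
    using that n by (smt (verit) mult_le_cancel_right1 norm_eq_zero norm_ge_zero)
  have bd: "card F \<le> card E" if F: "orthonormal F" "F \<subseteq> V" for F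
  proof (rule orthonormal_card_le[OF E F(1)])
    fix x assume "x \<in> fock.span F" "proj E \<rhd> x = 0"
    moreover then have "x \<in> V" using fock.span_minimal[OF F(2) V] by auto
    ultimately have "x = (P - proj E) \<rhd> x" by (simp add: app_diff_left V_def)
    then have "norm x \<le> norm (P - proj E) * norm x" using norm_app[of "P - proj E" x] by simp
    then show "x = 0" by (rule zero)
  qed
  obtain F where F: "orthonormal F" "parity_eigen F" "fock.span F = V"
    using parity_eigen_onb_exists[OF V par bd] by blast
  have PF: "P \<rhd> f = (\<Sum>e\<in>F. fock_cinner f e *\<^sub>C e)" for f
  proof -
    have "P \<rhd> (P \<rhd> f) = P \<rhd> f" using P(1) by (metis app_mult)
    then have "P \<rhd> f \<in> fock.span F" unfolding F(3) V_def by simp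
    from proj_span[OF F(1) this] have "P \<rhd> f = (\<Sum>e\<in>F. fock_cinner (P \<rhd> f) e *\<^sub>C e)" by (simp add: app_proj)
    also have "\<dots> = (\<Sum>e\<in>F. fock_cinner f e *\<^sub>C e)"
    proof (intro sum.cong refl)
      fix e assume "e \<in> F"
      then have "e \<in> V" using fock.span_base F(3) by blast
      then show "fock_cinner (P \<rhd> f) e *\<^sub>C e = fock_cinner f e *\<^sub>C e"
        by (simp add: cinner_adj P(2) V_def)
    qed
    finally show ?thesis .
  qed
  have "card E \<le> card F"
  proof (rule orthonormal_card_le[OF F(1) E])
    fix x assume x: "x \<in> fock.span E" "proj F \<rhd> x = 0"
    then have "P \<rhd> x = 0" by (simp add: PF app_proj)
    then have "(P - proj E) \<rhd> x = - x" using proj_span[OF E x(1)] by (simp add: app_diff_left)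
    then have "norm x \<le> norm (P - proj E) * norm x" using norm_app[of "P - proj E" x] by simp
    then show "x = 0" by (rule zero)
  qed
  moreover have "card F \<le> card E"
    by (rule bd[OF F(1)]) (use F(3) fock.span_superset in blast)
  ultimately have cEF: "card F = card E" by simp
  define s :: "'n fock \<Rightarrow> int" where "s e = (if parity e = e then 1 else - 1)" for e
  have "fock_cinner e (parity e) = of_int (s e)" if "e \<in> F" for e
  proof -
    have "fock_cinner e e = 1" using F(1) that by (simp add: orthonormal_def)
    then show ?thesis using F(2) that by (auto simp: s_def parity_eigen_def cinner_minus_right)
  qed
  then have "ptrace P = (2 * pi) ^ CARD('n) * of_int (\<Sum>e\<in>F. s e)"
    unfolding ptrace_finite_rank[OF PF] by simp
  moreover have "even (\<Sum>e\<in>F. s e) \<longleftrightarrow> even (card F)"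
  proof -
    have "finite F" using F(1) by (simp add: orthonormal_def)
    then show ?thesis by (induction F) (auto simp: s_def)
  qed
  ultimately show ?thesis unfolding cEF by (rule that)
qed

section \<open>Fredholm operators\<close>

text \<open>With \<open>h\<close> of length \<open>r\<close> along \<open>g\<close>, the values at
  \<open>x + h\<close> and \<open>x - h\<close> differ by 2 <g, h>, so one of them is large whatever
  the value at \<open>x\<close>.\<close>

lemma ball_functional_witness:
  fixes g x :: "'n::finite fock"
  assumes r: "r > 0"
  obtains y where "norm (y - x) \<le> r" "r * norm g \<le> cmod (fock_cinner g y)"
proof (cases "g = 0")
  case True
  then show ?thesis using r by (intro that[of x]) auto
next
  case False
  define h where "h = (r / norm g) *\<^sub>R g"
  have h: "norm h = r" using False r by (simp add: h_def)
  have "fock_cinner g h = of_real (r * norm g)"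
    using False by (simp add: h_def scaleR_scaleC cinner_scale_right cinner_self power2_eq_square)
  then have "cmod (fock_cinner g h) = cmod (complex_of_real (r * norm g))" by (simp only:)
  then have gh: "cmod (fock_cinner g h) = r * norm g" unfolding norm_of_real using r by simp
  have "2 * fock_cinner g h = fock_cinner g (x + h) - fock_cinner g (x - h)"
    by (simp add: cinner_add_right cinner_diff_right)
  then have "cmod (2 * fock_cinner g h) \<le> cmod (fock_cinner g (x + h)) + cmod (fock_cinner g (x - h))"
    using norm_triangle_ineq4 by metis
  then have "r * norm g \<le> cmod (fock_cinner g (x + h)) \<or> r * norm g \<le> cmod (fock_cinner g (x - h))"
    using gh by (simp add: norm_mult) linarith
  then show ?thesis using that[of "x + h"] that[of "x - h"] h by auto
qed

text \<open>The gliding-hump argument of Sokal for the uniform boundedness principle.\<close>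

lemma fock_uniform_bounded:
  fixes S :: "'n::finite fock set"
  assumes pt: "\<And>h. \<exists>M. \<forall>g\<in>S. cmod (fock_cinner g h) \<le> M"
  obtains K where "\<And>g. g \<in> S \<Longrightarrow> norm g \<le> K"
proof -
  have "\<exists>K. \<forall>g\<in>S. norm g \<le> K"
  proof (rule ccontr)
    assume "\<nexists>K. \<forall>g\<in>S. norm g \<le> K"
    \<comment> \<open>The growth 4^n is matched to the radii 3^(-n): all steps after the n-th move
      the point by at most (3/2) 3^(-n-1) = (1/2) 3^(-n), so half of the value reached survives, and
      it is at least (4/3)^n / 2.\<close>
    then have "\<exists>g\<in>S. norm g > 4 ^ n" for n :: nat by (meson not_le)
    then obtain g where g: "\<And>n. g n \<in> S" "\<And>n. norm (g n) > 4 ^ n" by metis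
    have "\<exists>y. norm (y - x) \<le> (1/3) ^ n \<and> (1/3) ^ n * norm (g n) \<le> cmod (fock_cinner (g n) y)" for x n
      using ball_functional_witness[of "(1/3) ^ n" x "g n"] by auto
    then obtain Y where Y: "\<And>x n. norm (Y x n - x) \<le> (1/3) ^ n"
      "\<And>x n. (1/3) ^ n * norm (g n) \<le> cmod (fock_cinner (g n) (Y x n))" by metis
    define x where "x = rec_nat 0 (\<lambda>n x. Y x n)"
    have xS: "x (Suc n) = Y (x n) n" for n by (simp add: x_def)
    have step: "norm (x (Suc n) - x n) \<le> (1/3) ^ n" for n unfolding xS by (rule Y)
    have dist: "norm (x (m + n) - x n) \<le> 3/2 * (1/3) ^ n" for m n
    proof -
      have "norm (x (m + n) - x n) \<le> 3/2 * (1/3) ^ n * (1 - (1/3) ^ m)"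
      proof (induction m)
        case (Suc m)
        have "norm (x (Suc m + n) - x n) \<le> norm (x (Suc (m + n)) - x (m + n)) + norm (x (m + n) - x n)"
          using norm_triangle_ineq[of "x (Suc (m + n)) - x (m + n)" "x (m + n) - x n"] by simp
        also have "\<dots> \<le> (1/3) ^ (m + n) + 3/2 * (1/3) ^ n * (1 - (1/3) ^ m)"
          using step[of "m + n"] Suc by (rule add_mono)
        also have "\<dots> = 3/2 * (1/3) ^ n * (1 - (1/3) ^ Suc m)" by (simp add: power_add field_simps)
        finally show ?case .
      qed simp
      also have "\<dots> \<le> 3/2 * (1/3) ^ n * 1" by (intro mult_left_mono) auto
      finally show ?thesis by simp
    qed
    have "Cauchy x"
    proof (rule CauchyI')
      fix e :: real assume e: "e > 0"
      obtain N where N: "(1/3::real) ^ N < e / 2" using real_arch_pow_inv[of "e / 2" "1/3"] e by auto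
      show "\<exists>M. \<forall>m\<ge>M. \<forall>n>m. dist (x m) (x n) < e"
      proof (intro exI[of _ N] allI impI)
        fix m n assume m: "N \<le> m" "m < n"
        have "(1/3::real) ^ m \<le> (1/3) ^ N" using m by (intro power_decreasing) auto
        moreover have "dist (x m) (x n) \<le> 3/2 * (1/3) ^ m"
          using dist[of "n - m" m] m by (simp add: dist_norm norm_minus_commute)
        ultimately show "dist (x m) (x n) < e" using N e by linarith
      qed
    qed
    then obtain L where L: "x \<longlonglongrightarrow> L" using Cauchy_convergent_iff convergent_def by blast
    have Ld: "norm (L - x n) \<le> 3/2 * (1/3) ^ n" for n
    proof (rule LIMSEQ_le_const2)
      show "(\<lambda>m. norm (x (m + n) - x n)) \<longlonglongrightarrow> norm (L - x n)"
        by (intro tendsto_intros LIMSEQ_ignore_initial_segment L)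
      show "\<exists>N. \<forall>m\<ge>N. norm (x (m + n) - x n) \<le> 3/2 * (1/3) ^ n" using dist by blast
    qed
    have low: "1/2 * (4/3) ^ n \<le> cmod (fock_cinner (g n) L)" for n
    proof -
      have "cmod (fock_cinner (g n) (x (Suc n) - L)) \<le> norm (g n) * (3/2 * (1/3) ^ Suc n)"
        using cinner_cauchy_schwarz[of "g n" "x (Suc n) - L"] Ld[of "Suc n"]
        by (intro order_trans[OF cinner_cauchy_schwarz] mult_left_mono) (auto simp: norm_minus_commute)
      moreover have "cmod (fock_cinner (g n) (x (Suc n))) \<le> cmod (fock_cinner (g n) (x (Suc n) - L)) + cmod (fock_cinner (g n) L)"
        using norm_triangle_ineq[of "fock_cinner (g n) (x (Suc n) - L)" "fock_cinner (g n) L"] by (simp add: cinner_diff_right)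
      moreover have "(1/3) ^ n * norm (g n) \<le> cmod (fock_cinner (g n) (x (Suc n)))" unfolding xS by (rule Y)
      moreover have "norm (g n) * (3/2 * (1/3) ^ Suc n) = 1/2 * ((1/3) ^ n * norm (g n))" by simp
      ultimately have "1/2 * ((1/3) ^ n * norm (g n)) \<le> cmod (fock_cinner (g n) L)" by linarith
      moreover have "(1/3) ^ n * 4 ^ n \<le> (1/3) ^ n * norm (g n)" using g(2)[of n] by (intro mult_left_mono) auto
      moreover have "(1/3::real) ^ n * 4 ^ n = (4/3) ^ n" by (simp add: power_mult_distrib[symmetric])
      ultimately show ?thesis by simp
    qed
    obtain M where M: "\<forall>g\<in>S. cmod (fock_cinner g L) \<le> M" using pt by blast
    obtain n where "2 * M < (4/3::real) ^ n" using real_arch_pow[of "4/3" "2 * M"] by auto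
    moreover have "cmod (fock_cinner (g n) L) \<le> M" using M g(1) by blast
    ultimately show False using low[of n] by linarith
  qed
  then show ?thesis using that by blast
qed

lemma bounded_subseq_finite:
  fixes s :: "'b \<Rightarrow> nat \<Rightarrow> complex"
  assumes "finite B" "\<And>b. b \<in> B \<Longrightarrow> bounded (range (s b))"
  shows "\<exists>r. strict_mono r \<and> (\<forall>b\<in>B. convergent (\<lambda>i. s b (r i)))"
  using assms
proof (induction B rule: finite_induct)
  case empty
  then show ?case by (intro exI[of _ id]) (simp add: strict_mono_def)
next
  case (insert b B)
  then obtain r where r: "strict_mono r" "\<forall>b\<in>B. convergent (\<lambda>i. s b (r i))" by auto
  have "bounded (range (\<lambda>i. s b (r i)))" using insert.prems[of b] by (auto intro: bounded_subset)
  then obtain l q where q: "strict_mono q" "((\<lambda>i. s b (r i)) \<circ> q) \<longlonglongrightarrow> l"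
    using bounded_imp_convergent_subsequence by blast
  show ?case
  proof (intro exI[of _ "r \<circ> q"] conjI ballI)
    show "strict_mono (r \<circ> q)" using r q by (intro strict_mono_o)
    fix b' assume "b' \<in> insert b B"
    then show "convergent (\<lambda>i. s b' ((r \<circ> q) i))"
    proof
      assume "b' = b"
      then show ?thesis using q(2) by (auto simp: convergent_def o_def)
    next
      assume "b' \<in> B"
      then obtain l' where "(\<lambda>i. s b' (r i)) \<longlonglongrightarrow> l'" using r(2) by (auto simp: convergent_def)
      from LIMSEQ_subseq_LIMSEQ[OF this q(1)] show ?thesis by (auto simp: convergent_def o_def)
    qed
  qed
qed

text \<open>The dual estimate for finite codimension. If the right-hand quantity is at most 1, then
  <g, h> is bounded for each \<open>h\<close>, written as in \<open>cover\<close>; uniform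
  boundedness then bounds \<open>g\<close>. Closedness of the range will be deduced from this
  estimate.\<close>

lemma complement_bound:
  fixes T :: "'n::finite fop"
  assumes B: "finite B" and cover: "\<And>f. \<exists>x c. f = T \<rhd> x + (\<Sum>b\<in>B. c b *\<^sub>C b)"
  obtains K where "K > 0" "\<And>g. norm g \<le> K * (norm (adj T \<rhd> g) + (\<Sum>b\<in>B. cmod (fock_cinner g b)))"
proof -
  let ?N = "\<lambda>g. norm (adj T \<rhd> g) + (\<Sum>b\<in>B. cmod (fock_cinner g b))"
  have N0: "0 \<le> ?N g" for g by (intro add_nonneg_nonneg sum_nonneg) auto
  have "\<exists>M. \<forall>g\<in>{g. ?N g \<le> 1}. cmod (fock_cinner g h) \<le> M" for h
  proof -
    obtain x c where h: "h = T \<rhd> x + (\<Sum>b\<in>B. c b *\<^sub>C b)" using cover by blast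
    have "cmod (fock_cinner g h) \<le> norm x + (\<Sum>b\<in>B. cmod (c b))" if g: "?N g \<le> 1" for g
    proof -
      have s0: "0 \<le> (\<Sum>b\<in>B. cmod (fock_cinner g b))" by (intro sum_nonneg) auto
      have g1: "norm (adj T \<rhd> g) \<le> 1" using g s0 by linarith
      have g2: "cmod (fock_cinner g b) \<le> 1" if "b \<in> B" for b
      proof -
        have "cmod (fock_cinner g b) \<le> (\<Sum>b\<in>B. cmod (fock_cinner g b))" using that B by (intro member_le_sum) auto
        then show ?thesis using g norm_ge_zero[of "adj T \<rhd> g"] by linarith
      qed
      have "fock_cinner g h = fock_cinner (adj T \<rhd> g) x + (\<Sum>b\<in>B. cnj (c b) * fock_cinner g b)"
        unfolding h by (simp add: cinner_add_right cinner_sum_right cinner_scale_right cinner_adj')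
      also have "cmod \<dots> \<le> cmod (fock_cinner (adj T \<rhd> g) x) + (\<Sum>b\<in>B. cmod (cnj (c b) * fock_cinner g b))"
        by (intro order_trans[OF norm_triangle_ineq] add_mono norm_sum order_refl)
      also have "\<dots> \<le> 1 * norm x + (\<Sum>b\<in>B. cmod (c b))"
      proof (intro add_mono sum_mono)
        show "cmod (fock_cinner (adj T \<rhd> g) x) \<le> 1 * norm x"
          using g1 by (intro order_trans[OF cinner_cauchy_schwarz] mult_right_mono) auto
        fix b assume "b \<in> B"
        then show "cmod (cnj (c b) * fock_cinner g b) \<le> cmod (c b)"
          using mult_left_mono[OF g2[of b], of "cmod (c b)"] by (simp add: norm_mult)
      qed
      finally show ?thesis by simp
    qed
    then show ?thesis by blast
  qed
  then obtain K0 where K0: "\<And>g. g \<in> {g. ?N g \<le> 1} \<Longrightarrow> norm g \<le> K0"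
    using fock_uniform_bounded[of "{g. ?N g \<le> 1}"] by blast
  define K where "K = \<bar>K0\<bar> + 1"
  have sc: "?N (s *\<^sub>R g) = \<bar>s\<bar> * ?N g" for s g
    by (simp add: scaleR_scaleC app_scale_right norm_scaleC cinner_scale_left norm_mult sum_distrib_left distrib_left)
  \<comment> \<open>The shift by \<open>e\<close> permits normalization when
    \<open>?N g = 0\<close>; it is removed by letting \<open>e\<close> tend to 0.\<close>
  have "norm g \<le> K * (?N g + e)" if e: "e > 0" for g e
  proof -
    define s where "s = 1 / (?N g + e)"
    have p: "?N g + e > 0" using N0[of g] e by linarith
    then have s: "s > 0" by (simp add: s_def)
    have "?N (s *\<^sub>R g) = s * ?N g" unfolding sc using s by simp
    also have "\<dots> \<le> s * (?N g + e)" using s e by (intro mult_left_mono) auto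
    also have "\<dots> = 1" using p by (simp add: s_def)
    finally have "norm (s *\<^sub>R g) \<le> K" using K0[of "s *\<^sub>R g"] by (simp add: K_def)
    then have "s * norm g \<le> K" using s by simp
    then show ?thesis using p by (simp add: s_def pos_divide_le_eq)
  qed
  then have "norm g \<le> K * ?N g" for g
  proof -
    have "((\<lambda>e. K * (?N g + e)) \<longlongrightarrow> K * (?N g + 0)) (at_right 0)" by (intro tendsto_intros)
    moreover have "eventually (\<lambda>e. norm g \<le> K * (?N g + e)) (at_right 0)"
      using \<open>\<And>e g. e > 0 \<Longrightarrow> norm g \<le> K * (?N g + e)\<close> by (auto simp: eventually_at_right_field intro: exI[of _ 1])
    ultimately have "norm g \<le> K * (?N g + 0)" by (rule tendsto_lowerbound) simp
    then show ?thesis by simp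
  qed
  moreover have "K > 0" by (simp add: K_def)
  ultimately show ?thesis using that by blast
qed

text \<open>Without a gap there are unit vectors orthogonal to the kernel with images tending to 0.
  Along a subsequence the finitely many functionals converge, so the estimate makes it Cauchy; its
  limit is a unit vector both in the kernel and orthogonal to it.\<close>

lemma kernel_gap:
  fixes S :: "'n::finite fop"
  assumes B: "finite B" and K: "K > 0" "\<And>g. norm g \<le> K * (norm (S \<rhd> g) + (\<Sum>b\<in>B. cmod (fock_cinner g b)))"
    and E: "orthonormal E" "fock.span E = {g. S \<rhd> g = 0}"
  obtains m where "m > 0" "\<And>g. (\<And>e. e \<in> E \<Longrightarrow> fock_cinner g e = 0) \<Longrightarrow> m * norm g \<le> norm (S \<rhd> g)"
proof -
  have "\<exists>m>0. \<forall>g. (\<forall>e\<in>E. fock_cinner g e = 0) \<longrightarrow> m * norm g \<le> norm (S \<rhd> g)"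
  proof (rule ccontr)
    assume neg: "\<not> (\<exists>m>0. \<forall>g. (\<forall>e\<in>E. fock_cinner g e = 0) \<longrightarrow> m * norm g \<le> norm (S \<rhd> g))"
    have "\<exists>g. (\<forall>e\<in>E. fock_cinner g e = 0) \<and> norm g = 1 \<and> norm (S \<rhd> g) < 1 / Suc i" for i :: nat
    proof -
      obtain g where g: "\<forall>e\<in>E. fock_cinner g e = 0" "norm (S \<rhd> g) < 1 / Suc i * norm g"
        using neg[simplified not_ex de_Morgan_conj not_all not_imp not_le, rule_format, of "1 / Suc i"] by auto
      have g0: "norm g > 0" using g(2) by (cases "g = 0") auto
      define h where "h = (1 / norm g) *\<^sub>R g"
      have "norm (S \<rhd> h) = norm (S \<rhd> g) / norm g" using g0 by (simp add: h_def app_scaleR_right)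
      also have "\<dots> < 1 / Suc i" using g(2) g0 by (simp add: pos_divide_less_eq)
      finally have "norm (S \<rhd> h) < 1 / Suc i" .
      moreover have "norm h = 1" using g0 by (simp add: h_def)
      moreover have "\<forall>e\<in>E. fock_cinner h e = 0" using g(1) by (simp add: h_def scaleR_scaleC cinner_scale_left)
      ultimately show ?thesis by blast
    qed
    then obtain g where g: "\<And>i e. e \<in> E \<Longrightarrow> fock_cinner (g i) e = 0" "\<And>i. norm (g i) = 1" "\<And>i. norm (S \<rhd> g i) < 1 / Suc i"
      by metis
    have "bounded (range (\<lambda>i. fock_cinner (g i) b))" for b
      unfolding bounded_iff using cinner_cauchy_schwarz[of "g _" b] g(2) by (intro exI[of _ "norm b"]) auto
    from bounded_subseq_finite[OF B, of "\<lambda>b i. fock_cinner (g i) b", OF this] obtain r where r: "strict_mono r" "\<forall>b\<in>B. convergent (\<lambda>i. fock_cinner (g (r i)) b)"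
      by blast
    define x where "x i = g (r i)" for i
    have Sx: "(\<lambda>i. S \<rhd> x i) \<longlonglongrightarrow> 0"
    proof (rule Lim_null_comparison[OF always_eventually[OF allI]])
      fix i
      have "1 / real (Suc (r i)) \<le> 1 / Suc i" using seq_suble[OF r(1), of i] by (intro divide_left_mono) auto
      then show "norm (S \<rhd> x i) \<le> 1 / Suc i" using g(3)[of "r i"] by (simp add: x_def)
      show "(\<lambda>i. 1 / real (Suc i)) \<longlonglongrightarrow> 0" using LIMSEQ_inverse_real_of_nat by (simp add: inverse_eq_divide)
    qed
    have Cb: "Cauchy (\<lambda>i. fock_cinner (x i) b)" if "b \<in> B" for b
      using r(2) that unfolding x_def by (simp add: Cauchy_convergent_iff)
    have CS: "Cauchy (\<lambda>i. S \<rhd> x i)" using Sx by (rule LIMSEQ_imp_Cauchy)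
    have "Cauchy x"
    proof (rule CauchyI)
      fix e :: real assume e: "e > 0"
      define d where "d = e / (K * (1 + card B) * 2)"
      have d: "d > 0" using e K by (simp add: d_def add_pos_nonneg)
      have "\<exists>N. \<forall>m\<ge>N. \<forall>n\<ge>N. cmod (fock_cinner (x m) b - fock_cinner (x n) b) < d" if "b \<in> B" for b
        using CauchyD[OF Cb[OF that] d] .
      then obtain N where N: "\<And>b m n. b \<in> B \<Longrightarrow> N b \<le> m \<Longrightarrow> N b \<le> n \<Longrightarrow> cmod (fock_cinner (x m) b - fock_cinner (x n) b) < d"
        by metis
      obtain N' where N': "\<And>m n. N' \<le> m \<Longrightarrow> N' \<le> n \<Longrightarrow> norm (S \<rhd> x m - S \<rhd> x n) < d" using CauchyD[OF CS d] by blast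
      show "\<exists>M. \<forall>m\<ge>M. \<forall>n\<ge>M. norm (x m - x n) < e"
      proof (intro exI[of _ "N' + (\<Sum>b\<in>B. N b)"] allI impI)
        fix m n assume mn: "N' + (\<Sum>b\<in>B. N b) \<le> m" "N' + (\<Sum>b\<in>B. N b) \<le> n"
        have Nb: "N b \<le> m" "N b \<le> n" if "b \<in> B" for b
          using member_le_sum[OF that, of N] B mn by auto
        have "norm (x m - x n) \<le> K * (norm (S \<rhd> x m - S \<rhd> x n) + (\<Sum>b\<in>B. cmod (fock_cinner (x m) b - fock_cinner (x n) b)))"
          using K(2)[of "x m - x n"] by (simp add: app_diff_right cinner_diff_left)
        also have "\<dots> \<le> K * (d + (\<Sum>b\<in>B. d))"
          using N'[of m n] N Nb mn K(1) by (intro mult_left_mono add_mono sum_mono) (auto intro: less_imp_le)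
        also have "\<dots> = (K * (1 + card B)) * d" by (simp add: algebra_simps)
        also have "\<dots> = e / 2"
        proof -
          have "K * (1 + card B) > 0" using K(1) by (simp add: add_pos_nonneg)
          then show ?thesis unfolding d_def by (simp del: of_nat_add add: field_simps)
        qed
        also have "\<dots> < e" using e by simp
        finally show "norm (x m - x n) < e" .
      qed
    qed
    then obtain L where L: "x \<longlonglongrightarrow> L" using Cauchy_convergent_iff convergent_def by blast
    have "(\<lambda>i. S \<rhd> x i) \<longlonglongrightarrow> S \<rhd> L" by (rule bounded_linear.tendsto[OF bounded_linear_app L])
    then have "S \<rhd> L = 0" using Sx LIMSEQ_unique by blast
    then have "proj E \<rhd> L = L" using E by (intro proj_span) auto
    moreover have "proj E \<rhd> L = 0"
    proof (rule proj_zero)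
      fix e assume "e \<in> E"
      then have "(\<lambda>i. fock_cinner (x i) e) \<longlonglongrightarrow> 0" using g(1) by (simp add: x_def)
      then show "fock_cinner L e = 0" using cinner_tendsto[OF L, of e] LIMSEQ_unique by blast
    qed
    moreover have "norm L = 1"
    proof -
      have "(\<lambda>i. norm (x i)) \<longlonglongrightarrow> norm L" by (intro tendsto_intros L)
      moreover have "norm (x i) = 1" for i by (simp add: x_def g(2))
      ultimately show ?thesis by (simp add: LIMSEQ_const_iff)
    qed
    ultimately show False by simp
  qed
  then show ?thesis using that by blast
qed

text \<open>\<open>Z = 1 - c *\<^sub>R (adj S * S)\<close> fixes the span of \<open>E\<close> and
  contracts its orthogonal complement: for \<open>g\<close> there, |Z g|^2 = |g|^2 - 2 c |S g|^2 +
  c^2 |S' S g|^2 with S' the adjoint of S, and \<open>c * (norm S)^2 <= 1\<close> bounds this by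
  |g|^2 - c |S g|^2.\<close>

lemma power_to_projection:
  fixes S :: "'n::finite fop"
  assumes E: "orthonormal E" "\<And>e. e \<in> E \<Longrightarrow> S \<rhd> e = 0"
    and m: "m > 0" "\<And>g. (\<And>e. e \<in> E \<Longrightarrow> fock_cinner g e = 0) \<Longrightarrow> m * norm g \<le> norm (S \<rhd> g)"
    and c: "c > 0" "c * (norm S)\<^sup>2 \<le> 1"
  obtains q where "0 \<le> q" "q < 1" "\<And>k. norm ((1 - c *\<^sub>R (adj S * S)) ^ k - proj E) \<le> q ^ k"
proof -
  define Z where "Z = 1 - c *\<^sub>R (adj S * S)"
  \<comment> \<open>The contraction factor is the root of 1 - c m^2; the maximum with 0 keeps the
    radicand nonnegative.\<close>
  define q where "q = sqrt (max 0 (1 - c * m\<^sup>2))"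
  have q: "0 \<le> q" "q < 1" using c m by (auto simp: q_def)
  have Ze: "Z \<rhd> e = e" if "e \<in> E" for e
    using E(2)[OF that] by (simp add: Z_def app_diff_left app_scaleR_left app_mult)
  have Zsa: "adj Z = Z" by (simp add: Z_def adj_props)
  have Zo: "fock_cinner (Z \<rhd> g) e = fock_cinner g e" if "e \<in> E" for g e
    by (simp add: cinner_adj Zsa Ze[OF that])
  have Zn: "norm (Z \<rhd> g) \<le> q * norm g" if g: "\<And>e. e \<in> E \<Longrightarrow> fock_cinner g e = 0" for g
  proof -
    have "(norm (Z \<rhd> g))\<^sup>2 = (norm g)\<^sup>2 - 2 * (c * (norm (S \<rhd> g))\<^sup>2) + c\<^sup>2 * (norm (adj S \<rhd> (S \<rhd> g)))\<^sup>2"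
    proof -
      have "Re (fock_cinner g (c *\<^sub>R (adj S \<rhd> (S \<rhd> g)))) = c * (norm (S \<rhd> g))\<^sup>2"
        by (simp add: scaleR_scaleC cinner_scale_right cinner_adj[symmetric] cinner_self del: of_real_power)
      then show ?thesis
        unfolding Z_def app_diff_left app_scaleR_left app_mult app_one norm_diff_cinner
        by (simp add: power_mult_distrib)
    qed
    also have "c\<^sup>2 * (norm (adj S \<rhd> (S \<rhd> g)))\<^sup>2 \<le> c * (norm (S \<rhd> g))\<^sup>2"
    proof -
      have "(norm (adj S \<rhd> (S \<rhd> g)))\<^sup>2 \<le> (norm S * norm (S \<rhd> g))\<^sup>2"
        using norm_app[of "adj S" "S \<rhd> g"] by (intro power_mono) (auto simp: norm_adj)
      then have "c\<^sup>2 * (norm (adj S \<rhd> (S \<rhd> g)))\<^sup>2 \<le> c\<^sup>2 * (norm S * norm (S \<rhd> g))\<^sup>2" by (intro mult_left_mono) auto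
      also have "\<dots> = (c * (norm S)\<^sup>2) * (c * (norm (S \<rhd> g))\<^sup>2)" by (simp add: power_mult_distrib power2_eq_square)
      also have "\<dots> \<le> 1 * (c * (norm (S \<rhd> g))\<^sup>2)" using c by (intro mult_right_mono) auto
      finally show ?thesis by simp
    qed
    finally have "(norm (Z \<rhd> g))\<^sup>2 \<le> (norm g)\<^sup>2 - c * (norm (S \<rhd> g))\<^sup>2" by simp
    moreover have "c * (m * norm g)\<^sup>2 \<le> c * (norm (S \<rhd> g))\<^sup>2"
      using m(2)[OF g] m(1) c by (intro mult_left_mono power_mono) auto
    ultimately have "(norm (Z \<rhd> g))\<^sup>2 \<le> (1 - c * m\<^sup>2) * (norm g)\<^sup>2" by (simp add: power_mult_distrib algebra_simps)
    also have "\<dots> \<le> q\<^sup>2 * (norm g)\<^sup>2" by (intro mult_right_mono) (auto simp: q_def)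
    finally have "(norm (Z \<rhd> g))\<^sup>2 \<le> (q * norm g)\<^sup>2" by (simp add: power_mult_distrib)
    then show ?thesis by (rule power2_le_imp_le) (use q in auto)
  qed
  have pow: "norm (Z ^ k \<rhd> g) \<le> q ^ k * norm g \<and> (\<forall>e\<in>E. fock_cinner (Z ^ k \<rhd> g) e = 0)"
    if g: "\<And>e. e \<in> E \<Longrightarrow> fock_cinner g e = 0" for g k
  proof (induction k)
    case 0
    then show ?case using g by simp
  next
    case (Suc k)
    have "norm (Z \<rhd> (Z ^ k \<rhd> g)) \<le> q * norm (Z ^ k \<rhd> g)" using Suc by (intro Zn) auto
    also have "\<dots> \<le> q * (q ^ k * norm g)" using Suc q by (intro mult_left_mono) auto
    finally show ?case using Suc Zo by (simp add: app_mult)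
  qed
  have Zs: "Z ^ k \<rhd> f = f" if "f \<in> fock.span E" for f k
  proof -
    have "Z \<rhd> f = f" using that
      by (induction rule: fock.span_induct_alt) (auto simp: app_add_right app_scale_right Ze)
    then show ?thesis by (induction k) (auto simp: app_mult)
  qed
  show ?thesis
  proof (rule that[OF q])
    fix k
    have "norm (Z ^ k - proj E) \<le> q ^ k"
    proof (rule norm_fop_bound)
      fix f
      have "(Z ^ k - proj E) \<rhd> f = Z ^ k \<rhd> (f - proj E \<rhd> f)"
        by (simp add: app_diff_left app_diff_right Zs[OF proj_in_span])
      also have "norm \<dots> \<le> q ^ k * norm (f - proj E \<rhd> f)"
        using E(1) by (intro conjunct1[OF pow]) (simp add: cinner_diff_left cinner_proj)
      also have "\<dots> \<le> q ^ k * norm f" using q by (intro mult_left_mono norm_proj_compl(2)[OF E(1)]) auto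
      finally show "norm ((Z ^ k - proj E) \<rhd> f) \<le> q ^ k * norm f" .
    qed (use q in simp)
    then show "norm ((1 - c *\<^sub>R (adj S * S)) ^ k - proj E) \<le> q ^ k" by (simp add: Z_def)
  qed
qed

section \<open>Cokernels and the parity of the index\<close>

lemma coset_eq_iff:
  fixes P T :: "'n::finite fop"
  assumes P: "\<And>f. f \<in> range (app T) \<longleftrightarrow> P \<rhd> f = 0"
  shows "f +o range (app T) = g +o range (app T) \<longleftrightarrow> P \<rhd> f = P \<rhd> g"
proof -
  have mem: "h \<in> f +o range (app T) \<longleftrightarrow> P \<rhd> h = P \<rhd> f" for f h
  proof
    assume "h \<in> f +o range (app T)"
    then obtain r where r: "r \<in> range (app T)" "h = f + r" by (auto simp: elt_set_plus_def)
    then have "P \<rhd> r = 0" using P by blast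
    then show "P \<rhd> h = P \<rhd> f" using r by (simp add: app_add_right)
  next
    assume "P \<rhd> h = P \<rhd> f"
    then have "h - f \<in> range (app T)" using P by (simp add: app_diff_right)
    then have "f + (h - f) \<in> f +o range (app T)" unfolding elt_set_plus_def by blast
    then show "h \<in> f +o range (app T)" by simp
  qed
  show ?thesis
  proof
    assume eq: "f +o range (app T) = g +o range (app T)"
    have "f \<in> f +o range (app T)" unfolding mem ..
    then have "f \<in> g +o range (app T)" unfolding eq .
    then show "P \<rhd> f = P \<rhd> g" unfolding mem .
  next
    assume "P \<rhd> f = P \<rhd> g"
    then show "f +o range (app T) = g +o range (app T)" by (intro set_eqI) (simp add: mem)
  qed
qed

text \<open>The projection has the range of \<open>T\<close> as kernel and so identifies the
  quotient with the span of \<open>E\<close>. Uniqueness of coefficients becomes independence of the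
  image of \<open>B\<close>, and existence becomes spanning.\<close>

lemma quotient_basis_card:
  fixes T :: "'n::finite fop"
  assumes E: "orthonormal E" and R: "\<And>f. f \<in> range (app T) \<longleftrightarrow> proj E \<rhd> f = 0"
    and B: "quotient_basis (range (app T)) B"
  shows "card B = card E"
proof -
  let ?P = "app (proj E)"
  have finB: "finite B" using B by (simp add: quotient_basis_def)
  have ex1: "\<exists>!c. (\<forall>b. b \<notin> B \<longrightarrow> c b = 0) \<and> ?P f = (\<Sum>b\<in>B. c b *\<^sub>C ?P b)" for f
    using B unfolding quotient_basis_def coset_eq_iff[OF R] by (simp add: app_sum_right app_scale_right)
  have zero: "c b = 0" if s: "(\<Sum>b\<in>B. c b *\<^sub>C ?P b) = 0" and b: "b \<in> B" for c b
  proof -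
    \<comment> \<open>\<open>quotient_basis\<close> compares only coefficient functions that vanish
      outside \<open>B\<close>, so \<open>c\<close> is cut off before uniqueness is applied.\<close>
    define c' where "c' b = (if b \<in> B then c b else 0)" for b
    have "(\<Sum>b\<in>B. c' b *\<^sub>C ?P b) = (\<Sum>b\<in>B. c b *\<^sub>C ?P b)" by (intro sum.cong) (auto simp: c'_def)
    define Q where "Q c \<longleftrightarrow> (\<forall>b. b \<notin> B \<longrightarrow> c b = 0) \<and> ?P 0 = (\<Sum>b\<in>B. c b *\<^sub>C ?P b)" for c
    have ex: "\<exists>!c. Q c" unfolding Q_def by (rule ex1)
    have "Q c'" using \<open>_ = (\<Sum>b\<in>B. c b *\<^sub>C ?P b)\<close> s by (simp add: Q_def c'_def)
    moreover have "Q (\<lambda>_. 0)" by (simp add: Q_def)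
    ultimately have "c' = (\<lambda>_. 0)"
      using trans[OF sym[OF the1_equality[OF ex]] the1_equality[OF ex]] by blast
    then have "c' b = 0" by simp
    then show ?thesis using b by (simp add: c'_def)
  qed
  have inj: "inj_on ?P B"
  proof (rule inj_onI, rule ccontr)
    fix x y assume xy: "x \<in> B" "y \<in> B" "?P x = ?P y" "x \<noteq> y"
    define c :: "'n fock \<Rightarrow> complex" where "c b = (if b = x then 1 else 0) + (if b = y then - 1 else 0)" for b
    have "(\<Sum>b\<in>B. c b *\<^sub>C ?P b) = (\<Sum>b\<in>B. if b = x then ?P x else 0) + (\<Sum>b\<in>B. if b = y then - ?P y else 0)"
      unfolding c_def fock.scale_left_distrib sum.distrib by (intro arg_cong2[where f="(+)"] sum.cong) auto
    also have "\<dots> = 0" using xy finB by simp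
    finally have "c x = 0" using xy(1) by (rule zero)
    then show False using xy(4) by (simp add: c_def)
  qed
  have indep: "fock.independent (?P ` B)"
  proof (rule fock.independent_if_scalars_zero)
    fix u x assume s: "(\<Sum>x\<in>?P ` B. u x *\<^sub>C x) = 0" and x: "x \<in> ?P ` B"
    obtain b where b: "b \<in> B" "x = ?P b" using x by auto
    have "(\<Sum>b\<in>B. u (?P b) *\<^sub>C ?P b) = 0" using s by (simp add: sum.reindex[OF inj])
    from zero[OF this b(1)] show "u x = 0" using b by simp
  qed (use finB in simp)
  have "fock.span (?P ` B) = fock.span E"
  proof
    show "fock.span (?P ` B) \<subseteq> fock.span E"
      by (rule fock.span_minimal) (auto intro: proj_in_span)
    have "e \<in> fock.span (?P ` B)" if "e \<in> E" for e
    proof -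
      obtain c where "?P e = (\<Sum>b\<in>B. c b *\<^sub>C ?P b)" using ex1[of e] by blast
      moreover have "?P e = e" using that by (intro proj_span[OF E] fock.span_base)
      moreover have "(\<Sum>b\<in>B. c b *\<^sub>C ?P b) \<in> fock.span (?P ` B)"
        by (intro fock.span_sum fock.span_scale fock.span_base imageI)
      ultimately show ?thesis by simp
    qed
    then show "fock.span E \<subseteq> fock.span (?P ` B)" by (intro fock.span_minimal) auto
  qed
  then have "fock.dim (?P ` B) = fock.dim E" by (metis fock.dim_span)
  then have "card (?P ` B) = card E"
    using fock.dim_eq_card_independent[OF indep] fock.dim_eq_card_independent[OF orthonormal_independent[OF E]] by simp
  then show ?thesis using card_image[OF inj] by simp
qed

lemma odd_app_parity: assumes "pop * T * pop = - T" shows "T \<rhd> parity f = - parity (T \<rhd> f)"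
proof -
  have "T \<rhd> parity f = pop \<rhd> ((pop * T * pop) \<rhd> f)" by (simp add: app_mult)
  then show ?thesis unfolding assms by (simp add: app_minus_left parity_minus)
qed

text \<open>Oddness makes the kernel invariant under parity, so the maximality argument for
  eigenbases applies.\<close>

lemma kernel_onb:
  fixes T :: "'n::finite fop"
  assumes odd: "pop * T * pop = - T" and bd: "\<And>E. orthonormal E \<Longrightarrow> (\<And>e. e \<in> E \<Longrightarrow> T \<rhd> e = 0) \<Longrightarrow> card E \<le> m"
  obtains E where "orthonormal E" "fock.span E = {f. T \<rhd> f = 0}"
proof -
  have V: "fock.subspace {f. T \<rhd> f = 0}"
    unfolding fock.subspace_def by (auto simp: app_add_right app_scale_right)
  have p: "parity f \<in> {f. T \<rhd> f = 0}" if "f \<in> {f. T \<rhd> f = 0}" for f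
    using that odd_app_parity[OF odd, of f] parity_scale[of 0 0] by simp
  have b: "card E \<le> m" if "orthonormal E" "E \<subseteq> {f. T \<rhd> f = 0}" for E
    using that by (intro bd) auto
  show ?thesis using parity_eigen_onb_exists[OF V p b] that by metis
qed

text \<open>The kernel of the adjoint represents the cokernel. Before the trace formula can be used,
  both kernels need a spectral gap, and the range must be shown to be the full orthogonal complement
  of the kernel of the adjoint.\<close>

lemma odd_index:
  fixes T :: "'n::finite fop"
  assumes C1: "T \<in> C1" and odd: "pop * T * pop = - T"
    and ker: "finite B0" "fock.span B0 = {f. T \<rhd> f = 0}"
    and B: "quotient_basis (range (app T)) B"
  shows "odd (int (fock.dim {f. T \<rhd> f = 0}) - int (card B))"
proof -
  have finB: "finite B" using B by (simp add: quotient_basis_def)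
  have cover: "\<exists>x c. f = T \<rhd> x + (\<Sum>b\<in>B. c b *\<^sub>C b)" for f
  proof -
    obtain c where "f +o range (app T) = (\<Sum>b\<in>B. c b *\<^sub>C b) +o range (app T)"
      using B unfolding quotient_basis_def by blast
    moreover have "f + T \<rhd> 0 \<in> f +o range (app T)" unfolding elt_set_plus_def by blast
    ultimately have "f \<in> (\<Sum>b\<in>B. c b *\<^sub>C b) +o range (app T)" by simp
    then obtain x where "f = (\<Sum>b\<in>B. c b *\<^sub>C b) + T \<rhd> x" unfolding elt_set_plus_def by blast
    then have "f = T \<rhd> x + (\<Sum>b\<in>B. c b *\<^sub>C b)" by (simp add: add.commute)
    then show ?thesis by blast
  qed
  obtain E where E: "orthonormal E" "fock.span E = {f. T \<rhd> f = 0}"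
  proof (rule kernel_onb[OF odd, of "card B0"])
    fix F assume "orthonormal F" "\<And>e. e \<in> F \<Longrightarrow> T \<rhd> e = 0"
    then show "card F \<le> card B0"
      using fock.independent_span_bound[OF ker(1) orthonormal_independent[of F]] unfolding ker(2) by auto
  qed
  \<comment> \<open>An orthonormal system in the kernel of the adjoint is orthogonal to the range of
    \<open>T\<close>, so the projections of \<open>B\<close> span it; this bounds its size by
    \<open>card B\<close>.\<close>
  obtain E' where E': "orthonormal E'" "fock.span E' = {f. adj T \<rhd> f = 0}"
  proof (rule kernel_onb[OF adj_odd[OF odd], of "card B"])
    fix F assume F: "orthonormal F" "\<And>e. e \<in> F \<Longrightarrow> adj T \<rhd> e = 0"
    have "e \<in> fock.span (app (proj F) ` B)" if e: "e \<in> F" for e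
    proof -
      obtain x c where xc: "e = T \<rhd> x + (\<Sum>b\<in>B. c b *\<^sub>C b)" using cover by blast
      have "proj F \<rhd> (T \<rhd> x) = 0" by (rule proj_zero) (simp add: cinner_adj F(2))
      then have "proj F \<rhd> e = (\<Sum>b\<in>B. c b *\<^sub>C (proj F \<rhd> b))"
        unfolding xc by (simp add: app_add_right app_sum_right app_scale_right)
      moreover have "proj F \<rhd> e = e" using e by (intro proj_span[OF F(1)] fock.span_base)
      moreover have "(\<Sum>b\<in>B. c b *\<^sub>C (proj F \<rhd> b)) \<in> fock.span (app (proj F) ` B)"
        by (intro fock.span_sum fock.span_scale fock.span_base imageI)
      ultimately show ?thesis by simp
    qed
    then have "card F \<le> card (app (proj F) ` B)"
      using fock.independent_span_bound[of "app (proj F) ` B" F] orthonormal_independent[OF F(1)] finB by blast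
    also have "\<dots> \<le> card B" by (rule card_image_le[OF finB])
    finally show "card F \<le> card B" .
  qed
  have Te: "T \<rhd> e = 0" if "e \<in> E" for e using E(2) fock.span_base[OF that] by blast
  have Te': "adj T \<rhd> e = 0" if "e \<in> E'" for e using E'(2) fock.span_base[OF that] by blast
  obtain K where K: "K > 0" "\<And>g. norm g \<le> K * (norm (adj T \<rhd> g) + (\<Sum>b\<in>B. cmod (fock_cinner g b)))"
    using complement_bound[OF finB cover] by blast
  have "\<exists>m>0. \<forall>g. (\<forall>e\<in>E'. fock_cinner g e = 0) \<longrightarrow> m * norm g \<le> norm (adj T \<rhd> g)"
  proof (rule kernel_gap[OF finB K E'])
    fix m :: real assume "m > 0" and "\<And>g. (\<And>e. e \<in> E' \<Longrightarrow> fock_cinner g e = 0) \<Longrightarrow> m * norm g \<le> norm (adj T \<rhd> g)"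
    then show ?thesis by (intro exI[of _ m] conjI allI impI) auto
  qed
  then obtain m where m1: "m > 0" and m0: "\<forall>g. (\<forall>e\<in>E'. fock_cinner g e = 0) \<longrightarrow> m * norm g \<le> norm (adj T \<rhd> g)"
    by (elim exE conjE)
  have m2: "m * norm g \<le> norm (adj T \<rhd> g)" if "\<And>e. e \<in> E' \<Longrightarrow> fock_cinner g e = 0" for g
    using m0[rule_format, of g] that by simp
  note m = m1 m2
  \<comment> \<open>The gap passes from the adjoint to \<open>T\<close>: a vector orthogonal to the
    kernel of \<open>T\<close> is a limit of vectors u = \<open>adj T \<rhd> g\<close> with
    \<open>g\<close> orthogonal to the kernel of the adjoint, and |u|^2 = <T u, g> <= |T u| |u| /
    m.\<close>
  have m': "m * norm f \<le> norm (T \<rhd> f)" if f: "\<And>e. e \<in> E \<Longrightarrow> fock_cinner f e = 0" for f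
  proof -
    let ?R = "closure (range (app (adj T)))"
    have clI: "x \<in> ?R" if "\<forall>i. w i \<in> range (app (adj T))" "w \<longlonglongrightarrow> x" for w :: "nat \<Rightarrow> 'n fock" and x
      unfolding closure_sequential by (intro exI[of _ w] conjI that)
    have sub: "fock.subspace ?R"
    proof -
      have add: "x + y \<in> ?R" if xy: "x \<in> ?R" "y \<in> ?R" for x y
      proof -
        obtain u where u: "\<And>i. u i \<in> range (app (adj T))" "u \<longlonglongrightarrow> x"
          using xy(1) unfolding closure_sequential by blast
        obtain v where v: "\<And>i. v i \<in> range (app (adj T))" "v \<longlonglongrightarrow> y"
          using xy(2) unfolding closure_sequential by blast
        have "u i + v i \<in> range (app (adj T))" for i
        proof -
          obtain a b where "u i = adj T \<rhd> a" "v i = adj T \<rhd> b" using u(1)[of i] v(1)[of i] by blast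
          then have "u i + v i = adj T \<rhd> (a + b)" by (simp add: app_add_right)
          then show ?thesis by (rule range_eqI)
        qed
        then show ?thesis using clI[OF _ tendsto_add[OF u(2) v(2)]] by simp
      qed
      have sc: "c *\<^sub>C x \<in> ?R" if x: "x \<in> ?R" for c x
      proof -
        obtain u where u: "\<And>i. u i \<in> range (app (adj T))" "u \<longlonglongrightarrow> x"
          using x unfolding closure_sequential by blast
        have "c *\<^sub>C u i \<in> range (app (adj T))" for i
        proof -
          obtain a where "u i = adj T \<rhd> a" using u(1)[of i] by blast
          then have "c *\<^sub>C u i = adj T \<rhd> (c *\<^sub>C a)" by (simp add: app_scale_right)
          then show ?thesis by (rule range_eqI)
        qed
        then show ?thesis using clI[OF _ bounded_linear.tendsto[OF bounded_linear_scaleC u(2), of c]] by simp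
      qed
      have "adj T \<rhd> 0 \<in> ?R" by (rule subsetD[OF closure_subset rangeI])
      then have "0 \<in> ?R" by simp
      then show ?thesis unfolding fock.subspace_def using add sc by blast
    qed
    obtain p where p: "p \<in> ?R" "\<And>s. s \<in> ?R \<Longrightarrow> fock_cinner (f - p) s = 0"
      using fock_projection[OF sub closed_closure] by blast
    have rangeE: "fock_cinner s e = 0" if se: "s \<in> ?R" "e \<in> E" for s e
    proof -
      obtain u where u: "\<And>i. u i \<in> range (app (adj T))" "u \<longlonglongrightarrow> s"
        using se(1) unfolding closure_sequential by blast
      have "fock_cinner (u i) e = 0" for i
      proof -
        obtain h where "u i = adj T \<rhd> h" using u(1)[of i] by blast
        then show ?thesis by (simp add: cinner_adj' Te[OF se(2)])
      qed
      then show ?thesis using cinner_tendsto[OF u(2), of e] by (simp add: LIMSEQ_const_iff)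
    qed
    \<comment> \<open>\<open>f - p\<close> is orthogonal to the range of the adjoint, hence in the
      kernel of \<open>T\<close>; but \<open>f\<close> and \<open>p\<close> are both orthogonal to
      that kernel, so they coincide.\<close>
    have "T \<rhd> (f - p) = 0"
    proof (rule cinner_eqI)
      fix h
      have "adj T \<rhd> h \<in> ?R" by (rule subsetD[OF closure_subset rangeI])
      then show "fock_cinner (T \<rhd> (f - p)) h = fock_cinner 0 h" by (simp add: cinner_adj p(2))
    qed
    then have "proj E \<rhd> (f - p) = f - p" using E by (intro proj_span) auto
    moreover have "proj E \<rhd> (f - p) = 0"
      by (rule proj_zero) (simp add: cinner_diff_left f rangeE[OF p(1)])
    ultimately have "f \<in> ?R" using p(1) by simp
    then obtain u where u: "\<And>i. u i \<in> range (app (adj T))" "u \<longlonglongrightarrow> f"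
      unfolding closure_sequential by blast
    have "m * norm (u i) \<le> norm (T \<rhd> u i)" for i
    proof -
      obtain h where h: "u i = adj T \<rhd> h" using u(1)[of i] by blast
      define g where "g = h - proj E' \<rhd> h"
      have "adj T \<rhd> (proj E' \<rhd> h) = 0" using proj_in_span[of E' h] unfolding E'(2) by blast
      then have ug: "u i = adj T \<rhd> g" by (simp add: h g_def app_diff_right)
      have go: "fock_cinner g e = 0" if "e \<in> E'" for e using cinner_proj[OF E'(1) that, of h] by (simp add: g_def cinner_diff_left)
      have "(norm (u i))\<^sup>2 = cmod (fock_cinner (T \<rhd> u i) g)"
        unfolding cinner_adj ug[symmetric] cinner_self by (simp add: norm_power)
      also have "\<dots> \<le> norm (T \<rhd> u i) * norm g" by (rule cinner_cauchy_schwarz)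
      finally have a: "m * (norm (u i))\<^sup>2 \<le> norm (T \<rhd> u i) * (m * norm g)" using m(1) by simp
      also have "\<dots> \<le> norm (T \<rhd> u i) * norm (u i)" using m(2)[OF go] unfolding ug[symmetric] by (intro mult_left_mono) auto
      finally have "(m * norm (u i)) * norm (u i) \<le> norm (T \<rhd> u i) * norm (u i)" by (simp add: power2_eq_square mult.assoc)
      then show ?thesis by (cases "norm (u i) = 0") (auto simp: mult_le_cancel_right)
    qed
    then show ?thesis
      by (intro LIMSEQ_le[of "\<lambda>i. m * norm (u i)" _ "\<lambda>i. norm (T \<rhd> u i)"])
         (auto intro!: tendsto_intros u bounded_linear.tendsto[OF bounded_linear_app])
  qed
  \<comment> \<open>The summand 1 keeps the denominator positive.\<close>
  define c where "c = 1 / ((norm T)\<^sup>2 + 1)"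
  have c: "c > 0" "c * (norm T)\<^sup>2 \<le> 1" "c * (norm (adj T))\<^sup>2 \<le> 1"
    by (auto simp: c_def norm_adj add_nonneg_pos divide_le_eq_1 sum_power2_gt_zero_iff)
  obtain q where q: "0 \<le> q" "q < 1" "\<And>k. norm ((1 - c *\<^sub>R (adj T * T)) ^ k - proj E) \<le> q ^ k"
    using power_to_projection[OF E(1) Te m(1) m' c(1,2)] by blast
  obtain q' where q': "0 \<le> q'" "q' < 1" "\<And>k. norm ((1 - c *\<^sub>R (T * adj T)) ^ k - proj E') \<le> q' ^ k"
    using power_to_projection[OF E'(1) Te' m c(1,3)] by auto
  \<comment> \<open>The partial sums are \<open>par\<close> at stage 0, so \<open>par_defect\<close>
    evaluates \<open>T\<close> times them. The series converges geometrically because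
    \<open>proj E * adj T = 0\<close> allows the powers to be replaced by their distance from
    \<open>proj E\<close>.\<close>
  have inv: "\<exists>R. T * R = 1 - proj E'"
  proof -
    let ?b = "\<lambda>i. c *\<^sub>R ((1 - c *\<^sub>R (adj T * T)) ^ i * adj T)"
    have PT: "proj E * adj T = 0"
      by (rule fop_eqI) (simp add: app_mult proj_zero cinner_adj' Te)
    have "summable ?b"
    proof (rule summable_comparison_test'[where N=0])
      show "summable (\<lambda>i. c * norm T * q ^ i)" using q by (intro summable_mult summable_geometric) auto
      fix i :: nat
      have "(1 - c *\<^sub>R (adj T * T)) ^ i * adj T = ((1 - c *\<^sub>R (adj T * T)) ^ i - proj E) * adj T"
        by (simp add: left_diff_distrib PT)
      then have "norm ((1 - c *\<^sub>R (adj T * T)) ^ i * adj T) \<le> norm ((1 - c *\<^sub>R (adj T * T)) ^ i - proj E) * norm (adj T)"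
        by (simp only: norm_mult_ineq)
      also have "\<dots> \<le> q ^ i * norm (adj T)" by (intro mult_right_mono q) auto
      finally have "norm ((1 - c *\<^sub>R (adj T * T)) ^ i * adj T) \<le> q ^ i * norm T" by (simp add: norm_adj)
      from mult_left_mono[OF this, of c] c(1) show "norm (?b i) \<le> c * norm T * q ^ i" by (simp add: mult_ac)
    qed
    then obtain R where R: "(\<lambda>k. \<Sum>i<k. ?b i) \<longlonglongrightarrow> R" by (auto simp: summable_def sums_def)
    have "(\<lambda>k. T * (\<Sum>i<k. ?b i)) \<longlonglongrightarrow> T * R" by (intro tendsto_intros R)
    moreover have "T * (\<Sum>i<k. ?b i) = 1 - (1 - c *\<^sub>R (T * adj T)) ^ k" for k
      using par_defect(2)[of T c k "adj T" 0] by (simp add: algebra_simps)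
    moreover have "(\<lambda>k. 1 - (1 - c *\<^sub>R (T * adj T)) ^ k) \<longlonglongrightarrow> 1 - proj E'"
    proof (intro tendsto_intros)
      have "(\<lambda>k. (1 - c *\<^sub>R (T * adj T)) ^ k - proj E') \<longlonglongrightarrow> 0"
        by (rule Lim_null_comparison[OF always_eventually[OF allI], OF q'(3)]) (rule LIMSEQ_power_zero, use q' in simp)
      then show "(\<lambda>k. (1 - c *\<^sub>R (T * adj T)) ^ k) \<longlonglongrightarrow> proj E'" by (subst Lim_null)
    qed
    ultimately have "T * R = 1 - proj E'" using LIMSEQ_unique by (simp only:) blast
    then show ?thesis by blast
  qed
  have range: "f \<in> range (app T) \<longleftrightarrow> proj E' \<rhd> f = 0" for f
  proof
    assume "f \<in> range (app T)"
    then obtain x where "f = T \<rhd> x" by blast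
    then show "proj E' \<rhd> f = 0" by (intro proj_zero) (simp add: cinner_adj Te')
  next
    assume f: "proj E' \<rhd> f = 0"
    obtain R where R: "T * R = 1 - proj E'" using inv by blast
    have "T \<rhd> (R \<rhd> f) = (1 - proj E') \<rhd> f" unfolding R[symmetric] app_mult ..
    also have "\<dots> = f" by (simp add: app_diff_left f)
    finally have "f = T \<rhd> (R \<rhd> f)" ..
    then show "f \<in> range (app T)" by (rule range_eqI)
  qed
  have cB: "card B = card E'" by (rule quotient_basis_card[OF E'(1) range B])
  have cE: "fock.dim {f. T \<rhd> f = 0} = card E"
    using fock.dim_eq_card_independent[OF orthonormal_independent[OF E(1)]] fock.dim_span[of E] by (simp add: E(2))
  obtain k where k: "q ^ k < 1/100" "q' ^ k < 1/100"
  proof -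
    define Q where "Q = max q q'"
    have Q: "Q < 1" "0 \<le> Q" using q q' by (auto simp: Q_def)
    obtain k where "Q ^ k < 1/100" using real_arch_pow_inv[of "1/100" Q] Q by auto
    moreover have "q ^ k \<le> Q ^ k" "q' ^ k \<le> Q ^ k" using q q' by (auto simp: Q_def intro!: power_mono)
    ultimately show ?thesis by (intro that[of k]) auto
  qed
  have n0: "norm ((1 - c *\<^sub>R (adj T * T)) ^ k - proj E) < 1/100" using q(3)[of k] k by linarith
  have n1: "norm ((1 - c *\<^sub>R (T * adj T)) ^ k - proj E') < 1/100" using q'(3)[of k] k by linarith
  obtain P P' where P: "P * P = P" "adj P = P" "pop * P * pop = P" "norm (P - proj E) < 1"
    and P': "P' * P' = P'" "adj P' = P'" "pop * P' * pop = P'" "norm (P' - proj E') < 1"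
    and ptrace: "ptrace P + ptrace P' = 2 * of_real (pi ^ CARD('n))"
    by (rule twisted_index_formula[OF C1 odd proj_idem[OF E(1)] norm_proj[OF E(1)] proj_idem[OF E'(1)] norm_proj[OF E'(1)] n0 n1])
  obtain a :: int where a: "ptrace P = (2 * pi) ^ CARD('n) * of_int a" "even a \<longleftrightarrow> even (card E)"
    by (rule ptrace_projection[OF P(1-3) E(1) P(4)])
  obtain b :: int where b: "ptrace P' = (2 * pi) ^ CARD('n) * of_int b" "even b \<longleftrightarrow> even (card E')"
    by (rule ptrace_projection[OF P'(1-3) E'(1) P'(4)])
  have "complex_of_real (pi ^ CARD('n)) * (2 ^ CARD('n) * of_int (a + b)) = complex_of_real (pi ^ CARD('n)) * 2"
    using ptrace unfolding a(1) b(1) by (simp add: power_mult_distrib algebra_simps)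
  then have "(of_int (2 ^ CARD('n) * (a + b)) :: complex) = of_int 2"
    by (simp only: mult_cancel_left) simp
  then have ab: "2 ^ CARD('n) * (a + b) = 2" by (simp only: of_int_eq_iff)
  \<comment> \<open>Halving the equation treats all dimensions at once: an even \<open>a + b\<close>
    would make 1 even. For \<open>CARD('n) > 1\<close> the equation has no integer solution at all,
    so such operators exist only in dimension one, if anywhere.\<close>
  have "odd (a + b)"
  proof
    assume "even (a + b)"
    then obtain d where d: "a + b = 2 * d" by blast
    have "CARD('n) \<noteq> 0" by simp
    then obtain j where j: "CARD('n) = Suc j" using not0_implies_Suc by blast
    have "2 * (d * 2 ^ j) = 1" using ab unfolding j d by simp
    then have "even (1 :: int)" by (metis dvd_triv_left)
    then show False by simp
  qed
  then have "odd (card E + card E')" using a(2) b(2) by simp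
  then show ?thesis unfolding cB cE by simp
qed

theorem corollary3p8:
  fixes A :: "'n::finite fock \<Rightarrow> 'n fock"
  assumes "A \<in> fock_C1"
    and "\<And>f. parity (A (parity f)) = - A f"
    and "fredholm A"
  shows "odd (fredholm_index A)"
proof -
  have "A \<in> fock_ops" using assms(3) by (simp add: fredholm_def)
  then obtain T where T: "A = app T" by (rule fock_ops_fop)
  have C1: "T \<in> C1" using assms(1) unfolding T by (rule fock_C1_fop)
  have odd: "pop * T * pop = - T"
    by (rule fop_eqI) (use assms(2) in \<open>simp add: app_mult app_minus_left T\<close>)
  obtain B0 where B0: "finite B0" "fock.span B0 = fock_ker A"
    using assms(3) by (auto simp: fredholm_def)
  have "\<exists>B. quotient_basis (range A) B" using assms(3) by (simp add: fredholm_def)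
  \<comment> \<open>\<open>odd_index\<close> holds for every quotient basis, so it applies in
    particular to the one chosen in \<open>quotient_dim\<close>.\<close>
  then have B: "quotient_basis (range A) (SOME B. quotient_basis (range A) B)" by (rule someI_ex)
  have kerT: "fock_ker A = {f. T \<rhd> f = 0}" by (simp add: fock_ker_def T)
  show ?thesis
    unfolding fredholm_index_def quotient_dim_def kerT unfolding T
    by (rule odd_index[OF C1 odd B0(1) B0(2)[unfolded kerT] B[unfolded T]])
qed

end
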